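(* For any $k\ge 1$ and any non-trivial finite words $w_1,\dots,w_k$ there is $N\in\mathbb{N}$ such that the following holds for all $n\ge N$. If $A\subseteq w_1(A_n)\cap\dots\cap w_k(A_n)$ satisfies $|A|\ge n^{-1/4}\,|w_1(A_n)\cap\dots\cap w_k(A_n)|$, then $A^3=A_n$.
   Context: $A_n$ is the alternating group on $\{1,\dots,n\}$. A word is an element $w$ of a free group of finite rank; it is non-trivial if it is not the identity. For a group $G$, $w(G)$ is the set of all elements of $G$ obtained by substituting arbitrary elements of $G$ for the free generators in $w$. $A^3=\{abc:a,b,c\in A\}$. *)

theory Defs
  imports Complex_Main "HOL-Algebra.Sym_Groups"
begin

text \<open>
  The letter \<open>(i, True)\<close> stands for the free generator \<open>x\<^sub>i\<close> and \<open>(i, False)\<close> for its formal inverse.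
\<close>

type_synonym letter = "nat \<times> bool"

definition letter_inv :: "letter \<Rightarrow> letter"
  where "letter_inv x = (fst x, \<not> snd x)"

definition reduced :: "letter list \<Rightarrow> bool"
  where "reduced xs \<longleftrightarrow> successively (\<lambda>x y. y \<noteq> letter_inv x) xs"

fun push_letter :: "letter \<Rightarrow> letter list \<Rightarrow> letter list" where
  "push_letter x [] = [x]"
| "push_letter x (y # ys) = (if y = letter_inv x then ys else x # y # ys)"

text \<open>
  The free group of rank \<open>r\<close> on \<open>x\<^sub>0, \<dots>, x\<^bsub>r-1\<^esub>\<close>, realised on reduced words. The product of
  two reduced words is the reduced form of their concatenation: the letters of the left factor are
  prepended to the right factor from the last to the first, cancelling whenever possible.
\<close>

definition free_group :: "nat \<Rightarrow> letter list monoid"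
  where "free_group r =
    \<lparr> carrier = {xs. reduced xs \<and> fst ` set xs \<subseteq> {..<r}},
      mult = foldr push_letter,
      one = [] \<rparr>"

definition letter_value :: "('a, 'b) monoid_scheme \<Rightarrow> (nat \<Rightarrow> 'a) \<Rightarrow> letter \<Rightarrow> 'a"
  where "letter_value G g x = (if snd x then g (fst x) else inv\<^bsub>G\<^esub> (g (fst x)))"

definition word_value :: "('a, 'b) monoid_scheme \<Rightarrow> (nat \<Rightarrow> 'a) \<Rightarrow> letter list \<Rightarrow> 'a"
  where "word_value G g w = foldr (\<lambda>x a. letter_value G g x \<otimes>\<^bsub>G\<^esub> a) w \<one>\<^bsub>G\<^esub>"

definition word_image :: "('a, 'b) monoid_scheme \<Rightarrow> nat \<Rightarrow> letter list \<Rightarrow> 'a set"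
  where "word_image G r w = {word_value G g w | g. g \<in> {..<r} \<rightarrow> carrier G}"


text \<open>
  The construction is a group with the universal property of a free group.
\<close>

lemma letter_inv_simps [simp]:
  "letter_inv (letter_inv x) = x" "fst (letter_inv x) = fst x"
  "letter_inv x \<noteq> x" "x \<noteq> letter_inv x"
  by (cases x; auto simp: letter_inv_def)+

lemma reduced_Nil [simp]: "reduced []"
  and reduced_single [simp]: "reduced [x]"
  and reduced_Cons_Cons [simp]:
    "reduced (x # y # ys) \<longleftrightarrow> y \<noteq> letter_inv x \<and> reduced (y # ys)"
  by (auto simp: reduced_def)

lemma reduced_tl: "reduced (x # xs) \<Longrightarrow> reduced xs"
  by (cases xs) auto

lemma reduced_push: "reduced xs \<Longrightarrow> reduced (push_letter x xs)"
  by (cases xs) (auto dest: reduced_tl)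

lemma reduced_foldr_push: "reduced ys \<Longrightarrow> reduced (foldr push_letter xs ys)"
  by (induction xs) (auto simp: reduced_push)

lemma set_push: "set (push_letter x xs) \<subseteq> insert x (set xs)"
  by (cases xs) auto

lemma set_foldr_push: "set (foldr push_letter xs ys) \<subseteq> set xs \<union> set ys"
proof (induction xs)
  case (Cons x xs)
  then show ?case using set_push[of x "foldr push_letter xs ys"] by auto
qed simp

lemma push_push_inv: "reduced xs \<Longrightarrow> push_letter x (push_letter (letter_inv x) xs) = xs"
  by (cases xs rule: list.exhaust; cases "tl xs") auto

lemma foldr_push_push:
  assumes "reduced vs"
  shows "foldr push_letter (push_letter x us) vs = push_letter x (foldr push_letter us vs)"
proof (cases us)
  case (Cons u us')
  then show ?thesis
    using push_push_inv[OF reduced_foldr_push[OF assms], of x us'] by auto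
qed simp

lemma foldr_push_assoc:
  "reduced zs \<Longrightarrow>
    foldr push_letter (foldr push_letter xs ys) zs = foldr push_letter xs (foldr push_letter ys zs)"
  by (induction xs) (auto simp: foldr_push_push)

lemma foldr_push_reduced: "reduced xs \<Longrightarrow> foldr push_letter xs [] = xs"
proof (induction xs)
  case (Cons x xs)
  then have "foldr push_letter xs [] = xs" by (auto dest: reduced_tl)
  then show ?case using Cons.prems by (cases xs) auto
qed simp

lemma foldr_push_left_inv: "foldr push_letter (rev (map letter_inv xs)) xs = []"
  by (induction xs) auto

lemma foldr_push_left_inv_reduced:
  assumes "reduced xs"
  shows "foldr push_letter (foldr push_letter (rev (map letter_inv xs)) []) xs = []"
  using foldr_push_assoc[OF assms, of "rev (map letter_inv xs)" "[]"] foldr_push_left_inv by simp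

lemma free_group_is_group: "group (free_group r)"
proof (rule groupI)
  fix xs assume "xs \<in> carrier (free_group r)"
  then have xs: "reduced xs" "fst ` set xs \<subseteq> {..<r}"
    by (auto simp: free_group_def)
  let ?ys = "foldr push_letter (rev (map letter_inv xs)) []"
  have "set ?ys \<subseteq> letter_inv ` set xs"
    using set_foldr_push[of "rev (map letter_inv xs)" "[]"] by auto
  then have "?ys \<in> carrier (free_group r)"
    using xs by (fastforce simp: free_group_def reduced_foldr_push)
  moreover have "?ys \<otimes>\<^bsub>free_group r\<^esub> xs = \<one>\<^bsub>free_group r\<^esub>"
    using foldr_push_left_inv_reduced[OF xs(1)] by (simp add: free_group_def)
  ultimately show "\<exists>ys\<in>carrier (free_group r). ys \<otimes>\<^bsub>free_group r\<^esub> xs = \<one>\<^bsub>free_group r\<^esub>"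
    by blast
next
  fix xs ys assume "xs \<in> carrier (free_group r)" "ys \<in> carrier (free_group r)"
  then show "xs \<otimes>\<^bsub>free_group r\<^esub> ys \<in> carrier (free_group r)"
    using set_foldr_push[of xs ys] by (fastforce simp: free_group_def reduced_foldr_push)
qed (auto simp: free_group_def foldr_push_assoc)

context group
begin

lemma letter_value_closed:
  "\<lbrakk>g \<in> {..<r} \<rightarrow> carrier G; fst x < r\<rbrakk> \<Longrightarrow> letter_value G g x \<in> carrier G"
  by (auto simp: letter_value_def Pi_def)

lemma word_value_closed:
  "\<lbrakk>g \<in> {..<r} \<rightarrow> carrier G; fst ` set w \<subseteq> {..<r}\<rbrakk> \<Longrightarrow> word_value G g w \<in> carrier G"
  by (induction w) (auto simp: word_value_def letter_value_closed)

lemma letter_value_inv: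
  "\<lbrakk>g \<in> {..<r} \<rightarrow> carrier G; fst x < r\<rbrakk> \<Longrightarrow>
    letter_value G g (letter_inv x) = inv (letter_value G g x)"
  by (auto simp: letter_value_def letter_inv_def Pi_def)

lemma word_value_push:
  assumes g: "g \<in> {..<r} \<rightarrow> carrier G" and x: "fst x < r" and w: "fst ` set w \<subseteq> {..<r}"
  shows "word_value G g (push_letter x w) = letter_value G g x \<otimes> word_value G g w"
proof (cases w)
  case Nil
  then show ?thesis by (simp add: word_value_def)
next
  case (Cons y ys)
  have "word_value G g ys \<in> carrier G" "letter_value G g x \<in> carrier G"
    using word_value_closed[OF g, of ys] letter_value_closed[OF g x] w Cons by auto
  then show ?thesis
    using Cons letter_value_inv[OF g x] by (auto simp: word_value_def m_assoc[symmetric])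
qed

lemma word_value_hom:
  assumes g: "g \<in> {..<r} \<rightarrow> carrier G"
  shows "word_value G g \<in> hom (free_group r) G"
proof (rule homI)
  fix xs assume "xs \<in> carrier (free_group r)"
  then show "word_value G g xs \<in> carrier G"
    using word_value_closed[OF g] by (auto simp: free_group_def)
next
  fix xs ys assume "xs \<in> carrier (free_group r)" "ys \<in> carrier (free_group r)"
  then have xs: "fst ` set xs \<subseteq> {..<r}" and ys: "fst ` set ys \<subseteq> {..<r}"
    by (auto simp: free_group_def)
  have "word_value G g (foldr push_letter xs ys) = word_value G g xs \<otimes> word_value G g ys"
    using xs
  proof (induction xs)
    case Nil
    then show ?case using word_value_closed[OF g ys] by (simp add: word_value_def)
  next
    case (Cons x xs)
    have "fst ` set (foldr push_letter xs ys) \<subseteq> {..<r}"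
      using Cons.prems ys set_foldr_push[of xs ys] by fastforce
    then have "word_value G g (foldr push_letter (x # xs) ys)
        = letter_value G g x \<otimes> (word_value G g xs \<otimes> word_value G g ys)"
      using Cons word_value_push[OF g, of x "foldr push_letter xs ys"] by simp
    also have "\<dots> = word_value G g (x # xs) \<otimes> word_value G g ys"
      using Cons.prems letter_value_closed[OF g, of x] word_value_closed[OF g, of xs]
        word_value_closed[OF g ys]
      by (simp add: word_value_def m_assoc)
    finally show ?case .
  qed
  then show "word_value G g (xs \<otimes>\<^bsub>free_group r\<^esub> ys) = word_value G g xs \<otimes> word_value G g ys"
    by (simp add: free_group_def)
qed

lemma word_value_generator:
  "\<lbrakk>g \<in> {..<r} \<rightarrow> carrier G; i < r\<rbrakk> \<Longrightarrow> word_value G g [(i, True)] = g i"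
  by (auto simp: word_value_def letter_value_def Pi_def)

lemma word_value_unique:
  assumes h: "h \<in> hom (free_group r) G" and w: "w \<in> carrier (free_group r)"
  shows "h w = word_value G (\<lambda>i. h [(i, True)]) w"
proof -
  interpret H: group_hom "free_group r" G h
    by (simp add: group_hom_def group_hom_axioms_def free_group_is_group is_group h)
  have letter: "h [x] = letter_value G (\<lambda>i. h [(i, True)]) x" if "fst x < r" for x
  proof (cases "snd x")
    case True
    then show ?thesis by (cases x) (simp add: letter_value_def)
  next
    case False
    then have x: "x = (fst x, False)" by (cases x) auto
    have c: "[(fst x, b)] \<in> carrier (free_group r)" for b
      using that by (simp add: free_group_def)
    have "[(fst x, False)] \<otimes>\<^bsub>free_group r\<^esub> [(fst x, True)] = \<one>\<^bsub>free_group r\<^esub>"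
      by (simp add: free_group_def letter_inv_def)
    then have "h [(fst x, False)] = inv (h [(fst x, True)])"
      using c by (metis H.hom_mult H.hom_one H.hom_closed inv_equality)
    then show ?thesis using x by (metis False letter_value_def)
  qed
  show ?thesis
    using w
  proof (induction w)
    case Nil
    then show ?case using H.hom_one by (simp add: word_value_def free_group_def)
  next
    case (Cons x xs)
    have c: "[x] \<in> carrier (free_group r)" "xs \<in> carrier (free_group r)" "fst x < r"
      using Cons.prems by (auto simp: free_group_def dest: reduced_tl)
    have "x # xs = [x] \<otimes>\<^bsub>free_group r\<^esub> xs"
      using Cons.prems by (cases xs) (auto simp: free_group_def)
    then have "h (x # xs) = h [x] \<otimes> h xs"
      using H.hom_mult[OF c(1,2)] by simp
    then show ?case
      using Cons.IH[OF c(2)] letter[OF c(3)] by (simp add: word_value_def)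
  qed
qed

end

end

theory Submission
  imports Defs "HOL-Analysis.Function_Topology" "HOL-Real_Asymp.Real_Asymp"
begin

text \<open>
  Write \<open>f\<close> for the indicator function of \<open>A\<close>, and call a function of \<open>\<sigma>\<close> of degree at most \<open>D\<close> if it is a
  combination of indicators of conditions prescribing \<open>\<sigma>\<close> at no more than \<open>D\<close> points. Split
  \<open>f = \<mu> + f\<^sub>l + f\<^sub>u\<close> into its mean, a part \<open>f\<^sub>l\<close> of bounded degree \<open>D\<close> and a part \<open>f\<^sub>u\<close> orthogonal to all
  functions of degree at most \<open>D\<close>. Convolution with a function orthogonal to low degrees has small
  operator norm: the top singular space is a right-invariant subspace, and
  such a space is large unless it contains functions of low degree, as one sees by decomposing it under
  commuting double transpositions. So \<open>f\<^sub>u\<close> is harmless once \<open>D\<close> is large compared with the exponent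
  of the density of \<open>A\<close>, while \<open>f\<^sub>l\<close> only has to be bounded better than trivially.

  For this, let \<open>W\<close> be the intersection of the word images, and \<open>F\<close> a function of bounded degree. Averaging
  \<open>F\<^sup>2\<close> over conjugation gives a class function that is a polynomial in the numbers of short cycles, and
  the moments of such a polynomial do not depend on \<open>n\<close>. Hence all its \<open>L\<^sup>q\<close> norms are
  comparable, and since \<open>W\<close> is normal with density at least \<open>n\<^bsup>-C\<^esup>\<close>, the mean of \<open>F\<^sup>2\<close> over \<open>W\<close>
  exceeds its mean over \<open>A\<^sub>n\<close> by a factor of at most \<open>n\<^bsup>o(1)\<^esup>\<close>. This makes \<open>f\<^sub>l\<close> as small as if \<open>A\<close> had density
  \<open>n\<^bsup>-1/4\<^esup>\<close> in the whole group.

  The density of \<open>W\<close> comes from one permutation with boundedly many cycles lying in all the word images. In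
  a tower of mod 2 homology covers of a bouquet of circles the girth grows, so at some level \<open>w\<close> lifts to closed
  loops all of which are homologically non-trivial; a further cyclic cover of large degree \<open>l\<close> unwinds these
  loops to cycles of length \<open>l\<close>.
\<close>

section \<open>Alternating groups\<close>

text \<open>The exponent 1/4 enters only through the low-degree term. With \<open>a = card A\<close>
  and \<open>g = card (Alt n)\<close>, the main term in the count of factorisations of a given
  element is \<open>a^3 / g\<close>, and the squared norm of the low-degree part is at most
  \<open>L = n^(1/4 + 1/32) * a^2 / g\<close>. The only cancellation used for this part is its
  vanishing mean, which is worth a factor \<open>n / 8\<close>: the square of the low-degree error
  is at most \<open>8 * g * L^3 / n\<close>, that is \<open>8 * n^(3/4 + 3/32 - 1)\<close> times the
  square of the main term. So three times the exponent has to stay below 1, and \<open>1/32\<close>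
  is a convenient bound for the loss written as o(1). The obstacle for the density is that several
  word images must share an element. A single word can be made to act with cycles of equal length
  \<open>l\<close>, provided that \<open>l\<close> is prime to certain winding numbers and the
  number of cycles is a multiple of a number depending on the word. Both demands can be met for all
  words at once, with \<open>l\<close> congruent to 1 modulo a common product.\<close>

abbreviation Alt :: "nat \<Rightarrow> (nat \<Rightarrow> nat) set"
  where "Alt n \<equiv> carrier (alt_group n)"

lemma Alt_iff: "p \<in> Alt n \<longleftrightarrow> p permutes {1..n} \<and> evenperm p"
  by (rule alt_group_carrier)

lemma finite_Alt [simp]: "finite (Alt n)"
  by (rule finite_subset[of _ "{p. p permutes {1..n}}"]) (auto simp: Alt_iff finite_permutations)

lemma Alt_id [simp]: "id \<in> Alt n"
  by (simp add: Alt_iff permutes_id evenperm_id)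

lemma Alt_comp [simp]: "p \<in> Alt n \<Longrightarrow> q \<in> Alt n \<Longrightarrow> p \<circ> q \<in> Alt n"
  using alt_group_carrier'[of p n] alt_group_carrier'[of q n]
  by (auto simp: Alt_iff permutes_compose evenperm_comp)

lemma Alt_inv [simp]: "p \<in> Alt n \<Longrightarrow> inv' p \<in> Alt n"
  by (rule alt_group_inv_closed)

lemma Alt_permutes: "p \<in> Alt n \<Longrightarrow> p permutes {1..n}"
  by (simp add: Alt_iff)

lemma Alt_bij: "p \<in> Alt n \<Longrightarrow> bij p"
  by (rule permutes_bij[OF Alt_permutes])

lemma Alt_inv_o: "p \<in> Alt n \<Longrightarrow> inv' p \<circ> p = id" "p \<in> Alt n \<Longrightarrow> p \<circ> inv' p = id"
  by (auto simp: Alt_iff permutes_inv_o)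

lemma Alt_inv_simps [simp]:
  assumes "p \<in> Alt n"
  shows "inv' p (p x) = x" "p (inv' p x) = x" "inv' (inv' p) = p"
  using Alt_permutes[OF assms] Alt_bij[OF assms]
  by (auto simp: permutes_inverses inv_inv_eq)

lemma Alt_image_eq: "p \<in> Alt n \<Longrightarrow> p x \<in> {1..n} \<longleftrightarrow> x \<in> {1..n}"
  by (rule permutes_in_image[OF Alt_permutes])

lemma Alt_eqI:
  assumes "p \<in> Alt n" "q \<in> Alt n" "\<And>x. x \<in> {1..n} \<Longrightarrow> p x = q x"
  shows "p = q"
proof
  fix x show "p x = q x"
    using assms Alt_permutes[THEN permutes_not_in, of p n x] Alt_permutes[THEN permutes_not_in, of q n x]
    by (cases "x \<in> {1..n}") simp_all
qed

lemma card_Alt_pos [simp]: "0 < card (Alt n)"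
  using Alt_id finite_Alt card_gt_0_iff by blast

lemma bij_betw_Alt_right: "z \<in> Alt n \<Longrightarrow> bij_betw (\<lambda>x. x \<circ> z) (Alt n) (Alt n)"
  by (rule bij_betwI[where g = "\<lambda>x. x \<circ> inv' z"]) (auto simp: comp_assoc Alt_inv_o)

lemma bij_betw_Alt_left: "z \<in> Alt n \<Longrightarrow> bij_betw (\<lambda>x. z \<circ> x) (Alt n) (Alt n)"
  by (rule bij_betwI[where g = "\<lambda>x. inv' z \<circ> x"]) (auto simp: comp_assoc[symmetric] Alt_inv_o)

lemma bij_betw_Alt_inv: "bij_betw inv' (Alt n) (Alt n)"
  by (rule bij_betwI[where g = inv']) auto

lemma sum_Alt_right: "z \<in> Alt n \<Longrightarrow> (\<Sum>x\<in>Alt n. f (x \<circ> z)) = (\<Sum>x\<in>Alt n. f x)"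
  by (rule sum.reindex_bij_betw[OF bij_betw_Alt_right])

lemma sum_Alt_left: "z \<in> Alt n \<Longrightarrow> (\<Sum>x\<in>Alt n. f (z \<circ> x)) = (\<Sum>x\<in>Alt n. f x)"
  by (rule sum.reindex_bij_betw[OF bij_betw_Alt_left])

lemma sum_Alt_inv: "(\<Sum>x\<in>Alt n. f (inv' x)) = (\<Sum>x\<in>Alt n. f x)"
  by (rule sum.reindex_bij_betw[OF bij_betw_Alt_inv])

lemma Alt_inv_comp: "p \<in> Alt n \<Longrightarrow> q \<in> Alt n \<Longrightarrow> inv' (p \<circ> q) = inv' q \<circ> inv' p"
  by (simp add: Alt_bij o_inv_distrib)

lemma permutes_extend:
  assumes f: "bij_betw f X Y" and S: "X \<subseteq> S" "Y \<subseteq> S" "finite S"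
  obtains g where "g permutes S" "\<And>x. x \<in> X \<Longrightarrow> g x = f x"
proof -
  have "card (S - X) = card (S - Y)"
    using bij_betw_same_card[OF f] S by (simp add: card_Diff_subset finite_subset)
  then obtain b where b: "bij_betw b (S - X) (S - Y)"
    using S by (meson finite_Diff finite_same_card_bij)
  define g where "g x = (if x \<in> X then f x else if x \<in> S then b x else x)" for x
  have "bij_betw g X Y"
    using f by (rule iffD1[OF bij_betw_cong, rotated]) (simp add: g_def)
  moreover have "bij_betw g (S - X) (S - Y)"
    using b by (rule iffD1[OF bij_betw_cong, rotated]) (simp add: g_def)
  ultimately have "bij_betw g (X \<union> (S - X)) (Y \<union> (S - Y))"
    by (rule bij_betw_combine) blast
  moreover have "X \<union> (S - X) = S" "Y \<union> (S - Y) = S" using S by auto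
  ultimately have "g permutes S"
    using S(1) by (intro bij_imp_permutes) (auto simp: g_def)
  then show ?thesis using that[of g] by (auto simp: g_def)
qed

text \<open>At least two points remain outside \<open>X\<close>; composing with their transposition
  repairs the parity and leaves the values on \<open>X\<close> alone.\<close>

lemma Alt_extend:
  assumes f: "bij_betw f X Y" and X: "X \<subseteq> {1..n}" "Y \<subseteq> {1..n}" "card X + 2 \<le> n"
  obtains g where "g \<in> Alt n" "\<And>x. x \<in> X \<Longrightarrow> g x = f x"
proof -
  obtain g where g: "g permutes {1..n}" "\<And>x. x \<in> X \<Longrightarrow> g x = f x"
    using permutes_extend[OF f X(1,2)] by blast
  have "card ({1..n} - X) \<ge> 2"
    using X by (simp add: card_Diff_subset finite_subset)
  then obtain T where "T \<subseteq> {1..n} - X" "card T = 2"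
    by (meson obtain_subset_with_card_n)
  then obtain a b where ab: "a \<in> {1..n} - X" "b \<in> {1..n} - X" "a \<noteq> b"
    unfolding card_2_iff by blast
  have perm: "permutation g" using g(1) permutation_permutes by blast
  have tr: "transpose a b permutes {1..n}" using ab by (intro permutes_swap_id) auto
  show ?thesis
  proof (cases "evenperm g")
    case True
    then show ?thesis using g that by (auto simp: Alt_iff)
  next
    case False
    have "evenperm (g \<circ> transpose a b)"
      using False ab(3) perm by (simp add: evenperm_comp permutation_swap_id evenperm_swap)
    then have "g \<circ> transpose a b \<in> Alt n"
      using permutes_compose[OF tr g(1)] by (simp add: Alt_iff)
    moreover have "(g \<circ> transpose a b) x = f x" if "x \<in> X" for x
      using that ab g(2) by (auto simp: transpose_def)
    ultimately show ?thesis using that by blast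
  qed
qed

section \<open>Covers in which a word winds\<close>

text \<open>Permutations \<open>y i\<close> of a vertex set are the same thing as a labelled
  covering graph of a bouquet of circles: the edge with label \<open>i\<close> runs from
  \<open>v\<close> to \<open>y i v\<close>. Words act by composition, so a path reads its word from
  the last letter to the first.\<close>

definition act :: "(nat \<Rightarrow> 'a \<Rightarrow> 'a) \<Rightarrow> letter \<Rightarrow> 'a \<Rightarrow> 'a"
  where "act y x = (if snd x then y (fst x) else inv' (y (fst x)))"

definition wact :: "(nat \<Rightarrow> 'a \<Rightarrow> 'a) \<Rightarrow> letter list \<Rightarrow> 'a \<Rightarrow> 'a"
  where "wact y w = foldr (\<lambda>x f. act y x \<circ> f) w id"

lemma wact_simps [simp]: "wact y [] v = v" "wact y (x # w) v = act y x (wact y w v)"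
  by (simp_all add: wact_def)

lemma wact_append: "wact y (u @ w) v = wact y u (wact y w v)"
  by (induction u) simp_all

text \<open>An edge is named by its label and its starting point in the positive direction, so that
  traversing it backwards gives the same name.\<close>

definition crossing :: "(nat \<Rightarrow> 'a \<Rightarrow> 'a) \<Rightarrow> letter \<Rightarrow> 'a \<Rightarrow> nat \<times> 'a"
  where "crossing y x v = (fst x, if snd x then v else inv' (y (fst x)) v)"

text \<open>The mod 2 chain of the path along \<open>w\<close> from \<open>v\<close>. A graph has no
  2-cells, so a closed path is trivial in mod 2 homology iff this set is empty.\<close>

fun odd_edges :: "(nat \<Rightarrow> 'a \<Rightarrow> 'a) \<Rightarrow> letter list \<Rightarrow> 'a \<Rightarrow> (nat \<times> 'a) set" where
  "odd_edges y [] v = {}"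
| "odd_edges y (x # w) v = sym_diff (odd_edges y w v) {crossing y x (wact y w v)}"

text \<open>The integral chain of the path, evaluated on the 1-cochain \<open>c\<close>.\<close>

fun signed_sum :: "(nat \<Rightarrow> 'a \<Rightarrow> 'a) \<Rightarrow> (nat \<times> 'a \<Rightarrow> int) \<Rightarrow> letter list \<Rightarrow> 'a \<Rightarrow> int" where
  "signed_sum y c [] v = 0"
| "signed_sum y c (x # w) v = signed_sum y c w v
     + (if snd x then 1 else -1) * c (crossing y x (wact y w v))"

definition over :: "nat \<Rightarrow> letter list \<Rightarrow> bool"
  where "over r w \<longleftrightarrow> fst ` set w \<subseteq> {..<r}"

lemma over_simps [simp]: "over r []" "over r (x # w) \<longleftrightarrow> fst x < r \<and> over r w"
  "over r (u @ w) \<longleftrightarrow> over r u \<and> over r w"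
  by (auto simp: over_def)

definition graph_on :: "nat \<Rightarrow> 'a set \<Rightarrow> (nat \<Rightarrow> 'a \<Rightarrow> 'a) \<Rightarrow> bool"
  where "graph_on r S y \<longleftrightarrow> finite S \<and> S \<noteq> {} \<and> (\<forall>i<r. y i permutes S)"

lemma act_permutes: "graph_on r S y \<Longrightarrow> fst x < r \<Longrightarrow> act y x permutes S"
  by (auto simp: graph_on_def act_def permutes_inv)

lemma act_in: "graph_on r S y \<Longrightarrow> fst x < r \<Longrightarrow> act y x v \<in> S \<longleftrightarrow> v \<in> S"
  using permutes_in_image[OF act_permutes] .

lemma wact_in: "graph_on r S y \<Longrightarrow> over r w \<Longrightarrow> v \<in> S \<Longrightarrow> wact y w v \<in> S"
  by (induction w) (simp_all add: act_in)

lemma crossing_in: "graph_on r S y \<Longrightarrow> fst x < r \<Longrightarrow> v \<in> S \<Longrightarrow> crossing y x v \<in> {..<r} \<times> S"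
  using permutes_in_image[OF permutes_inv, of "y (fst x)" S v] by (auto simp: crossing_def graph_on_def)

lemma odd_edges_subset: "graph_on r S y \<Longrightarrow> over r w \<Longrightarrow> v \<in> S \<Longrightarrow> odd_edges y w v \<subseteq> {..<r} \<times> S"
proof (induction w)
  case (Cons x w)
  then have "crossing y x (wact y w v) \<in> {..<r} \<times> S"
    by (intro crossing_in wact_in) auto
  then show ?case using Cons by auto
qed simp

lemma odd_signed_sum: "odd (signed_sum y (\<lambda>f. of_bool (f = e)) w v) \<longleftrightarrow> e \<in> odd_edges y w v"
  by (induction w) auto

lemma signed_sum_linear:
  "signed_sum y (\<lambda>e. m * c e + d e) w v = m * signed_sum y c w v + signed_sum y d w v"
  by (induction w) (auto simp: algebra_simps)

text \<open>Adding a \<open>d\<close> that works at the new index \<open>u\<close> to a large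
  multiple of \<open>c\<close> repairs \<open>u\<close>; the factor \<open>m\<close> exceeds every
  \<open>|L d v|\<close>, so nothing cancels at the old indices.\<close>

lemma generic_cochain:
  fixes L :: "('e \<Rightarrow> int) \<Rightarrow> 'v \<Rightarrow> int"
  assumes lin: "\<And>m c d v. L (\<lambda>e. m * c e + d e) v = m * L c v + L d v"
    and S: "finite S" "\<And>v. v \<in> S \<Longrightarrow> \<exists>c. L c v \<noteq> 0"
  shows "\<exists>c. \<forall>v\<in>S. L c v \<noteq> 0"
  using S
proof (induction S)
  case (insert u S)
  then obtain c where c: "\<forall>v\<in>S. L c v \<noteq> 0" by auto
  show ?case
  proof (cases "L c u = 0")
    case False
    then show ?thesis using c by auto
  next
    case True
    obtain d where d: "L d u \<noteq> 0" using insert.prems by auto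
    define m where "m = 1 + (\<Sum>v\<in>S. \<bar>L d v\<bar>)"
    have "L (\<lambda>e. m * c e + d e) v \<noteq> 0" if "v \<in> insert u S" for v
    proof (cases "v = u")
      case True
      then show ?thesis using \<open>L c u = 0\<close> d by (simp add: lin)
    next
      case False
      then have v: "v \<in> S" using that by simp
      have "\<bar>L d v\<bar> \<le> (\<Sum>v\<in>S. \<bar>L d v\<bar>)" using insert.hyps(1) v by (intro member_le_sum) auto
      then have "\<bar>L d v\<bar> < m" by (simp add: m_def)
      also have "m \<le> m * \<bar>L c v\<bar>"
      proof -
        have "L c v \<noteq> 0" using c v by blast
        then have "1 \<le> \<bar>L c v\<bar>" by linarith
        then show ?thesis using mult_left_mono[of 1 "\<bar>L c v\<bar>" m] \<open>\<bar>L d v\<bar> < m\<close> by simp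
      qed
      also have "m * \<bar>L c v\<bar> = \<bar>m * L c v\<bar>" using \<open>\<bar>L d v\<bar> < m\<close> by (simp add: abs_mult)
      finally show ?thesis by (auto simp: lin)
    qed
    then show ?thesis by blast
  qed
qed simp

section \<open>Girth, transitivity and mod 2 homology covers\<close>

definition has_girth :: "nat \<Rightarrow> 'a set \<Rightarrow> (nat \<Rightarrow> 'a \<Rightarrow> 'a) \<Rightarrow> nat \<Rightarrow> bool"
  where "has_girth r S y k \<longleftrightarrow>
    (\<forall>u v. over r u \<longrightarrow> reduced u \<longrightarrow> u \<noteq> [] \<longrightarrow> v \<in> S \<longrightarrow> wact y u v = v \<longrightarrow> k < length u)"

text \<open>Regularity of the cover, expressed by a transitive group of label-preserving
  automorphisms: what happens along \<open>w\<close> at one vertex happens at every vertex.\<close>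

definition homogeneous :: "nat \<Rightarrow> 'a set \<Rightarrow> (nat \<Rightarrow> 'a \<Rightarrow> 'a) \<Rightarrow> bool"
  where "homogeneous r S y \<longleftrightarrow> (\<forall>u\<in>S. \<forall>v\<in>S. \<exists>\<alpha>. bij_betw \<alpha> S S \<and>
    (\<forall>i<r. \<forall>p\<in>S. \<alpha> (y i p) = y i (\<alpha> p)) \<and> \<alpha> u = v)"

lemma odd_edges_split:
  "e \<in> odd_edges y w v \<Longrightarrow> \<exists>p x q. w = p @ x # q \<and> crossing y x (wact y q v) = e"
proof (induction w)
  case (Cons x w)
  show ?case
  proof (cases "e \<in> odd_edges y w v")
    case True
    then obtain p x' q where "w = p @ x' # q" "crossing y x' (wact y q v) = e" using Cons.IH by blast
    then show ?thesis by (intro exI[of _ "x # p"] exI[of _ x'] exI[of _ q]) simp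
  next
    case False
    then have "crossing y x (wact y w v) = e" using Cons.prems by auto
    then show ?thesis by (intro exI[of _ "[]"] exI[of _ x] exI[of _ w]) simp
  qed
qed simp

lemma reduced_appendD: "reduced (p @ q) \<Longrightarrow> reduced p" "reduced (p @ q) \<Longrightarrow> reduced q"
  by (auto simp: reduced_def successively_append_iff)

text \<open>
  The edge crossed last has been crossed before; the portion of the path between the two crossings
  closes up.
\<close>

lemma shorter_closed_word:
  assumes y: "graph_on r S y" and u: "over r u" "reduced u" "u \<noteq> []" and v: "v \<in> S"
    and closed: "odd_edges y u v = {}"
  shows "\<exists>u' v'. over r u' \<and> reduced u' \<and> u' \<noteq> [] \<and> v' \<in> S \<and> wact y u' v' = v' \<and> length u' < length u"
proof -
  obtain x u1 where u1: "u = x # u1" using u(3) by (cases u) auto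
  let ?e = "crossing y x (wact y u1 v)"
  have "?e \<in> odd_edges y u1 v" using closed u1 by auto
  then obtain p x' q where q: "u1 = p @ x' # q" "crossing y x' (wact y q v) = ?e"
    using odd_edges_split by metis
  have over: "fst x < r" "over r p" "fst x' < r" "over r q" using u(1) u1 q(1) by auto
  have red: "reduced (p @ [x'])" "reduced p"
    using u(2) reduced_appendD[of "[x]" u1] reduced_appendD[of "p @ [x']" q] reduced_appendD[of p "[x']"]
    by (auto simp: u1 q(1))
  have gen: "fst x' = fst x" using q(2) by (simp add: crossing_def)
  have inj: "inj (y (fst x))" "inj (inv' (y (fst x)))" "surj (y (fst x))"
    using y over(1) permutes_inj permutes_inv permutes_surj unfolding graph_on_def by metis+
  have qS: "wact y q v \<in> S" "wact y (x' # q) v \<in> S" 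
    using wact_in[OF y over(4) v] over(3) by (simp_all add: act_in[OF y])
  show ?thesis
  proof (cases "snd x' = snd x")
    \<comment> \<open>Same direction twice: both crossings start at the same vertex, and the letters
      \<open>p @ [x']\<close> lead from there back to it.\<close>
    case True
    then have "wact y q v = wact y u1 v"
      using q(2) gen inj(2) by (auto simp: crossing_def inj_eq split: if_splits)
    then have "wact y (p @ [x']) (wact y q v) = wact y q v" by (simp add: q(1) wact_append)
    moreover have "length (p @ [x']) < length u" by (simp add: u1 q(1))
    ultimately show ?thesis using over red qS(1)
      by (intro exI[of _ "p @ [x']"] exI[of _ "wact y q v"]) auto
  next
    case False
    \<comment> \<open>Opposite directions: the path returns to the edge at the vertex where it left
      it, so \<open>p\<close> closes up. It is non-empty because \<open>u\<close> is
      reduced.\<close>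
    then have x': "x' = letter_inv x" using gen by (cases x; cases x') (auto simp: letter_inv_def)
    have "wact y (x' # q) v = wact y u1 v"
    proof (cases "snd x")
      case True
      then show ?thesis using q(2) False gen by (simp add: crossing_def act_def)
    next
      case b: False
      then have "wact y q v = inv' (y (fst x)) (wact y u1 v)" using q(2) False gen by (simp add: crossing_def)
      then show ?thesis using b False gen inj(3) by (simp add: act_def surj_f_inv_f)
    qed
    then have "wact y p (wact y (x' # q) v) = wact y (x' # q) v" by (simp add: q(1) wact_append)
    moreover have "p \<noteq> []" using u(2) x' by (auto simp: u1 q(1))
    moreover have "length p < length u" by (simp add: u1 q(1))
    ultimately show ?thesis using over red qS(2)
      by (intro exI[of _ p] exI[of _ "wact y (x' # q) v"]) auto
  qed
qed

definition cover :: "nat \<Rightarrow> 'a set \<Rightarrow> (nat \<Rightarrow> 'a \<Rightarrow> 'a) \<Rightarrow> nat \<Rightarrow> 'a \<times> (nat \<times> 'a) set \<Rightarrow> 'a \<times> (nat \<times> 'a) set"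
  where "cover r S y i = (\<lambda>(v, s). if i < r \<and> v \<in> S \<and> s \<subseteq> {..<r} \<times> S then (y i v, sym_diff s {(i, v)}) else (v, s))"

abbreviation cover_set :: "nat \<Rightarrow> 'a set \<Rightarrow> ('a \<times> (nat \<times> 'a) set) set"
  where "cover_set r S \<equiv> S \<times> Pow ({..<r} \<times> S)"

lemma cover_permutes:
  assumes y: "graph_on r S y" and i: "i < r"
  shows "cover r S y i permutes cover_set r S"
    and "\<And>v s. v \<in> S \<Longrightarrow> s \<subseteq> {..<r} \<times> S \<Longrightarrow>
      inv' (cover r S y i) (v, s) = (inv' (y i) v, sym_diff s {(i, inv' (y i) v)})"
proof -
  have p: "y i permutes S" using y i by (simp add: graph_on_def)
  have S: "y i v \<in> S \<longleftrightarrow> v \<in> S" "inv' (y i) v \<in> S \<longleftrightarrow> v \<in> S" for v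
    using permutes_in_image[OF p] permutes_in_image[OF permutes_inv[OF p]] by auto
  have "bij_betw (cover r S y i) (cover_set r S) (cover_set r S)"
    by (rule bij_betwI[where g = "\<lambda>(v, s). (inv' (y i) v, sym_diff s {(i, inv' (y i) v)})"])
      (use i S permutes_inverses[OF p] in \<open>auto simp: cover_def split: if_splits\<close>)
  then show perm: "cover r S y i permutes cover_set r S"
    by (rule bij_imp_permutes) (auto simp: cover_def split: if_splits)
  fix v s assume v: "v \<in> S" "s \<subseteq> {..<r} \<times> S"
  let ?v = "inv' (y i) v"
  have "cover r S y i (?v, sym_diff s {(i, ?v)}) = (y i ?v, sym_diff (sym_diff s {(i, ?v)}) {(i, ?v)})"
    using v i S by (auto simp: cover_def)
  also have "\<dots> = (v, s)" using permutes_inverses(1)[OF p] by auto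
  finally show "inv' (cover r S y i) (v, s) = (?v, sym_diff s {(i, ?v)})"
    using permutes_inv_eq[OF perm] by metis
qed

lemma graph_on_cover: "graph_on r S y \<Longrightarrow> graph_on r (cover_set r S) (cover r S y)"
  unfolding graph_on_def using cover_permutes(1)[of r S y] by (auto simp: graph_on_def)

text \<open>It follows that a lifted path closes up exactly when the path below is closed and has
  empty mod 2 chain.\<close>

lemma wact_cover:
  assumes y: "graph_on r S y" and w: "over r w" and v: "v \<in> S" "s \<subseteq> {..<r} \<times> S"
  shows "wact (cover r S y) w (v, s) = (wact y w v, sym_diff s (odd_edges y w v))"
  using w
proof (induction w)
  case (Cons x w)
  let ?v = "wact y w v" and ?s = "sym_diff s (odd_edges y w v)"
  have IH: "wact (cover r S y) w (v, s) = (?v, ?s)" using Cons by simp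
  have x: "fst x < r" using Cons.prems by simp
  have "?v \<in> S" using wact_in[OF y _ v(1)] Cons.prems by simp
  moreover have "?s \<subseteq> {..<r} \<times> S" using odd_edges_subset[OF y _ v(1), of w] Cons.prems v(2) by auto
  ultimately have "act (cover r S y) x (?v, ?s) = (act y x ?v, sym_diff ?s {crossing y x ?v})"
    using cover_permutes(2)[OF y x] x by (auto simp: act_def crossing_def cover_def)
  moreover have "sym_diff ?s {crossing y x ?v} = sym_diff s (odd_edges y (x # w) v)" by auto
  ultimately show ?case using IH by simp
qed auto

text \<open>A closed path upstairs lies over a closed path with empty mod 2 chain; by
  \<open>shorter_closed_word\<close> the latter is longer than some non-trivial closed reduced path,
  which already has more than \<open>k\<close> letters.\<close>

lemma has_girth_cover:
  assumes y: "graph_on r S y" and k: "has_girth r S y k"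
  shows "has_girth r (cover_set r S) (cover r S y) (Suc k)"
  unfolding has_girth_def
proof (intro allI impI)
  fix u p assume u: "over r u" "reduced u" "u \<noteq> []" and p: "p \<in> cover_set r S" "wact (cover r S y) u p = p"
  obtain v s where vs: "p = (v, s)" "v \<in> S" "s \<subseteq> {..<r} \<times> S" using p(1) by auto
  have "sym_diff s (odd_edges y u v) = s" using wact_cover[OF y u(1) vs(2,3)] p(2) vs(1) by simp
  then have "odd_edges y u v = {}" by auto
  then obtain u' v' where "over r u'" "reduced u'" "u' \<noteq> []" "v' \<in> S" "wact y u' v' = v'" "length u' < length u"
    using shorter_closed_word[OF y u vs(2)] by blast
  then show "Suc k < length u" using k unfolding has_girth_def by fastforce
qed

lemma sym_diff_image:
  assumes "inj_on f E" "A \<subseteq> E" "B \<subseteq> E" shows "f ` sym_diff A B = sym_diff (f ` A) (f ` B)"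
  using assms by (auto simp: inj_on_def)

lemma homogeneous_cover:
  assumes y: "graph_on r S y" and h: "homogeneous r S y"
  shows "homogeneous r (cover_set r S) (cover r S y)"
  unfolding homogeneous_def
proof (intro ballI)
  fix p q assume "p \<in> cover_set r S" "q \<in> cover_set r S"
  then obtain v s v' s' where p: "p = (v, s)" "v \<in> S" "s \<subseteq> {..<r} \<times> S"
    and q: "q = (v', s')" "v' \<in> S" "s' \<subseteq> {..<r} \<times> S" by auto
  obtain \<alpha> where \<alpha>: "bij_betw \<alpha> S S" "\<And>i p. i < r \<Longrightarrow> p \<in> S \<Longrightarrow> \<alpha> (y i p) = y i (\<alpha> p)" "\<alpha> v = v'"
    using h p(2) q(2) unfolding homogeneous_def by blast
  define a where "a = (\<lambda>(i::nat, u). (i, \<alpha> u))"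
  let ?E = "{..<r} \<times> S"
  have \<alpha>S: "\<alpha> u \<in> S" if "u \<in> S" for u using \<alpha>(1) that by (auto simp: bij_betw_def)
  have a_inj: "inj_on a ?E" using \<alpha>(1) by (auto simp: a_def inj_on_def bij_betw_def)
  have a_img: "a ` ?E = ?E"
  proof -
    have "a ` ?E = {..<r} \<times> \<alpha> ` S" by (force simp: a_def)
    then show ?thesis using \<alpha>(1) by (simp add: bij_betw_def)
  qed
  \<comment> \<open>The automorphism \<open>\<alpha>\<close> lifts by moving chains along, and
    adding a fixed chain is an automorphism too; this \<open>\<delta>\<close> is what takes
    \<open>s\<close> to \<open>s'\<close>.\<close>
  define \<delta> where "\<delta> = sym_diff s' (a ` s)"
  have as: "a ` t \<subseteq> ?E" if "t \<subseteq> ?E" for t using a_img that by blast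
  have \<delta>: "\<delta> \<subseteq> ?E" using q(3) as[OF p(3)] by (auto simp: \<delta>_def)
  define \<beta> where "\<beta> = (\<lambda>(u, t). (\<alpha> u, sym_diff (a ` t) \<delta>))"
  have \<beta>_in: "\<beta> z \<in> cover_set r S" if "z \<in> cover_set r S" for z
    using that \<alpha>S as \<delta> by (auto simp: \<beta>_def)
  have "inj_on \<beta> (cover_set r S)"
  proof (rule inj_onI)
    fix z z' assume "z \<in> cover_set r S" "z' \<in> cover_set r S" "\<beta> z = \<beta> z'"
    then obtain u t u' t' where z: "z = (u, t)" "z' = (u', t')" "u \<in> S" "u' \<in> S" "t \<subseteq> ?E" "t' \<subseteq> ?E"
      "\<alpha> u = \<alpha> u'" "sym_diff (a ` t) \<delta> = sym_diff (a ` t') \<delta>" by (auto simp: \<beta>_def)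
    have "a ` t = a ` t'" using z(8) by blast
    then have "t = t'" using inj_on_image_eq_iff[OF a_inj z(5,6)] by simp
    moreover have "u = u'" using z \<alpha>(1) by (auto simp: bij_betw_def inj_on_def)
    ultimately show "z = z'" using z by simp
  qed
  moreover have fin: "finite (cover_set r S)" using y by (auto simp: graph_on_def)
  ultimately have "bij_betw \<beta> (cover_set r S) (cover_set r S)"
    using endo_inj_surj[OF fin, of \<beta>] \<beta>_in by (auto simp: bij_betw_def)
  moreover have "\<beta> (cover r S y i z) = cover r S y i (\<beta> z)" if i: "i < r" and z: "z \<in> cover_set r S" for i z
  proof -
    obtain u t where ut: "z = (u, t)" "u \<in> S" "t \<subseteq> ?E" using z by auto
    have "a ` sym_diff t {(i, u)} = sym_diff (a ` t) (a ` {(i, u)})"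
      by (rule sym_diff_image[OF a_inj ut(3)]) (use i ut(2) in auto)
    then have "a ` sym_diff t {(i, u)} = sym_diff (a ` t) {(i, \<alpha> u)}" by (simp add: a_def)
    then have "\<beta> (cover r S y i z) = (y i (\<alpha> u), sym_diff (sym_diff (a ` t) {(i, \<alpha> u)}) \<delta>)"
      using ut i \<alpha>(2)[OF i ut(2)] by (simp add: \<beta>_def cover_def)
    moreover have "cover r S y i (\<beta> z) = (y i (\<alpha> u), sym_diff (sym_diff (a ` t) \<delta>) {(i, \<alpha> u)})"
      using \<beta>_in[OF z] i ut(1) by (simp add: \<beta>_def cover_def)
    moreover have "sym_diff (sym_diff (a ` t) {(i, \<alpha> u)}) \<delta> = sym_diff (sym_diff (a ` t) \<delta>) {(i, \<alpha> u)}" by blast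
    ultimately show ?thesis by simp
  qed
  moreover have "\<beta> p = q" by (auto simp: \<beta>_def p(1) q(1) \<alpha>(3) \<delta>_def)
  ultimately show "\<exists>\<alpha>. bij_betw \<alpha> (cover_set r S) (cover_set r S) \<and>
    (\<forall>i<r. \<forall>p\<in>cover_set r S. \<alpha> (cover r S y i p) = cover r S y i (\<alpha> p)) \<and> \<alpha> p = q" by blast
qed

lemma odd_edges_automorphism:
  assumes y: "graph_on r S y" and \<alpha>: "bij_betw \<alpha> S S" "\<And>i p. i < r \<Longrightarrow> p \<in> S \<Longrightarrow> \<alpha> (y i p) = y i (\<alpha> p)"
    and w: "over r w" and v: "v \<in> S"
  shows "wact y w (\<alpha> v) = \<alpha> (wact y w v)"
    and "odd_edges y w (\<alpha> v) = (\<lambda>(i, u). (i, \<alpha> u)) ` odd_edges y w v"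
proof -
  let ?a = "\<lambda>(i::nat, u). (i, \<alpha> u)"
  have \<alpha>S: "\<alpha> u \<in> S" if "u \<in> S" for u using \<alpha>(1) that by (auto simp: bij_betw_def)
  have inv: "\<alpha> (inv' (y i) u) = inv' (y i) (\<alpha> u)" if i: "i < r" and u: "u \<in> S" for i u
  proof -
    have p: "y i permutes S" using y i by (simp add: graph_on_def)
    have "inv' (y i) u \<in> S" using permutes_in_image[OF permutes_inv[OF p]] u by blast
    then have "y i (\<alpha> (inv' (y i) u)) = \<alpha> u" using \<alpha>(2)[OF i] permutes_inverses(1)[OF p] by metis
    then show ?thesis using permutes_inv_eq[OF p] by metis
  qed
  have "wact y w (\<alpha> v) = \<alpha> (wact y w v) \<and> odd_edges y w (\<alpha> v) = ?a ` odd_edges y w v"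
    using w
  proof (induction w)
    case (Cons x w)
    have x: "fst x < r" and ow: "over r w" using Cons.prems by auto
    have wS: "wact y w v \<in> S" by (rule wact_in[OF y ow v])
    have inj: "inj_on ?a ({..<r} \<times> S)" using \<alpha>(1) by (auto simp: inj_on_def bij_betw_def)
    have "act y x (\<alpha> (wact y w v)) = \<alpha> (act y x (wact y w v))"
      using \<alpha>(2)[OF x wS] inv[OF x wS] by (simp add: act_def)
    moreover have "crossing y x (\<alpha> (wact y w v)) = ?a (crossing y x (wact y w v))"
      using inv[OF x wS] by (simp add: crossing_def)
    moreover have "?a ` sym_diff (odd_edges y w v) {crossing y x (wact y w v)}
        = sym_diff (?a ` odd_edges y w v) (?a ` {crossing y x (wact y w v)})"
      by (rule sym_diff_image[OF inj odd_edges_subset[OF y ow v]]) (use crossing_in[OF y x wS] in simp)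
    ultimately show ?case using Cons.IH[OF ow] by simp
  qed simp
  then show "wact y w (\<alpha> v) = \<alpha> (wact y w v)" "odd_edges y w (\<alpha> v) = ?a ` odd_edges y w v" by auto
qed

text \<open>Renaming of vertices along an injection. It serves twice: a cover has a new vertex type,
  so the tower is carried back to natural numbers by \<open>cover_code\<close> at each level, and
  the final cover is placed inside \<open>{1..n}\<close>.\<close>

definition transport :: "('a \<Rightarrow> 'b) \<Rightarrow> 'a set \<Rightarrow> ('a \<Rightarrow> 'a) \<Rightarrow> 'b \<Rightarrow> 'b"
  where "transport f S p = (\<lambda>u. if u \<in> f ` S then f (p (inv_into S f u)) else u)"

lemma transport_apply [simp]: "inj_on f S \<Longrightarrow> v \<in> S \<Longrightarrow> transport f S p (f v) = f (p v)"
  by (simp add: transport_def)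

lemma transport_permutes:
  assumes f: "inj_on f S" and p: "p permutes S"
  shows "transport f S p permutes f ` S"
    and "v \<in> S \<Longrightarrow> inv' (transport f S p) (f v) = f (inv' p v)"
proof -
  have S: "p v \<in> S \<longleftrightarrow> v \<in> S" "inv' p v \<in> S \<longleftrightarrow> v \<in> S" for v
    using permutes_in_image[OF p] permutes_in_image[OF permutes_inv[OF p]] by auto
  have "bij_betw (transport f S p) (f ` S) (f ` S)"
    by (rule bij_betwI[where g = "transport f S (inv' p)"])
      (use f S permutes_inverses[OF p] in auto)
  then show perm: "transport f S p permutes f ` S"
    by (rule bij_imp_permutes) (simp add: transport_def)
  assume v: "v \<in> S"
  have "transport f S p (f (inv' p v)) = f v"
    using f v S permutes_inverses(1)[OF p] by simp
  then show "inv' (transport f S p) (f v) = f (inv' p v)"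
    using permutes_inv_eq[OF perm] by metis
qed

lemma graph_on_transport:
  assumes y: "graph_on r S y" and f: "inj_on f S"
  shows "graph_on r (f ` S) (\<lambda>i. transport f S (y i))"
  using y transport_permutes(1)[OF f] by (auto simp: graph_on_def)

lemma wact_transport:
  assumes y: "graph_on r S y" and f: "inj_on f S" and w: "over r w" and v: "v \<in> S"
  shows "wact (\<lambda>i. transport f S (y i)) w (f v) = f (wact y w v)"
  using w
proof (induction w)
  case (Cons x w)
  have x: "fst x < r" and ow: "over r w" using Cons.prems by auto
  have "wact y w v \<in> S" by (rule wact_in[OF y ow v])
  moreover have "y (fst x) permutes S" using y x by (simp add: graph_on_def)
  ultimately have "act (\<lambda>i. transport f S (y i)) x (f (wact y w v)) = f (act y x (wact y w v))"
    using f transport_permutes(2)[OF f] by (simp add: act_def)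
  then show ?case using Cons.IH[OF ow] by simp
qed simp

lemma has_girth_transport:
  assumes y: "graph_on r S y" and f: "inj_on f S" and k: "has_girth r S y k"
  shows "has_girth r (f ` S) (\<lambda>i. transport f S (y i)) k"
  unfolding has_girth_def
proof (intro allI impI)
  fix u p assume u: "over r u" "reduced u" "u \<noteq> []" and p: "p \<in> f ` S" "wact (\<lambda>i. transport f S (y i)) u p = p"
  obtain v where v: "v \<in> S" "p = f v" using p(1) by blast
  then have "f (wact y u v) = f v" using p(2) wact_transport[OF y f u(1) v(1)] by simp
  then have "wact y u v = v" using f v(1) wact_in[OF y u(1) v(1)] by (simp add: inj_on_eq_iff)
  then show "k < length u" using k u v(1) unfolding has_girth_def by blast
qed

lemma homogeneous_transport:
  assumes y: "graph_on r S y" and f: "inj_on f S" and h: "homogeneous r S y"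
  shows "homogeneous r (f ` S) (\<lambda>i. transport f S (y i))"
  unfolding homogeneous_def
proof (intro ballI)
  fix p q assume "p \<in> f ` S" "q \<in> f ` S"
  then obtain u v where uv: "u \<in> S" "p = f u" "v \<in> S" "q = f v" by blast
  obtain \<alpha> where \<alpha>: "bij_betw \<alpha> S S" "\<And>i p. i < r \<Longrightarrow> p \<in> S \<Longrightarrow> \<alpha> (y i p) = y i (\<alpha> p)" "\<alpha> u = v"
    using h uv unfolding homogeneous_def by blast
  have \<alpha>S: "\<alpha> u \<in> S" if "u \<in> S" for u using \<alpha>(1) that by (auto simp: bij_betw_def)
  have yS: "y i u \<in> S" if "i < r" "u \<in> S" for i u
    using y that permutes_in_image unfolding graph_on_def by metis
  define \<beta> where "\<beta> = f \<circ> \<alpha> \<circ> inv_into S f"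
  have \<beta>: "\<beta> (f u) = f (\<alpha> u)" if "u \<in> S" for u using f that by (simp add: \<beta>_def)
  have "bij_betw \<beta> (f ` S) (f ` S)"
    unfolding \<beta>_def
    by (intro bij_betw_trans[of _ _ S]) (use f \<alpha>(1) in \<open>auto simp: bij_betw_def inj_on_inv_into\<close>)
  moreover have "\<forall>i<r. \<forall>p\<in>f ` S. \<beta> (transport f S (y i) p) = transport f S (y i) (\<beta> p)"
    using f \<beta> \<alpha>(2) \<alpha>S yS by auto
  moreover have "\<beta> p = q" using \<beta> uv \<alpha>(3) by simp
  ultimately show "\<exists>\<alpha>. bij_betw \<alpha> (f ` S) (f ` S) \<and>
    (\<forall>i<r. \<forall>p\<in>f ` S. \<alpha> (transport f S (y i) p) = transport f S (y i) (\<alpha> p)) \<and> \<alpha> p = q" by blast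
qed

definition cover_code :: "nat \<times> (nat \<times> nat) set \<Rightarrow> nat"
  where "cover_code = (\<lambda>(v, s). prod_encode (v, set_encode (prod_encode ` s)))"

lemma inj_on_cover_code: "finite S \<Longrightarrow> inj_on cover_code (cover_set r S)"
proof (rule inj_onI)
  fix p q assume S: "finite S" and pq: "p \<in> cover_set r S" "q \<in> cover_set r S" "cover_code p = cover_code q"
  have fin: "finite (snd p)" "finite (snd q)"
  proof -
    have "snd p \<subseteq> {..<r} \<times> S" "snd q \<subseteq> {..<r} \<times> S" using pq(1,2) by (auto simp: mem_Times_iff)
    then show "finite (snd p)" "finite (snd q)" using S finite_subset by (metis finite_cartesian_product finite_lessThan)+
  qed
  have "fst p = fst q" "set_encode (prod_encode ` snd p) = set_encode (prod_encode ` snd q)"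
    using pq(3) by (auto simp: cover_code_def split_beta)
  then have "prod_encode ` snd p = prod_encode ` snd q"
    using inj_onD[OF inj_on_set_encode] fin by simp
  then have "snd p = snd q" using inj_image_eq_iff[of "prod_encode" "snd p" "snd q"] by (simp add: inj_prod_encode)
  then show "p = q" using \<open>fst p = fst q\<close> by (simp add: prod_eq_iff)
qed

text \<open>Start with the bouquet itself and pass to the homology cover as long as the loops along
  \<open>w\<close> have empty chain. They then stay closed, while the bound on the girth goes up by
  one. It cannot reach the length of \<open>w\<close>, which closes up itself, so the process
  stops.\<close>

lemma exists_cover_with_odd_loops:
  assumes w: "over r w" "reduced w" "w \<noteq> []"
  obtains S :: "nat set" and y where "graph_on r S y" "\<And>v. v \<in> S \<Longrightarrow> wact y w v = v"
    "\<And>v. v \<in> S \<Longrightarrow> odd_edges y w v \<noteq> {}"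
proof -
  let ?A = "\<exists>(S :: nat set) y. graph_on r S y \<and> (\<forall>v\<in>S. wact y w v = v \<and> odd_edges y w v \<noteq> {})"
  let ?B = "\<lambda>k. \<exists>(S :: nat set) y. graph_on r S y \<and> homogeneous r S y \<and> has_girth r S y k \<and> (\<forall>v\<in>S. wact y w v = v)"
  have "?A \<or> ?B k" for k
  proof (induction k)
    case 0
    have id: "wact (\<lambda>_. id) u v = v" for u and v :: nat
      by (induction u) (auto simp: act_def inv_id)
    have "?B 0"
      by (intro exI[of _ "{0}"] exI[of _ "\<lambda>_. id"])
        (auto simp: graph_on_def homogeneous_def has_girth_def permutes_id id intro!: exI[of _ id])
    then show ?case by blast
  next
    case (Suc k)
    show ?case
    proof (cases ?A)
      case False
      then have "?B k" using Suc.IH by (simp only: simp_thms)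
      then obtain S :: "nat set" and y where y: "graph_on r S y" and h: "homogeneous r S y"
        and k: "has_girth r S y k" and triv: "\<forall>v\<in>S. wact y w v = v"
        by (elim exE conjE)
      have "\<not> (\<forall>v\<in>S. odd_edges y w v \<noteq> {})"
      proof
        assume "\<forall>v\<in>S. odd_edges y w v \<noteq> {}"
        then have ?A using y triv by (intro exI[of _ S] exI[of _ y]) blast
        then show False using False by blast
      qed
      then obtain v0 where v0: "v0 \<in> S" "odd_edges y w v0 = {}" by blast
      \<comment> \<open>By regularity one empty chain makes all of them empty, which keeps every
        loop along \<open>w\<close> closed in the next cover.\<close>
      have empty: "odd_edges y w v = {}" if v: "v \<in> S" for v
      proof -
        obtain \<alpha> where \<alpha>: "bij_betw \<alpha> S S" "\<And>i p. i < r \<Longrightarrow> p \<in> S \<Longrightarrow> \<alpha> (y i p) = y i (\<alpha> p)" "\<alpha> v0 = v"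
          using h v0(1) v unfolding homogeneous_def by blast
        then show ?thesis using odd_edges_automorphism(2)[OF y \<alpha>(1,2) w(1) v0(1)] v0(2) by simp
      qed
      let ?E = "cover_set r S"
      have finS: "finite S" using y by (simp add: graph_on_def)
      note inj = inj_on_cover_code[OF finS, of r]
      let ?S = "cover_code ` ?E" and ?y = "\<lambda>i. transport cover_code ?E (cover r S y i)"
      have "wact ?y w v = v" if "v \<in> ?S" for v
      proof -
        obtain p s where p: "v = cover_code (p, s)" "p \<in> S" "s \<subseteq> {..<r} \<times> S" using \<open>v \<in> ?S\<close> by auto
        have "(p, s) \<in> ?E" using p by simp
        then have "wact ?y w v = cover_code (wact (cover r S y) w (p, s))"
          unfolding p(1) by (rule wact_transport[OF graph_on_cover[OF y] inj w(1)])
        also have "wact (cover r S y) w (p, s) = (p, s)"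
          using wact_cover[OF y w(1) p(2,3)] empty[OF p(2)] triv p(2) by simp
        finally show ?thesis using p(1) by simp
      qed
      moreover have "graph_on r ?S ?y" by (rule graph_on_transport[OF graph_on_cover[OF y] inj])
      moreover have "homogeneous r ?S ?y"
        by (rule homogeneous_transport[OF graph_on_cover[OF y] inj homogeneous_cover[OF y h]])
      moreover have "has_girth r ?S ?y (Suc k)"
        by (rule has_girth_transport[OF graph_on_cover[OF y] inj has_girth_cover[OF y k]])
      ultimately show ?thesis by (intro disjI2 exI[of _ ?S] exI[of _ ?y]) blast
    qed blast
  qed
  moreover have "\<not> ?B (length w)"
  proof
    assume "?B (length w)"
    then obtain S :: "nat set" and y where *: "graph_on r S y" "has_girth r S y (length w)" "\<forall>v\<in>S. wact y w v = v"
      by blast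
    obtain v where "v \<in> S" using *(1) by (auto simp: graph_on_def)
    then have "length w < length w" using *(2,3) w unfolding has_girth_def by blast
    then show False by simp
  qed
  ultimately have ?A by blast
  then show ?thesis using that by blast
qed

text \<open>An edge crossed an odd number of times has a non-zero signed number of crossings, so its
  dual cochain works at one vertex; \<open>generic_cochain\<close> finds a cochain for all vertices
  together.\<close>

lemma exists_winding_cover:
  assumes w: "over r w" "reduced w" "w \<noteq> []"
  obtains S :: "nat set" and y c where "graph_on r S y" "\<And>v. v \<in> S \<Longrightarrow> wact y w v = v"
    "\<And>v. v \<in> S \<Longrightarrow> signed_sum y c w v \<noteq> 0"
proof -
  obtain S :: "nat set" and y where y: "graph_on r S y" "\<And>v. v \<in> S \<Longrightarrow> wact y w v = v"
    "\<And>v. v \<in> S \<Longrightarrow> odd_edges y w v \<noteq> {}"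
    using exists_cover_with_odd_loops[OF w] by blast
  have "\<exists>c. \<forall>v\<in>S. signed_sum y c w v \<noteq> 0"
  proof (rule generic_cochain)
    show "finite S" using y(1) by (simp add: graph_on_def)
    fix v assume "v \<in> S"
    then obtain e where "e \<in> odd_edges y w v" using y(3) by blast
    then have "odd (signed_sum y (\<lambda>f. of_bool (f = e)) w v)" by (simp only: odd_signed_sum)
    then have "signed_sum y (\<lambda>f. of_bool (f = e)) w v \<noteq> 0" by (rule contrapos_nn) simp
    then show "\<exists>c. signed_sum y c w v \<noteq> 0" by blast
  qed (rule signed_sum_linear)
  then show ?thesis using that y by blast
qed

section \<open>Cyclic covers and their realisation in alternating groups\<close>

lemma wact_outside: "graph_on r S y \<Longrightarrow> over r w \<Longrightarrow> v \<notin> S \<Longrightarrow> wact y w v = v"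
proof (induction w)
  case (Cons x w)
  then show ?case using permutes_not_in[OF act_permutes[of r S y x]] by simp
qed simp

text \<open>The cyclic cover of degree \<open>l\<close> given by the cochain \<open>c\<close> modulo
  \<open>l\<close>: a loop along \<open>w\<close> at \<open>v\<close> translates the fibre over
  \<open>v\<close> by \<open>signed_sum y c w v\<close>.\<close>

definition cyc_ext :: "nat \<Rightarrow> 'a set \<Rightarrow> int \<Rightarrow> (nat \<Rightarrow> 'a \<Rightarrow> 'a) \<Rightarrow> (nat \<times> 'a \<Rightarrow> int) \<Rightarrow> nat \<Rightarrow> 'a \<times> int \<Rightarrow> 'a \<times> int"
  where "cyc_ext r S l y c i = (\<lambda>(v, t). if i < r \<and> v \<in> S \<and> t \<in> {0..<l} then (y i v, (t + c (i, v)) mod l) else (v, t))"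

lemma cyc_ext_permutes:
  assumes y: "graph_on r S y" and i: "i < r" and l: "0 < l"
  shows "cyc_ext r S l y c i permutes S \<times> {0..<l}"
    and "\<And>v t. v \<in> S \<Longrightarrow> t \<in> {0..<l} \<Longrightarrow>
      inv' (cyc_ext r S l y c i) (v, t) = (inv' (y i) v, (t - c (i, inv' (y i) v)) mod l)"
proof -
  have p: "y i permutes S" using y i by (simp add: graph_on_def)
  have S: "y i v \<in> S \<longleftrightarrow> v \<in> S" "inv' (y i) v \<in> S \<longleftrightarrow> v \<in> S" for v
    using permutes_in_image[OF p] permutes_in_image[OF permutes_inv[OF p]] by auto
  have "bij_betw (cyc_ext r S l y c i) (S \<times> {0..<l}) (S \<times> {0..<l})"
    by (rule bij_betwI[where g = "\<lambda>(v, t). (inv' (y i) v, (t - c (i, inv' (y i) v)) mod l)"])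
      (use i l S permutes_inverses[OF p] in \<open>auto simp: cyc_ext_def mod_simps\<close>)
  then show perm: "cyc_ext r S l y c i permutes S \<times> {0..<l}"
    by (rule bij_imp_permutes) (auto simp: cyc_ext_def split: if_splits)
  fix v t assume v: "v \<in> S" "t \<in> {0..<l}"
  let ?v = "inv' (y i) v"
  have "cyc_ext r S l y c i (?v, (t - c (i, ?v)) mod l) = (v, t)"
    using v i l S permutes_inverses[OF p] by (simp add: cyc_ext_def mod_simps)
  then show "inv' (cyc_ext r S l y c i) (v, t) = (?v, (t - c (i, ?v)) mod l)"
    using permutes_inv_eq[OF perm] by metis
qed

lemma graph_on_cyc_ext: "graph_on r S y \<Longrightarrow> 0 < l \<Longrightarrow> graph_on r (S \<times> {0..<l}) (cyc_ext r S l y c)"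
  unfolding graph_on_def using cyc_ext_permutes(1)[of r S y] by (auto simp: graph_on_def)

lemma wact_cyc_ext:
  assumes y: "graph_on r S y" and l: "0 < l" and w: "over r w" and v: "v \<in> S" "t \<in> {0..<l}"
  shows "wact (cyc_ext r S l y c) w (v, t) = (wact y w v, (t + signed_sum y c w v) mod l)"
  using w
proof (induction w)
  case Nil
  then show ?case using v by simp
next
  case (Cons x w)
  let ?v = "wact y w v" and ?t = "(t + signed_sum y c w v) mod l"
  have x: "fst x < r" using Cons.prems by simp
  have "?v \<in> S" using wact_in[OF y _ v(1)] Cons.prems by simp
  moreover have "?t \<in> {0..<l}" using l by simp
  ultimately have "act (cyc_ext r S l y c) x (?v, ?t) = (act y x ?v, (t + signed_sum y c (x # w) v) mod l)"
    using cyc_ext_permutes(2)[OF y x l] x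
    by (auto simp: act_def crossing_def cyc_ext_def mod_simps algebra_simps)
  then show ?case using Cons by simp
qed

text \<open>Disjoint copies serve two purposes: the index set \<open>{..<d}\<close> adjusts the
  number of cycles, and a last doubling by \<open>bool\<close> makes all generators even.\<close>

definition copies :: "'a set \<Rightarrow> 'b set \<Rightarrow> (nat \<Rightarrow> 'a \<Rightarrow> 'a) \<Rightarrow> nat \<Rightarrow> 'a \<times> 'b \<Rightarrow> 'a \<times> 'b"
  where "copies S K y i = (\<lambda>(v, k). if v \<in> S \<and> k \<in> K then (y i v, k) else (v, k))"

lemma copies_permutes:
  assumes p: "y i permutes S"
  shows "copies S K y i permutes S \<times> K"
    and "\<And>v k. v \<in> S \<Longrightarrow> k \<in> K \<Longrightarrow> inv' (copies S K y i) (v, k) = (inv' (y i) v, k)"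
proof -
  have S: "y i v \<in> S \<longleftrightarrow> v \<in> S" "inv' (y i) v \<in> S \<longleftrightarrow> v \<in> S" for v
    using permutes_in_image[OF p] permutes_in_image[OF permutes_inv[OF p]] by auto
  have "bij_betw (copies S K y i) (S \<times> K) (S \<times> K)"
    by (rule bij_betwI[where g = "\<lambda>(v, k). (inv' (y i) v, k)"])
      (use S permutes_inverses[OF p] in \<open>auto simp: copies_def\<close>)
  then show perm: "copies S K y i permutes S \<times> K"
    by (rule bij_imp_permutes) (auto simp: copies_def split: if_splits)
  fix v k assume v: "v \<in> S" "k \<in> K"
  have "copies S K y i (inv' (y i) v, k) = (v, k)"
    using v S permutes_inverses[OF p] by (simp add: copies_def)
  then show "inv' (copies S K y i) (v, k) = (inv' (y i) v, k)"
    using permutes_inv_eq[OF perm] by metis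
qed

lemma graph_on_copies: "graph_on r S y \<Longrightarrow> finite K \<Longrightarrow> K \<noteq> {} \<Longrightarrow> graph_on r (S \<times> K) (copies S K y)"
  unfolding graph_on_def using copies_permutes(1)[of y _ S K] by auto

lemma wact_copies:
  assumes y: "graph_on r S y" and w: "over r w" and v: "v \<in> S" "k \<in> K"
  shows "wact (copies S K y) w (v, k) = (wact y w v, k)"
  using w
proof (induction w)
  case (Cons x w)
  have "wact y w v \<in> S" using wact_in[OF y _ v(1)] Cons.prems by simp
  moreover have "y (fst x) permutes S" using y Cons.prems by (simp add: graph_on_def)
  ultimately have "act (copies S K y) x (wact y w v, k) = (act y x (wact y w v), k)"
    using copies_permutes(2)[of y "fst x" S] v(2) by (auto simp: act_def copies_def)
  then show ?case using Cons by simp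
qed simp

text \<open>The actions on the two copies are conjugate, hence of equal sign.\<close>

lemma transport_double_Alt:
  fixes f :: "'a \<times> bool \<Rightarrow> nat"
  assumes p: "y i permutes Z" and f: "inj_on f (Z \<times> UNIV)" "f ` (Z \<times> UNIV) \<subseteq> {1..n}"
  shows "transport f (Z \<times> UNIV) (copies Z UNIV y i) \<in> Alt n"
proof -
  let ?T = "transport f (Z \<times> UNIV) (copies Z UNIV y i)"
  define g where "g b = (\<lambda>a. f (a, b))" for b
  define P where "P b = transport (g b) Z (y i)" for b
  have g: "inj_on (g b) Z" "g b ` Z \<subseteq> {1..n}" for b
    using f by (auto simp: g_def inj_on_def)
  have perm: "P b permutes {1..n}" for b
    unfolding P_def by (rule permutes_subset[OF transport_permutes(1)[OF g(1) p] g(2)])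
  have yZ: "y i a \<in> Z" if "a \<in> Z" for a using permutes_in_image[OF p] that by blast
  have P_same: "P b (f (a, b)) = f (y i a, b)" if "a \<in> Z" for a b
    using transport_apply[OF g(1) that, of b "y i"] by (simp add: P_def g_def)
  have P_other: "P b u = u" if "u \<notin> g b ` Z" for b u
    using that by (simp add: P_def transport_def)
  have disj: "f (a, b) \<notin> g b' ` Z" if "a \<in> Z" "b \<noteq> b'" for a b b'
    using that f(1) by (auto simp: g_def inj_on_def)
  have T: "?T = P False \<circ> P True"
  proof
    fix u
    consider (F) a where "a \<in> Z" "u = f (a, False)" | (T) a where "a \<in> Z" "u = f (a, True)"
      | (out) "u \<notin> f ` (Z \<times> UNIV)"
    proof (cases "u \<in> f ` (Z \<times> UNIV)")
      case True
      then obtain a b where "a \<in> Z" "u = f (a, b)" by auto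
      then show thesis using that(1,2)[of a] by (cases b) simp_all
    qed (use that(3) in simp)
    then show "?T u = (P False \<circ> P True) u"
    proof cases
      case F
      then show ?thesis using transport_apply[OF f(1), of "(a, False)"] P_same P_other[OF disj, of a False True]
        by (simp add: copies_def)
    next
      case T
      then show ?thesis using transport_apply[OF f(1), of "(a, True)"] P_same yZ P_other[OF disj, of "y i a" True False]
        by (simp add: copies_def)
    next
      case out
      then have "u \<notin> g b ` Z" for b by (auto simp: g_def)
      then show ?thesis using out P_other by (simp add: transport_def)
    qed
  qed
  define h where "h = g True \<circ> inv_into Z (g False)"
  have h: "h (f (a, False)) = f (a, True)" if "a \<in> Z" for a
    using inv_into_f_f[OF g(1) that, of False] by (simp add: h_def g_def)
  have "bij_betw h (g False ` Z) (g True ` Z)"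
    unfolding h_def
    by (rule bij_betw_trans[of _ _ Z]) (use g(1) in \<open>auto simp: bij_betw_def inj_on_inv_into\<close>)
  then obtain s where s: "s permutes {1..n}" "\<And>x. x \<in> g False ` Z \<Longrightarrow> s x = h x"
    using permutes_extend[OF _ g(2) g(2) finite_atLeastAtMost] by blast
  have s_f: "s (f (a, False)) = f (a, True)" if "a \<in> Z" for a
    using s(2)[of "f (a, False)"] h[OF that] that by (auto simp: g_def)
  have "s \<circ> P False = P True \<circ> s"
  proof
    fix u
    show "(s \<circ> P False) u = (P True \<circ> s) u"
    proof (cases "u \<in> g False ` Z")
      case True
      then obtain a where "a \<in> Z" "u = f (a, False)" by (auto simp: g_def)
      then show ?thesis using P_same s_f yZ by simp
    next
      case False
      have "s u \<notin> g True ` Z"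
      proof
        assume "s u \<in> g True ` Z"
        then obtain a where a: "a \<in> Z" "s u = f (a, True)" by (auto simp: g_def)
        then have "s u = s (f (a, False))" using s_f by simp
        then have "u = f (a, False)" using permutes_inj[OF s(1)] by (simp add: inj_eq)
        then show False using False a(1) by (auto simp: g_def)
      qed
      then show ?thesis using False P_other by simp
    qed
  qed
  then have "evenperm (s \<circ> P False) = evenperm (P True \<circ> s)" by simp
  moreover have "permutation (P b)" "permutation s" for b
    using perm s(1) permutation_permutes by blast+
  ultimately have "evenperm (P False) = evenperm (P True)" by (auto simp: evenperm_comp)
  moreover have "permutation (P False)" "permutation (P True)" using perm permutation_permutes by blast+
  ultimately have "evenperm ?T" unfolding T by (simp add: evenperm_comp)
  then show ?thesis unfolding Alt_iff T using permutes_compose[OF perm perm] by (simp add: T)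
qed

lemma word_value_alt_group:
  assumes g: "g \<in> {..<r} \<rightarrow> Alt n" and w: "over r w"
  shows "word_value (alt_group n) g w = wact g w"
  using w
proof (induction w)
  case Nil
  then show ?case by (simp add: word_value_def alt_group_one fun_eq_iff)
next
  case (Cons x w)
  then have "g (fst x) \<in> Alt n" using g by auto
  then have "letter_value (alt_group n) g x = act g x"
    by (simp add: letter_value_def act_def alt_group_inv_equality)
  moreover have "word_value (alt_group n) g (x # w)
      = letter_value (alt_group n) g x \<circ> word_value (alt_group n) g w"
    by (simp add: word_value_def alt_group_mult)
  ultimately show ?case using Cons by (simp add: fun_eq_iff)
qed

text \<open>A fixed representative of the permutations with \<open>H\<close> cycles of length
  \<open>l\<close>: consecutive blocks of \<open>l\<close> points, counted from 1, are rotated by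
  one step. Working with a literal element avoids the question whether its class splits in the
  alternating group.\<close>

definition rho :: "nat \<Rightarrow> nat \<Rightarrow> nat \<Rightarrow> nat"
  where "rho H l u = (if 1 \<le> u \<and> u \<le> H * l
    then ((u - 1) div l) * l + ((u - 1) mod l + 1) mod l + 1 else u)"

lemma rho_block: "b < H \<Longrightarrow> x < l \<Longrightarrow> rho H l (b * l + x + 1) = b * l + (x + 1) mod l + 1"
proof -
  assume b: "b < H" "x < l"
  have "b * l + x < (b + 1) * l" using b(2) by simp
  also have "\<dots> \<le> H * l" using b(1) by (intro mult_right_mono) auto
  finally show ?thesis using b(2) by (simp add: rho_def)
qed

text \<open>On the fibre over \<open>v\<close> the word translates by its winding number; if that is
  prime to \<open>l\<close>, the fibre is a single cycle of length \<open>l\<close>. So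
  \<open>h\<close> is twice the number of vertices, because of the doubling, and \<open>M\<close> is
  the absolute value of the product of the winding numbers. The factor \<open>d\<close> leaves room
  for a number of cycles common to several words.\<close>

lemma rho_in_word_image:
  assumes w: "w \<in> carrier (free_group r)" "w \<noteq> \<one>\<^bsub>free_group r\<^esub>"
  shows "\<exists>h>0. \<exists>M>0. \<forall>d l n. 0 < d \<longrightarrow> 0 < l \<longrightarrow> coprime l M \<longrightarrow> h * d * l \<le> n \<longrightarrow>
    rho (h * d) l \<in> word_image (alt_group n) r w"
proof -
  have over: "over r w" and red: "reduced w" "w \<noteq> []"
    using w by (auto simp: free_group_def over_def)
  obtain S :: "nat set" and y c where S: "graph_on r S y" "\<And>v. v \<in> S \<Longrightarrow> wact y w v = v"
    "\<And>v. v \<in> S \<Longrightarrow> signed_sum y c w v \<noteq> 0"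
    using exists_winding_cover[OF over red] by blast
  let ?\<sigma> = "signed_sum y c w"
  have finS: "finite S" "S \<noteq> {}" using S(1) by (auto simp: graph_on_def)
  define M where "M = nat \<bar>\<Prod>v\<in>S. ?\<sigma> v\<bar>"
  have "0 < M" using S(3) finS by (simp add: M_def)
  moreover have "0 < 2 * card S" using finS by (simp add: card_gt_0_iff)
  moreover have "rho (2 * card S * d) l \<in> word_image (alt_group n) r w"
    if d: "0 < d" and l: "0 < l" "coprime l M" and n: "2 * card S * d * l \<le> n" for d l n
  proof -
    let ?l = "int l" and ?H = "2 * card S * d"
    have cop: "coprime (?\<sigma> v) ?l" if "v \<in> S" for v
    proof -
      have "?\<sigma> v dvd int M" using finS that by (simp add: M_def dvd_prodI)
      moreover have "coprime (int M) ?l" using l(2) by (simp add: coprime_commute)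
      ultimately show ?thesis by (rule coprime_divisors[OF _ dvd_refl])
    qed
    \<comment> \<open>\<open>k\<close> inverts the winding number modulo \<open>l\<close>; writing
      \<open>1 mod ?l\<close> covers \<open>l = 1\<close>.\<close>
    have "\<forall>v\<in>S. \<exists>k. (k * ?\<sigma> v) mod ?l = 1 mod ?l"
    proof
      fix v assume "v \<in> S"
      obtain a b where "a * ?\<sigma> v + b * ?l = gcd (?\<sigma> v) ?l" using bezout_int by blast
      then have "a * ?\<sigma> v + b * ?l = 1" using cop[OF \<open>v \<in> S\<close>] by simp
      then have "(a * ?\<sigma> v + b * ?l) mod ?l = 1 mod ?l" by simp
      then show "\<exists>k. (k * ?\<sigma> v) mod ?l = 1 mod ?l" by auto
    qed
    then obtain k where k: "\<And>v. v \<in> S \<Longrightarrow> (k v * ?\<sigma> v) mod ?l = 1 mod ?l" by metis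
    let ?C = "S \<times> {0..<?l}"
    let ?Z = "?C \<times> {..<d}"
    let ?z = "copies ?C {..<d} (cyc_ext r S ?l y c)"
    have lpos: "0 < ?l" using l(1) by simp
    have Z0: "graph_on r ?C (cyc_ext r S ?l y c)" by (rule graph_on_cyc_ext[OF S(1) lpos])
    have Z: "graph_on r ?Z ?z" by (rule graph_on_copies[OF Z0]) (use d in auto)
    let ?B = "?Z \<times> (UNIV :: bool set)"
    let ?b = "copies ?Z UNIV ?z"
    have Z2: "graph_on r ?B ?b" by (rule graph_on_copies[OF Z]) auto
    let ?E = "S \<times> {..<d} \<times> (UNIV :: bool set)"
    have "card ?E = ?H" by (simp add: card_cartesian_product)
    moreover have "finite ?E" using finS by simp
    ultimately obtain e where e: "bij_betw e ?E {0..<?H}"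
      using ex_bij_betw_finite_nat[of ?E] by auto
    \<comment> \<open>Multiplying the fibre coordinate by the inverse \<open>k v\<close> of the
      winding number turns the translation into a step of one, as in \<open>rho\<close>. The number
      \<open>e (v, j, b)\<close> selects the block.\<close>
    define f where "f = (\<lambda>(((v, t), j), b). e (v, j, b) * l + nat ((k v * t) mod ?l) + 1)"
    have x_less: "nat ((k v * t) mod ?l) < l" for v t
      using lpos by (simp add: nat_less_iff)
    have e_less: "e (v, j, b) < ?H" if "v \<in> S" "j < d" for v j b
      using e that by (force simp: bij_betw_def)
    have f_inj: "inj_on f ?B"
    proof (rule inj_onI)
      fix p q assume "p \<in> ?B" "q \<in> ?B" "f p = f q"
      then obtain v t j b v' t' j' b' where p: "p = (((v, t), j), b)" "q = (((v', t'), j'), b')"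
        "v \<in> S" "t \<in> {0..<?l}" "j < d" "v' \<in> S" "t' \<in> {0..<?l}" "j' < d"
        and eq: "e (v, j, b) * l + nat ((k v * t) mod ?l) = e (v', j', b') * l + nat ((k v' * t') mod ?l)"
        by (auto simp: f_def)
      have "(e (v, j, b) * l + nat ((k v * t) mod ?l)) div l = e (v, j, b)" for v j b t
        using x_less[of v t] l(1) by simp
      then have "e (v, j, b) = e (v', j', b')" using eq by metis
      then have vjb: "(v, j, b) = (v', j', b')" using e p by (auto simp: bij_betw_def inj_on_def)
      then have "nat ((k v * t) mod ?l) = nat ((k v * t') mod ?l)" using eq by simp
      then have "(k v * t) mod ?l = (k v * t') mod ?l" using lpos by (simp add: nat_eq_iff)
      then have "(?\<sigma> v * (k v * t)) mod ?l = (?\<sigma> v * (k v * t')) mod ?l" by (metis mod_mult_right_eq)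
      moreover have "(?\<sigma> v * (k v * x)) mod ?l = x mod ?l" for x
      proof -
        have "(?\<sigma> v * (k v * x)) mod ?l = ((k v * ?\<sigma> v) mod ?l * x) mod ?l"
          by (simp add: mod_simps mult_ac)
        also have "\<dots> = (1 mod ?l * x) mod ?l" using k[OF p(3)] by simp
        finally show ?thesis by (simp add: mod_simps)
      qed
      ultimately have "t = t'" using p(4,7) by simp
      then show "p = q" using p vjb by simp
    qed
    have f_sub: "f ` ?B \<subseteq> {1..?H * l}"
    proof
      fix u assume "u \<in> f ` ?B"
      then obtain v t j b where u: "u = e (v, j, b) * l + nat ((k v * t) mod ?l) + 1" "v \<in> S" "j < d"
        by (auto simp: f_def)
      have "u \<le> (e (v, j, b) + 1) * l" using u(1) x_less[of v t] by simp
      also have "\<dots> \<le> ?H * l" using e_less[OF u(2,3), of b] by (intro mult_right_mono) auto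
      finally show "u \<in> {1..?H * l}" using u(1) by simp
    qed
    have "card (f ` ?B) = ?H * l"
      using f_inj by (simp add: card_image card_cartesian_product)
    then have f_img: "f ` ?B = {1..?H * l}"
      using f_sub by (intro card_subset_eq) auto
    let ?Y = "\<lambda>i. transport f ?B (?b i)"
    have Y_Alt: "?Y i \<in> Alt n" if "i < r" for i
      by (rule transport_double_Alt[OF _ f_inj]) (use Z that f_img n in \<open>auto simp: graph_on_def\<close>)
    have Y: "graph_on r (f ` ?B) ?Y" by (rule graph_on_transport[OF Z2 f_inj])
    have "wact ?Y w u = rho ?H l u" for u
    proof (cases "u \<in> {1..?H * l}")
      case True
      then have "u \<in> f ` ?B" using f_img by simp
      then obtain v t j b where u: "u = f (((v, t), j), b)" "v \<in> S" "t \<in> {0..<?l}" "j < d" by auto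
      have Zm: "(v, t) \<in> ?C" "((v, t), j) \<in> ?Z" "(((v, t), j), b) \<in> ?B" using u by auto
      have "wact ?Y w u = f (wact ?b w (((v, t), j), b))"
        unfolding u(1) by (rule wact_transport[OF Z2 f_inj over Zm(3)])
      also have "wact ?b w (((v, t), j), b) = (wact ?z w ((v, t), j), b)"
        by (rule wact_copies[OF Z over Zm(2)]) simp
      also have "wact ?z w ((v, t), j) = (wact (cyc_ext r S ?l y c) w (v, t), j)"
        by (rule wact_copies[OF Z0 over Zm(1)]) (use u in simp)
      also have "wact (cyc_ext r S ?l y c) w (v, t) = (v, (t + ?\<sigma> v) mod ?l)"
        using wact_cyc_ext[OF S(1) lpos over u(2,3)] S(2)[OF u(2)] by simp
      finally have 1: "wact ?Y w u = e (v, j, b) * l + nat ((k v * ((t + ?\<sigma> v) mod ?l)) mod ?l) + 1"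
        by (simp add: f_def)
      have "(k v * ((t + ?\<sigma> v) mod ?l)) mod ?l = (k v * t + k v * ?\<sigma> v) mod ?l"
        by (simp add: mod_simps algebra_simps)
      also have "\<dots> = (k v * t + 1) mod ?l" using k[OF u(2)] by (metis mod_add_right_eq)
      also have "\<dots> = ((k v * t) mod ?l + 1) mod ?l" by (simp add: mod_simps)
      finally have "nat ((k v * ((t + ?\<sigma> v) mod ?l)) mod ?l) = (nat ((k v * t) mod ?l) + 1) mod l"
        using lpos by (simp add: nat_mod_distrib nat_add_distrib)
      then show ?thesis
        using 1 rho_block[OF e_less[OF u(2,4), of b] x_less[of v t]] by (simp add: u(1) f_def)
    next
      case False
      then have "u \<notin> f ` ?B" using f_img by blast
      then show ?thesis using wact_outside[OF Y over] False by (auto simp: rho_def)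
    qed
    then have "rho ?H l = wact ?Y w" by (simp add: fun_eq_iff)
    moreover have Yr: "?Y \<in> {..<r} \<rightarrow> Alt n" using Y_Alt by auto
    ultimately have "rho ?H l = word_value (alt_group n) ?Y w \<and> ?Y \<in> {..<r} \<rightarrow> Alt n"
      by (simp only: word_value_alt_group[OF Yr over] simp_thms)
    then show ?thesis unfolding word_image_def by blast
  qed
  ultimately show ?thesis by blast
qed

section \<open>Density of word images\<close>

lemma wact_Alt:
  assumes "g \<in> {..<r} \<rightarrow> Alt n" "over r w" shows "wact g w \<in> Alt n"
  using assms(2)
proof (induction w)
  case Nil
  have "wact g [] = id" by (simp add: wact_def)
  then show ?case by (simp only: Alt_id)
next
  case (Cons x w)
  then have "g (fst x) \<in> Alt n" using assms(1) by auto
  then have "act g x \<in> Alt n" by (simp add: act_def)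
  moreover have "wact g (x # w) = act g x \<circ> wact g w" by (simp add: fun_eq_iff)
  moreover have "wact g w \<in> Alt n" using Cons by simp
  ultimately show ?case by (simp only: Alt_comp)
qed

lemma word_image_Alt: "over r w \<Longrightarrow> word_image (alt_group n) r w = {wact g w | g. g \<in> {..<r} \<rightarrow> Alt n}"
  unfolding word_image_def using word_value_alt_group by metis

lemma wact_conj:
  assumes y: "y \<in> {..<r} \<rightarrow> Alt n" and g: "g \<in> Alt n" and w: "over r w"
  shows "wact (\<lambda>i. g \<circ> y i \<circ> inv' g) w = g \<circ> wact y w \<circ> inv' g"
  using w
proof (induction w)
  case Nil
  then show ?case using g by (simp add: fun_eq_iff)
next
  case (Cons x w)
  let ?y = "\<lambda>i. g \<circ> y i \<circ> inv' g"
  have yx: "y (fst x) \<in> Alt n" using Cons.prems y by auto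
  have "inv' (g \<circ> y (fst x) \<circ> inv' g) = g \<circ> (inv' (y (fst x)) \<circ> inv' g)"
    using Alt_inv_comp[of "g \<circ> y (fst x)" n "inv' g"] Alt_inv_comp[OF g yx] g yx by simp
  then have A: "act ?y x = g \<circ> act y x \<circ> inv' g" by (simp add: act_def comp_assoc)
  have IH: "wact ?y w = g \<circ> wact y w \<circ> inv' g"
    by (rule Cons.IH) (use Cons.prems in simp)
  show ?case
    by (rule ext) (simp only: wact_simps A IH, simp add: Alt_inv_simps(1)[OF g])
qed

lemma word_image_conj:
  assumes w: "over r w" and g: "g \<in> Alt n" and x: "x \<in> word_image (alt_group n) r w"
  shows "g \<circ> x \<circ> inv' g \<in> word_image (alt_group n) r w"
proof -
  obtain y where y: "x = wact y w" "y \<in> {..<r} \<rightarrow> Alt n"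
    using x word_image_Alt[OF w] by auto
  have "(\<lambda>i. g \<circ> y i \<circ> inv' g) \<in> {..<r} \<rightarrow> Alt n"
  proof
    fix i assume "i \<in> {..<r}"
    then have "y i \<in> Alt n" using y(2) by blast
    then show "g \<circ> y i \<circ> inv' g \<in> Alt n" by (intro Alt_comp Alt_inv g)
  qed
  then show ?thesis
    unfolding word_image_Alt[OF w] y(1) wact_conj[OF y(2) g w, symmetric] by blast
qed

text \<open>The value of \<open>g\<close> at \<open>(\<rho> ^^ t) p\<close> arises from
  \<open>g p\<close> by applying the conjugate of \<open>\<rho>\<close> by \<open>g\<close>
  \<open>t\<close> times. Hence that conjugate and the values of \<open>g\<close> on
  \<open>R\<close> determine \<open>g\<close>.\<close>

lemma card_Alt_le_class:
  assumes W: "W \<subseteq> Alt n" "\<And>g x. g \<in> Alt n \<Longrightarrow> x \<in> W \<Longrightarrow> g \<circ> x \<circ> inv' g \<in> W" and \<rho>: "\<rho> \<in> W"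
    and R: "R \<subseteq> {1..n}" "\<And>u. u \<in> {1..n} \<Longrightarrow> \<exists>t. \<exists>p\<in>R. u = (\<rho> ^^ t) p"
  shows "card (Alt n) \<le> card W * n ^ card R"
proof -
  let ?F = "\<lambda>g. (g \<circ> \<rho> \<circ> inv' g, restrict g R)"
  have finR: "finite R" using R(1) finite_subset by blast
  have finW: "finite W" by (rule finite_subset[OF W(1) finite_Alt])
  have "inj_on ?F (Alt n)"
  proof (rule inj_onI)
    fix g h assume g: "g \<in> Alt n" and h: "h \<in> Alt n" and eq: "?F g = ?F h"
    let ?k = "g \<circ> \<rho> \<circ> inv' g"
    have kh: "?k = h \<circ> \<rho> \<circ> inv' h" using eq by simp
    have pow: "f ((\<rho> ^^ t) p) = (?k ^^ t) (f p)" if f: "f \<in> Alt n" "?k = f \<circ> \<rho> \<circ> inv' f" for f t p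
    proof (induction t)
      case (Suc t)
      have "f ((\<rho> ^^ Suc t) p) = ?k (f ((\<rho> ^^ t) p))" unfolding f(2) using f(1) by simp
      then show ?case using Suc by simp
    qed simp
    show "g = h"
    proof (rule Alt_eqI[OF g h])
      fix u assume "u \<in> {1..n}"
      then obtain t p where u: "p \<in> R" "u = (\<rho> ^^ t) p" using R(2) by blast
      have "g p = h p" using eq u(1) by (metis Pair_inject restrict_apply')
      then show "g u = h u" unfolding u(2) pow[OF g refl] pow[OF h kh] by simp
    qed
  qed
  moreover have "?F ` Alt n \<subseteq> W \<times> (R \<rightarrow>\<^sub>E {1..n})"
  proof
    fix z assume "z \<in> ?F ` Alt n"
    then obtain g where g: "g \<in> Alt n" "z = ?F g" by blast
    have "g p \<in> {1..n}" if "p \<in> R" for p using Alt_image_eq[OF g(1), of p] R(1) that by blast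
    then have "restrict g R \<in> R \<rightarrow>\<^sub>E {1..n}" by simp
    then show "z \<in> W \<times> (R \<rightarrow>\<^sub>E {1..n})" using W(2)[OF g(1) \<rho>] g(2) by simp
  qed
  moreover have "finite (W \<times> (R \<rightarrow>\<^sub>E {1..n}))" using finW finR by (intro finite_cartesian_product finite_PiE) auto
  ultimately have "card (Alt n) \<le> card (W \<times> (R \<rightarrow>\<^sub>E {1..n}))" by (rule card_inj_on_le)
  also have "\<dots> = card W * n ^ card R" using finR by (simp add: card_cartesian_product card_funcsetE)
  finally show ?thesis .
qed

lemma rho_power: "b < H \<Longrightarrow> t < l \<Longrightarrow> (rho H l ^^ t) (b * l + 1) = b * l + t + 1"
proof (induction t)
  case (Suc t)
  then show ?case using rho_block[of b H t l] by simp
qed simp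

text \<open>The number of cycles is a common multiple \<open>H\<close> of all \<open>h i\<close>,
  and their length is prime to all \<open>M i\<close> by being 1 modulo the product
  \<open>P\<close>. Then the same \<open>rho H l\<close> lies in every image, and only boundedly
  many points lie outside its blocks.\<close>

lemma word_intersection_density:
  fixes k :: nat
  assumes w: "\<And>i. i \<in> {1..k} \<Longrightarrow> w i \<in> carrier (free_group (r i))"
    "\<And>i. i \<in> {1..k} \<Longrightarrow> w i \<noteq> \<one>\<^bsub>free_group (r i)\<^esub>" and k: "1 \<le> k"
  defines "W \<equiv> \<lambda>n. \<Inter>i\<in>{1..k}. word_image (alt_group n) (r i) (w i)"
  shows "\<And>n. W n \<subseteq> Alt n" "\<And>n g x. g \<in> Alt n \<Longrightarrow> x \<in> W n \<Longrightarrow> g \<circ> x \<circ> inv' g \<in> W n"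
    "\<exists>C N. \<forall>n\<ge>N. W n \<noteq> {} \<and> card (Alt n) \<le> card (W n) * n ^ C"
proof -
  have over: "over (r i) (w i)" if "i \<in> {1..k}" for i
    using w(1)[OF that] by (auto simp: free_group_def over_def)
  show sub: "W n \<subseteq> Alt n" for n
  proof
    fix x assume "x \<in> W n"
    moreover have "1 \<in> {1..k}" using k by simp
    ultimately have "x \<in> word_image (alt_group n) (r 1) (w 1)" unfolding W_def by blast
    then show "x \<in> Alt n" using over[of 1] k wact_Alt by (auto simp: word_image_Alt)
  qed
  show conj: "g \<circ> x \<circ> inv' g \<in> W n" if "g \<in> Alt n" "x \<in> W n" for n g x
    using that word_image_conj[OF over] by (auto simp: W_def)
  have "\<forall>i\<in>{1..k}. \<exists>h>0. \<exists>M>0. \<forall>d l n. 0 < d \<longrightarrow> 0 < l \<longrightarrow> coprime l M \<longrightarrow> h * d * l \<le> n \<longrightarrow>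
    rho (h * d) l \<in> word_image (alt_group n) (r i) (w i)"
    using rho_in_word_image[OF w] by blast
  then obtain h where "\<forall>i\<in>{1..k}. 0 < h i \<and> (\<exists>M>0. \<forall>d l n. 0 < d \<longrightarrow> 0 < l \<longrightarrow> coprime l M \<longrightarrow> h i * d * l \<le> n \<longrightarrow>
    rho (h i * d) l \<in> word_image (alt_group n) (r i) (w i))"
    by metis
  then obtain M where hM: "\<forall>i\<in>{1..k}. 0 < h i \<and> 0 < M i \<and> (\<forall>d l n. 0 < d \<longrightarrow> 0 < l \<longrightarrow> coprime l (M i) \<longrightarrow> h i * d * l \<le> n \<longrightarrow>
    rho (h i * d) l \<in> word_image (alt_group n) (r i) (w i))"
    by metis
  define H where "H = (\<Prod>i\<in>{1..k}. h i)"
  define P where "P = (\<Prod>i\<in>{1..k}. M i)"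
  have H: "0 < H" and P: "0 < P" using hM by (auto simp: H_def P_def intro!: prod_pos)
  \<comment> \<open>One representative for each of the \<open>H\<close> cycles, and room for the at
    most \<open>H * P\<close> points beyond the blocks.\<close>
  define C where "C = H + H * (P + 1)"
  have "W n \<noteq> {} \<and> card (Alt n) \<le> card (W n) * n ^ C" if n: "H \<le> n" for n
  proof -
    \<comment> \<open>The largest number up to \<open>n div H\<close> that is congruent to 1 modulo
      \<open>P\<close>.\<close>
    define l where "l = P * ((n div H - 1) div P) + 1"
    have nH: "1 \<le> n div H" using n H by (simp add: div_greater_zero_iff Suc_leI)
    have "P * ((n div H - 1) div P) \<le> n div H - 1" by simp
    then have "l \<le> n div H" using nH unfolding l_def by linarith
    then have "H * l \<le> H * (n div H)" by (rule mult_le_mono2)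
    also have "\<dots> \<le> n" by (rule times_div_less_eq_dividend)
    finally have Hl: "H * l \<le> n" .
    have "n div H - 1 < P + P * ((n div H - 1) div P)" using P by (rule dividend_less_times_div)
    then have "n div H < l + P" using nH unfolding l_def by linarith
    then have "Suc (n div H) \<le> l + P" by simp
    then have "H * Suc (n div H) \<le> H * (l + P)" by (rule mult_le_mono2)
    moreover have "n < H * Suc (n div H)" using H by (simp add: dividend_less_times_div)
    ultimately have rest: "n - H * l \<le> H * P" by (simp add: algebra_simps)
    have l0: "0 < l" by (simp add: l_def)
    have \<rho>: "rho H l \<in> W n"
      unfolding W_def
    proof
      fix i assume i: "i \<in> {1..k}"
      have "h i dvd H" unfolding H_def using i by (intro dvd_prodI) auto
      then obtain d where d: "H = h i * d" by (elim dvdE)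
      have "0 < d" using H d by simp
      have "coprime (Suc (P * ((n div H - 1) div P))) (P * ((n div H - 1) div P))"
        by (rule coprime_Suc_left_nat)
      moreover have "M i dvd P * ((n div H - 1) div P)"
        unfolding P_def using i by (intro dvd_mult2 dvd_prodI) auto
      ultimately have "coprime l (M i)" unfolding l_def Suc_eq_plus1[symmetric]
        using coprime_divisors[OF dvd_refl] by blast
      then show "rho H l \<in> word_image (alt_group n) (r i) (w i)"
        using hM i \<open>0 < d\<close> l0 Hl d by simp
    qed
    define R where "R = (\<lambda>b. b * l + 1) ` {..<H} \<union> {H * l + 1..n}"
    have R_sub: "R \<subseteq> {1..n}"
    proof -
      have "b * l + 1 \<le> n" if "b < H" for b
      proof -
        have "b * l + l \<le> H * l" using mult_le_mono1[of "Suc b" H l] that by simp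
        then show ?thesis using l0 Hl by linarith
      qed
      then show ?thesis by (auto simp: R_def)
    qed
    have "card R \<le> card ((\<lambda>b. b * l + 1) ` {..<H}) + card {H * l + 1..n}"
      unfolding R_def by (rule card_Un_le)
    also have "\<dots> \<le> H + (n - H * l)"
      using card_image_le[of "{..<H}" "\<lambda>b. b * l + 1"] by simp
    also have "\<dots> \<le> C" using rest by (simp add: C_def)
    finally have cR: "card R \<le> C" .
    have reach: "\<exists>t. \<exists>p\<in>R. u = (rho H l ^^ t) p" if u: "u \<in> {1..n}" for u
    proof (cases "u \<le> H * l")
      case True
      have b: "(u - 1) div l < H" using True u l0 by (simp add: div_less_iff_less_mult) linarith
      have "(u - 1) mod l < l" using l0 by simp
      then have "u = (rho H l ^^ ((u - 1) mod l)) ((u - 1) div l * l + 1)"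
        using rho_power[OF b] u by simp
      moreover have "(u - 1) div l * l + 1 \<in> R" using b by (auto simp: R_def)
      ultimately show ?thesis by blast
    next
      case False
      then have "u \<in> R" "u = (rho H l ^^ 0) u" using u by (auto simp: R_def)
      then show ?thesis by blast
    qed
    have "card (Alt n) \<le> card (W n) * n ^ card R"
      by (rule card_Alt_le_class[OF sub conj \<rho> R_sub reach])
    also have "\<dots> \<le> card (W n) * n ^ C"
      using cR n H by (intro mult_le_mono2 power_increasing) auto
    finally show ?thesis using \<rho> by blast
  qed
  then show "\<exists>C N. \<forall>n\<ge>N. W n \<noteq> {} \<and> card (Alt n) \<le> card (W n) * n ^ C" by blast
qed

section \<open>Convolution and right-invariant subspaces\<close>

definition ip :: "nat \<Rightarrow> ((nat \<Rightarrow> nat) \<Rightarrow> real) \<Rightarrow> ((nat \<Rightarrow> nat) \<Rightarrow> real) \<Rightarrow> real"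
  where "ip n f g = (\<Sum>x\<in>Alt n. f x * g x)"

text \<open>Orthogonality to all functions of degree at most \<open>m\<close>, tested on the
  indicators of the conditions \<open>map x I = J\<close>.\<close>

definition perp :: "nat \<Rightarrow> nat \<Rightarrow> ((nat \<Rightarrow> nat) \<Rightarrow> real) \<Rightarrow> bool"
  where "perp n m g \<longleftrightarrow> (\<forall>I J. length I \<le> m \<longrightarrow> set I \<subseteq> {1..n} \<longrightarrow>
    (\<Sum>x\<in>{x\<in>Alt n. map x I = J}. g x) = 0)"

definition conv :: "nat \<Rightarrow> ((nat \<Rightarrow> nat) \<Rightarrow> real) \<Rightarrow> ((nat \<Rightarrow> nat) \<Rightarrow> real) \<Rightarrow> (nat \<Rightarrow> nat) \<Rightarrow> real"
  where "conv n f g x = (\<Sum>y\<in>Alt n. f (x \<circ> inv' y) * g y)"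

definition rtrans :: "(nat \<Rightarrow> nat) \<Rightarrow> ((nat \<Rightarrow> nat) \<Rightarrow> real) \<Rightarrow> (nat \<Rightarrow> nat) \<Rightarrow> real"
  where "rtrans z f = (\<lambda>x. f (x \<circ> z))"

lemma ip_sym: "ip n f g = ip n g f"
  by (simp add: ip_def mult.commute)

lemma ip_nonneg [simp]: "0 \<le> ip n f f"
  by (simp add: ip_def sum_nonneg)

lemma ip_add_left: "ip n (\<lambda>x. f x + g x) h = ip n f h + ip n g h"
  by (simp add: ip_def sum.distrib distrib_right)

lemma ip_diff_left: "ip n (\<lambda>x. f x - g x) h = ip n f h - ip n g h"
  by (simp add: ip_def sum_subtractf left_diff_distrib)

lemma ip_scale_left: "ip n (\<lambda>x. c * f x) h = c * ip n f h"
  by (simp add: ip_def sum_distrib_left mult.assoc)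

lemma ip_add_right: "ip n h (\<lambda>x. f x + g x) = ip n h f + ip n h g"
  by (simp add: ip_def sum.distrib distrib_left)

lemma ip_diff_right: "ip n h (\<lambda>x. f x - g x) = ip n h f - ip n h g"
  by (simp add: ip_def sum_subtractf right_diff_distrib)

lemma ip_scale_right: "ip n h (\<lambda>x. c * f x) = c * ip n h f"
  by (simp add: ip_def sum_distrib_left algebra_simps)

lemmas ip_linear = ip_add_left ip_diff_left ip_scale_left ip_add_right ip_diff_right ip_scale_right

lemma ip_sum_right: "ip n h (\<lambda>x. \<Sum>i\<in>I. f i x) = (\<Sum>i\<in>I. ip n h (f i))"
  unfolding ip_def sum_distrib_left by (rule sum.swap)

lemma ip_sum_left: "ip n (\<lambda>x. \<Sum>i\<in>I. f i x) h = (\<Sum>i\<in>I. ip n (f i) h)"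
  by (simp add: ip_sum_right ip_sym[of n _ h])

lemma ip_cong: "(\<And>x. x \<in> Alt n \<Longrightarrow> f x = f' x) \<Longrightarrow> (\<And>x. x \<in> Alt n \<Longrightarrow> g x = g' x) \<Longrightarrow> ip n f g = ip n f' g'"
  by (simp add: ip_def)

lemma ip_eq_0_iff: "ip n f f = 0 \<longleftrightarrow> (\<forall>x\<in>Alt n. f x = 0)"
  by (auto simp: ip_def sum_nonneg_eq_0_iff)

lemma ip_rtrans: "z \<in> Alt n \<Longrightarrow> ip n (rtrans z f) (rtrans z g) = ip n f g"
  using sum_Alt_right[of z n "\<lambda>x. f x * g x"] by (simp add: ip_def rtrans_def)

lemma ip_inv: "ip n (\<lambda>y. f (x \<circ> inv' y)) (\<lambda>y. g (x \<circ> inv' y)) = ip n f g" if "x \<in> Alt n"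
  using sum_Alt_inv[of "\<lambda>y. f (x \<circ> y) * g (x \<circ> y)" n] sum_Alt_left[OF that, of "\<lambda>y. f y * g y"]
  by (simp add: ip_def)

lemma conv_ip: "conv n f g x = ip n (\<lambda>y. f (x \<circ> inv' y)) g"
  by (simp add: conv_def ip_def)

lemma conv_rtrans:
  assumes "z \<in> Alt n" shows "conv n f (rtrans z g) x = rtrans z (conv n f g) x"
proof -
  have "(\<Sum>y\<in>Alt n. f (x \<circ> z \<circ> inv' y) * g y) = (\<Sum>y\<in>Alt n. f (x \<circ> z \<circ> inv' (y \<circ> z)) * g (y \<circ> z))"
    by (rule sum_Alt_right[OF assms, symmetric])
  also have "\<dots> = (\<Sum>y\<in>Alt n. f (x \<circ> inv' y) * g (y \<circ> z))"
  proof (rule sum.cong)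
    fix y assume y: "y \<in> Alt n"
    have "x \<circ> z \<circ> inv' (y \<circ> z) = x \<circ> (z \<circ> inv' z) \<circ> inv' y"
      using Alt_inv_comp[OF y assms] by (simp add: comp_assoc)
    then show "f (x \<circ> z \<circ> inv' (y \<circ> z)) * g (y \<circ> z) = f (x \<circ> inv' y) * g (y \<circ> z)"
      using assms by (simp add: Alt_inv_o)
  qed simp
  finally show ?thesis by (simp add: conv_def rtrans_def)
qed

section \<open>Operator norm and multiplicity of singular values\<close>

lemma Bessel:
  assumes I: "finite I" and pos: "\<And>i. i \<in> I \<Longrightarrow> 0 < ip n (u i) (u i)"
    and orth: "\<And>i j. i \<in> I \<Longrightarrow> j \<in> I \<Longrightarrow> i \<noteq> j \<Longrightarrow> ip n (u i) (u j) = 0"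
  shows "(\<Sum>i\<in>I. (ip n f (u i))\<^sup>2 / ip n (u i) (u i)) \<le> ip n f f"
proof -
  define c where "c i = ip n f (u i) / ip n (u i) (u i)" for i
  define s where "s = (\<lambda>x. \<Sum>i\<in>I. c i * u i x)"
  have fs: "ip n f s = (\<Sum>i\<in>I. (ip n f (u i))\<^sup>2 / ip n (u i) (u i))"
    by (simp add: s_def ip_sum_right ip_scale_right) (simp add: c_def power2_eq_square)
  have "ip n (u i) s = ip n f (u i)" if "i \<in> I" for i
  proof -
    have "ip n (u i) s = (\<Sum>j\<in>I. if j = i then ip n f (u i) else 0)"
      unfolding s_def ip_sum_right ip_scale_right
      using pos[OF that] orth[OF that] by (intro sum.cong) (auto simp: c_def)
    then show ?thesis using I that by simp
  qed
  then have "ip n s s = ip n f s"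
    by (subst s_def) (simp add: ip_sum_left ip_scale_left fs, simp add: c_def power2_eq_square)
  then have "ip n (\<lambda>x. f x - s x) (\<lambda>x. f x - s x) = ip n f f - ip n f s"
    by (simp add: ip_linear ip_sym)
  then show ?thesis using fs ip_nonneg[of n "\<lambda>x. f x - s x"] by simp
qed

lemma ip_Cauchy: "(ip n f g)\<^sup>2 \<le> ip n f f * ip n g g"
proof (cases "ip n g g = 0")
  case True
  then have "ip n f g = 0" by (simp add: ip_def[of n f g] ip_eq_0_iff)
  then show ?thesis by simp
next
  case False
  then have "0 < ip n g g" using ip_nonneg[of n g] by linarith
  then show ?thesis
    using Bessel[of "{()}" n "\<lambda>_. g" f] by (simp add: divide_le_eq)
qed

text \<open>The kernel \<open>f (x \<circ> inv' y)\<close> has rows of squared norm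
  \<open>ip n f f\<close>, one for each \<open>x\<close>, and Bessel's inequality applies row by
  row. This is the Hilbert-Schmidt bound for convolution with \<open>f\<close>.\<close>

lemma conv_hilbert_schmidt:
  assumes I: "finite I" and pos: "\<And>i. i \<in> I \<Longrightarrow> 0 < ip n (u i) (u i)"
    and orth: "\<And>i j. i \<in> I \<Longrightarrow> j \<in> I \<Longrightarrow> i \<noteq> j \<Longrightarrow> ip n (u i) (u j) = 0"
  shows "(\<Sum>i\<in>I. ip n (conv n f (u i)) (conv n f (u i)) / ip n (u i) (u i)) \<le> card (Alt n) * ip n f f"
proof -
  have "(\<Sum>i\<in>I. ip n (conv n f (u i)) (conv n f (u i)) / ip n (u i) (u i))
      = (\<Sum>i\<in>I. \<Sum>x\<in>Alt n. (ip n (\<lambda>y. f (x \<circ> inv' y)) (u i))\<^sup>2 / ip n (u i) (u i))"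
    unfolding ip_def[of n "conv n f _"]
    by (simp add: sum_divide_distrib conv_ip power2_eq_square)
  also have "\<dots> = (\<Sum>x\<in>Alt n. \<Sum>i\<in>I. (ip n (\<lambda>y. f (x \<circ> inv' y)) (u i))\<^sup>2 / ip n (u i) (u i))"
    by (rule sum.swap)
  also have "\<dots> \<le> (\<Sum>x\<in>Alt n. ip n f f)"
  proof (rule sum_mono)
    fix x assume "x \<in> Alt n"
    then show "(\<Sum>i\<in>I. (ip n (\<lambda>y. f (x \<circ> inv' y)) (u i))\<^sup>2 / ip n (u i) (u i)) \<le> ip n f f"
      using Bessel[OF assms, where f = "\<lambda>y. f (x \<circ> inv' y)"] ip_inv[of x n f f] by simp
  qed
  finally show ?thesis by simp
qed

lemma perp_lincomb: "perp n m f \<Longrightarrow> perp n m g \<Longrightarrow> perp n m (\<lambda>x. a * f x + b * g x)"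
  by (simp add: perp_def sum.distrib flip: sum_distrib_left)

lemma perp_rtrans:
  assumes "perp n m f" "z \<in> Alt n" shows "perp n m (rtrans z f)"
  unfolding perp_def
proof (intro allI impI)
  fix I J :: "nat list" assume I: "length I \<le> m" "set I \<subseteq> {1..n}"
  have "(\<Sum>x\<in>{x\<in>Alt n. map x I = J}. rtrans z f x) = (\<Sum>x\<in>{x\<in>Alt n. map x (map (inv' z) I) = J}. f x)"
    unfolding rtrans_def
    by (rule sum.reindex_bij_witness[where j = "\<lambda>x. x \<circ> z" and i = "\<lambda>x. x \<circ> inv' z"])
      (use assms(2) in \<open>auto simp: comp_assoc Alt_inv_o\<close>)
  moreover have "set (map (inv' z) I) \<subseteq> {1..n}"
    using I(2) Alt_image_eq[OF Alt_inv[OF assms(2)]] by auto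
  ultimately show "(\<Sum>x\<in>{x\<in>Alt n. map x I = J}. rtrans z f x) = 0"
    using assms(1)[unfolded perp_def, rule_format, of "map (inv' z) I" J] I(1)
    by (simp only: length_map)
qed

definition invariant_subspace :: "nat \<Rightarrow> nat \<Rightarrow> (((nat \<Rightarrow> nat) \<Rightarrow> real) \<Rightarrow> bool) \<Rightarrow> bool"
  where "invariant_subspace n m U \<longleftrightarrow>
    (\<forall>f g a b. U f \<longrightarrow> U g \<longrightarrow> U (\<lambda>x. a * f x + b * g x)) \<and>
    (\<forall>f z. U f \<longrightarrow> z \<in> Alt n \<longrightarrow> U (rtrans z f)) \<and> (\<forall>f. U f \<longrightarrow> perp n m f)"

text \<open>The functions have an infinite domain, so compactness comes from the product topology:
  the set is closed in a product of intervals over \<open>Alt n\<close> and of points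
  \<open>{0}\<close> elsewhere.\<close>

lemma compact_unit_perp:
  "compact {g. (\<forall>x. x \<notin> Alt n \<longrightarrow> g x = 0) \<and> ip n g g = 1 \<and> perp n m g}" (is "compact ?K")
proof -
  define B where "B = PiE UNIV (\<lambda>x. if x \<in> Alt n then {-1..1::real} else {0})"
  have "compactin (product_topology (\<lambda>i. euclidean) UNIV) B"
    unfolding B_def compactin_PiE by (auto simp: compactin_euclidean_iff)
  then have B: "compact B"
    by (simp add: euclidean_product_topology compactin_euclidean_iff)
  have cont: "continuous_on UNIV (\<lambda>g::(nat \<Rightarrow> nat) \<Rightarrow> real. g x)" for x
    by (rule continuous_on_product_coordinates)
  have "closed {g. ip n g g = 1}"
    unfolding ip_def by (intro closed_Collect_eq continuous_intros cont)
  moreover have "closed {g. perp n m g}"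
    unfolding perp_def
    by (intro closed_Collect_all closed_Collect_imp open_Collect_const closed_Collect_eq
        continuous_on_sum cont continuous_on_const)
  ultimately have "compact (B \<inter> ({g. ip n g g = 1} \<inter> {g. perp n m g}))"
    using B by (intro compact_Int_closed closed_Int)
  also have "B \<inter> ({g. ip n g g = 1} \<inter> {g. perp n m g}) = ?K"
  proof -
    have "g x \<in> {-1..1}" if "ip n g g = 1" "x \<in> Alt n" for g x
    proof -
      have "g x * g x \<le> ip n g g"
        unfolding ip_def using that(2) by (intro member_le_sum) auto
      then have "\<bar>g x\<bar> \<le> 1"
        using that(1) abs_square_le_1[of "g x"] by (simp add: power2_eq_square)
      then show ?thesis by auto
    qed
    then show ?thesis by (auto simp: B_def PiE_def Pi_def split: if_splits)
  qed
  finally show ?thesis .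
qed

lemma ip_conv_lincomb:
  "ip n (conv n f (\<lambda>x. a * g x + b * h x)) (conv n f (\<lambda>x. a * g x + b * h x))
    = a^2 * ip n (conv n f g) (conv n f g) + 2 * a * b * ip n (conv n f g) (conv n f h)
      + b^2 * ip n (conv n f h) (conv n f h)"
proof -
  have "conv n f (\<lambda>x. a * g x + b * h x) = (\<lambda>x. a * conv n f g x + b * conv n f h x)"
    by (simp add: fun_eq_iff conv_ip ip_linear)
  then show ?thesis by (simp add: ip_linear ip_sym power2_eq_square algebra_simps)
qed

text \<open>A maximiser of the quadratic form on the compact unit sphere takes the place of the
  spectral theorem; \<open>g0\<close> ensures that the sphere is not empty.\<close>

lemma conv_norm_maximum:
  assumes "perp n m g0" "ip n g0 g0 \<noteq> 0"
  obtains u where "perp n m u" "ip n u u = 1"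
    "\<And>g. perp n m g \<Longrightarrow> ip n (conv n f g) (conv n f g)
      \<le> ip n (conv n f u) (conv n f u) * ip n g g"
proof -
  let ?K = "{g. (\<forall>x. x \<notin> Alt n \<longrightarrow> g x = 0) \<and> ip n g g = 1 \<and> perp n m g}"
  let ?Q = "\<lambda>g. ip n (conv n f g) (conv n f g)"
  define nrm where "nrm g = (\<lambda>x. if x \<in> Alt n then g x / sqrt (ip n g g) else 0)" for g
  have nrm: "nrm g \<in> ?K" "?Q (nrm g) = ?Q g / ip n g g" if g: "perp n m g" "ip n g g \<noteq> 0" for g
  proof -
    have sq: "sqrt (ip n g g) * sqrt (ip n g g) = ip n g g" by simp
    have "ip n (nrm g) (nrm g) = (\<Sum>x\<in>Alt n. g x * g x / ip n g g)"
      unfolding ip_def[of n "nrm g"] by (simp add: nrm_def)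
    also have "\<dots> = ip n g g / ip n g g"
      by (simp add: ip_def flip: sum_divide_distrib)
    finally have "ip n (nrm g) (nrm g) = 1" using g(2) by simp
    moreover have "(\<Sum>x\<in>{x\<in>Alt n. map x I = J}. nrm g x) = (\<Sum>x\<in>{x\<in>Alt n. map x I = J}. g x) / sqrt (ip n g g)" for I J
      by (simp add: nrm_def sum_divide_distrib)
    ultimately show "nrm g \<in> ?K"
      using g by (auto simp: nrm_def perp_def)
    have "conv n f (nrm g) = (\<lambda>x. (1 / sqrt (ip n g g)) * conv n f g x)"
      by (simp add: conv_def nrm_def fun_eq_iff sum_divide_distrib)
    then have "?Q (nrm g) = (1 / sqrt (ip n g g)) * ((1 / sqrt (ip n g g)) * ?Q g)"
      by (simp only: ip_scale_left ip_scale_right)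
    also have "\<dots> = ?Q g / (sqrt (ip n g g) * sqrt (ip n g g))"
      by (simp only: times_divide_times_eq times_divide_eq_left mult_1_left divide_divide_eq_left)
    finally show "?Q (nrm g) = ?Q g / ip n g g"
      unfolding sq .
  qed
  have "continuous_on ?K ?Q"
    unfolding ip_def conv_def
    by (intro continuous_intros continuous_on_subset[OF continuous_on_product_coordinates]) auto
  moreover have "?K \<noteq> {}" using nrm(1)[OF assms] by blast
  ultimately obtain u where u: "u \<in> ?K" "\<And>g. g \<in> ?K \<Longrightarrow> ?Q g \<le> ?Q u"
    using continuous_attains_sup[OF compact_unit_perp[of n m], of ?Q] by blast
  show ?thesis
  proof (rule that[of u])
    fix g assume g: "perp n m g"
    show "?Q g \<le> ?Q u * ip n g g"
    proof (cases "ip n g g = 0")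
      case True
      then have "conv n f g x = 0" for x by (simp add: conv_def ip_eq_0_iff)
      then show ?thesis using True by (simp add: ip_def)
    next
      case False
      then have "0 < ip n g g" using ip_nonneg[of n g] by linarith
      then show ?thesis using u(2)[OF nrm(1)[OF g False]] nrm(2)[OF g False]
        by (simp add: divide_le_eq)
    qed
  qed (use u(1) in auto)
qed

text \<open>The space where the operator norm is attained is invariant, so this singular value occurs at least \<open>N\<close> times.\<close>

lemma conv_norm_bound:
  assumes dim: "\<And>U u. invariant_subspace n m U \<Longrightarrow> U u \<Longrightarrow> 0 < ip n u u \<Longrightarrow>
      \<exists>(I::'i set) v. finite I \<and> N \<le> real (card I) \<and> (\<forall>i\<in>I. U (v i) \<and> 0 < ip n (v i) (v i)) \<and>
        (\<forall>i\<in>I. \<forall>j\<in>I. i \<noteq> j \<longrightarrow> ip n (v i) (v j) = 0)"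
    and g: "perp n m g"
  shows "N * ip n (conv n f g) (conv n f g) \<le> card (Alt n) * ip n f f * ip n g g"
proof (cases "ip n g g = 0")
  case True
  then have "conv n f g x = 0" for x by (simp add: conv_def ip_eq_0_iff)
  then show ?thesis using True by (simp add: ip_def)
next
  case False
  let ?Q = "\<lambda>g. ip n (conv n f g) (conv n f g)"
  obtain u where u: "perp n m u" "ip n u u = 1" "\<And>g. perp n m g \<Longrightarrow> ?Q g \<le> ?Q u * ip n g g"
    using conv_norm_maximum[OF g False] by metis
  \<comment> \<open>The vectors at which the maximal ratio \<open>?Q u\<close> is attained, i.e. the
    top singular space.\<close>
  define U where "U h \<longleftrightarrow> perp n m h \<and> ?Q h = ?Q u * ip n h h" for h
  have "invariant_subspace n m U"
    unfolding invariant_subspace_def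
  proof (intro conjI allI impI)
    fix h1 h2 a b assume h: "U h1" "U h2"
    let ?D = "\<lambda>h. ?Q u * ip n h h - ?Q h"
    let ?h = "\<lambda>a b x. a * h1 x + b * h2 x"
    have nonneg: "0 \<le> ?D (?h a b)" for a b
      using u(3)[OF perp_lincomb] h by (simp add: U_def)
    define e where "e = ?Q u * ip n h1 h2 - ip n (conv n f h1) (conv n f h2)"
    have D: "?D (?h a b) = 2 * a * b * e" for a b
    proof -
      have 1: "ip n (?h a b) (?h a b) = a^2 * ip n h1 h1 + 2 * a * b * ip n h1 h2 + b^2 * ip n h2 h2"
        by (simp add: ip_linear ip_sym[of n h2 h1] power2_eq_square algebra_simps)
      show ?thesis unfolding ip_conv_lincomb 1 e_def
        using h by (simp add: U_def algebra_simps)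
    qed
    \<comment> \<open>The form \<open>?D\<close> is non-negative and vanishes at \<open>h1\<close>
      and \<open>h2\<close>. On their span only the cross term is left, and it would take both signs
      unless \<open>e\<close> is zero.\<close>
    have "e = 0" using nonneg[of 1 1] nonneg[of 1 "-1"] unfolding D by simp
    then show "U (?h a b)"
      using D[of a b] h perp_lincomb by (simp add: U_def)
  next
    fix h z assume "U h" "z \<in> Alt n"
    moreover from this have "ip n (conv n f (rtrans z h)) (conv n f (rtrans z h)) = ?Q h"
      using ip_rtrans[of z n "conv n f h" "conv n f h"] conv_rtrans[of z n f h]
      by (simp cong: ip_cong)
    ultimately show "U (rtrans z h)"
      by (simp add: U_def perp_rtrans ip_rtrans)
  qed (simp add: U_def)
  moreover have "U u" "0 < ip n u u" using u by (simp_all add: U_def)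
  ultimately obtain I :: "'i set" and v where I: "finite I" "N \<le> real (card I)"
    "\<forall>i\<in>I. U (v i) \<and> 0 < ip n (v i) (v i)" "\<forall>i\<in>I. \<forall>j\<in>I. i \<noteq> j \<longrightarrow> ip n (v i) (v j) = 0"
    using dim[of U u] by blast
  \<comment> \<open>Each vector of the orthogonal family contributes the full value
    \<open>?Q u\<close> to the Hilbert-Schmidt norm.\<close>
  have "N * ?Q u \<le> card I * ?Q u" using I(2) by (intro mult_right_mono) auto
  also have "\<dots> = (\<Sum>i\<in>I. ?Q (v i) / ip n (v i) (v i))"
  proof -
    have "?Q (v i) / ip n (v i) (v i) = ?Q u" if "i \<in> I" for i
      using I(3) that by (auto simp: U_def)
    then show ?thesis by simp
  qed
  also have "\<dots> \<le> card (Alt n) * ip n f f"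
    using I by (intro conv_hilbert_schmidt) auto
  finally have *: "N * ?Q u \<le> card (Alt n) * ip n f f" .
  show ?thesis
  proof (cases "N \<ge> 0")
    case True
    then have "N * ?Q g \<le> N * (?Q u * ip n g g)"
      using u(3)[OF g] by (rule mult_left_mono[rotated])
    also have "\<dots> \<le> card (Alt n) * ip n f f * ip n g g"
      using mult_right_mono[OF *, of "ip n g g"] by (simp add: mult.assoc)
    finally show ?thesis .
  next
    case False
    then have "N * ?Q g \<le> 0" by (simp add: mult_nonpos_nonneg)
    also have "0 \<le> card (Alt n) * ip n f f * ip n g g" by simp
    finally show ?thesis .
  qed
qed

section \<open>Joint eigenvectors of double transpositions\<close>

text \<open>Transpositions are used in pairs to stay in the alternating group. The two pairs may
  share a point: \<open>rot\<close> is a three-cycle written in this form.\<close>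

definition dtr :: "nat \<Rightarrow> nat \<Rightarrow> nat \<Rightarrow> nat \<Rightarrow> nat \<Rightarrow> nat"
  where "dtr x y z w = transpose x y \<circ> transpose z w"

lemma transpose_comp_inj:
  assumes "inj g" shows "g \<circ> transpose x y = transpose (g x) (g y) \<circ> g"
  using assms by (auto simp: fun_eq_iff transpose_def inj_eq)

lemma dtr_conj:
  assumes "inj g" shows "g \<circ> dtr x y z w = dtr (g x) (g y) (g z) (g w) \<circ> g"
  using transpose_comp_inj[OF assms, of x y] transpose_comp_inj[OF assms, of z w]
  by (simp add: dtr_def fun_eq_iff)

lemma transpose_pair_Alt:
  assumes "x \<in> {1..n}" "y \<in> {1..n}" "z \<in> {1..n}" "w \<in> {1..n}" "x \<noteq> y" "z \<noteq> w"
  shows "dtr x y z w \<in> Alt n"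
  unfolding Alt_iff dtr_def using assms
  by (auto simp: evenperm_comp permutation_swap_id evenperm_swap
      intro!: permutes_compose permutes_swap_id)

text \<open>
  Blocks of four points are counted downwards from \<open>n\<close>, so that the points outside the first \<open>s\<close> blocks
  are exactly \<open>{1..n - 4 * s}\<close>. The involutions \<open>tt n a 0\<close> and \<open>tt n a 1\<close> generate the Klein four-group on block
  \<open>a\<close>, whose non-trivial characters are permuted cyclically by \<open>rot n a\<close>.
\<close>

definition pt :: "nat \<Rightarrow> nat \<Rightarrow> nat \<Rightarrow> nat"
  where "pt n a c = n - (4 * a + c)"

definition tt :: "nat \<Rightarrow> nat \<Rightarrow> nat \<Rightarrow> nat \<Rightarrow> nat"
  where "tt n a i = (if i = 0 then dtr (pt n a 0) (pt n a 1) (pt n a 2) (pt n a 3)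
                     else dtr (pt n a 0) (pt n a 2) (pt n a 1) (pt n a 3))"

text \<open>Exchanging two blocks of four points takes four transpositions, so it is even.\<close>

definition swapb :: "nat \<Rightarrow> nat \<Rightarrow> nat \<Rightarrow> nat \<Rightarrow> nat"
  where "swapb n a b = dtr (pt n a 0) (pt n b 0) (pt n a 1) (pt n b 1)
     \<circ> dtr (pt n a 2) (pt n b 2) (pt n a 3) (pt n b 3)"

definition rot :: "nat \<Rightarrow> nat \<Rightarrow> nat \<Rightarrow> nat"
  where "rot n a = dtr (pt n a 1) (pt n a 2) (pt n a 2) (pt n a 3)"

context
  fixes n k :: nat assumes k: "4 * k \<le> n"
begin

lemma pt_in: "a < k \<Longrightarrow> c < 4 \<Longrightarrow> pt n a c \<in> {1..n}"
  using k by (auto simp: pt_def)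

lemma pt_eq_iff: "a < k \<Longrightarrow> c < 4 \<Longrightarrow> b < k \<Longrightarrow> d < 4 \<Longrightarrow> pt n a c = pt n b d \<longleftrightarrow> a = b \<and> c = d"
proof -
  assume *: "a < k" "c < 4" "b < k" "d < 4"
  then have "4 * a + c < n" "4 * b + d < n" using k by linarith+
  then have "pt n a c = pt n b d \<longleftrightarrow> 4 * a + c = 4 * b + d" by (auto simp: pt_def)
  also have "\<dots> \<longleftrightarrow> a = b \<and> c = d" using * by presburger
  finally show ?thesis .
qed

lemma pt_bounds: "a < k \<Longrightarrow> c < 4 \<Longrightarrow> Suc 0 \<le> pt n a c \<and> pt n a c \<le> n"
  using pt_in[of a c] by auto

lemma tt_Alt: "a < k \<Longrightarrow> tt n a i \<in> Alt n"
  by (auto simp: tt_def pt_bounds pt_eq_iff intro!: transpose_pair_Alt)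

lemma swapb_Alt: "a < k \<Longrightarrow> b < k \<Longrightarrow> a \<noteq> b \<Longrightarrow> swapb n a b \<in> Alt n"
  unfolding swapb_def by (intro Alt_comp transpose_pair_Alt) (auto simp: pt_bounds pt_eq_iff)

lemma rot_Alt: "a < k \<Longrightarrow> rot n a \<in> Alt n"
  unfolding rot_def by (intro transpose_pair_Alt) (auto simp: pt_bounds pt_eq_iff)

lemma tt_sq: "a < k \<Longrightarrow> tt n a i \<circ> tt n a i = id"
  by (auto simp: fun_eq_iff tt_def dtr_def transpose_def pt_eq_iff)

lemma tt_other: "a < k \<Longrightarrow> b < k \<Longrightarrow> a \<noteq> b \<Longrightarrow> c < 4 \<Longrightarrow> tt n a i (pt n b c) = pt n b c"
  by (auto simp: tt_def dtr_def transpose_def pt_eq_iff)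

lemma tt_conj_fix:
  assumes "inj g" "\<And>c. c < 4 \<Longrightarrow> g (pt n a c) = pt n b c"
  shows "g \<circ> tt n a i = tt n b i \<circ> g"
  using assms(2)[of 0] assms(2)[of 1] assms(2)[of 2] assms(2)[of 3]
  by (simp add: tt_def dtr_conj[OF assms(1)])

lemma tt_commute: "a < k \<Longrightarrow> b < k \<Longrightarrow> tt n a i \<circ> tt n b j = tt n b j \<circ> tt n a i"
proof (cases "a = b")
  case True
  assume "a < k" "b < k"
  then show ?thesis using True
    by (auto simp: fun_eq_iff tt_def dtr_def transpose_def pt_eq_iff)
next
  case False
  assume ab: "a < k" "b < k"
  show ?thesis
    by (rule tt_conj_fix) (use ab False tt_other Alt_bij[OF tt_Alt] in \<open>auto simp: bij_is_inj\<close>)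
qed

lemma swapb_pt: "a < k \<Longrightarrow> b < k \<Longrightarrow> a \<noteq> b \<Longrightarrow> e < k \<Longrightarrow> c < 4 \<Longrightarrow>
    swapb n a b (pt n e c) = pt n (transpose a b e) c"
proof -
  assume "a < k" "b < k" "a \<noteq> b" "e < k" "c < 4"
  moreover from this have "c = 0 \<or> c = 1 \<or> c = 2 \<or> c = 3" by auto
  ultimately show ?thesis
    by (elim disjE) (simp_all add: swapb_def dtr_def transpose_def pt_eq_iff)
qed

lemma swapb_conj:
  assumes "a < k" "b < k" "a \<noteq> b" "e < k"
  shows "tt n e i \<circ> swapb n a b = swapb n a b \<circ> tt n (transpose a b e) i"
proof -
  have "transpose a b e < k" using assms by (auto simp: transpose_def)
  then show ?thesis
    using assms Alt_bij[OF swapb_Alt]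
    by (intro tt_conj_fix[symmetric]) (auto simp: bij_is_inj swapb_pt)
qed

lemma rot_other:
  assumes "a < k" "b < k" "a \<noteq> b"
  shows "tt n b i \<circ> rot n a = rot n a \<circ> tt n b i"
  by (rule tt_conj_fix[symmetric])
    (use assms Alt_bij[OF rot_Alt] in \<open>auto simp: bij_is_inj rot_def dtr_def transpose_def pt_eq_iff\<close>)

lemma rot_same:
  assumes "a < k"
  shows "tt n a 1 \<circ> rot n a = rot n a \<circ> tt n a 0"
    "tt n a 0 \<circ> rot n a = rot n a \<circ> (tt n a 0 \<circ> tt n a 1)"
  using assms by (auto simp: fun_eq_iff rot_def tt_def dtr_def transpose_def pt_eq_iff)

end

text \<open>For an involution, a vector is half the sum of its symmetric and antisymmetric parts, so
  one of them is non-zero. Both stay in \<open>U\<close> and, by commutation, keep the eigenvalues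
  already fixed. The eigenvalues on \<open>T\<close> are prescribed; those on the rest of
  \<open>Q\<close> are found on the way.\<close>

lemma joint_eigenvector:
  fixes t :: "'q \<Rightarrow> nat \<Rightarrow> nat"
  assumes U: "invariant_subspace n m U" and "finite Q"
    and t: "\<And>q. q \<in> P \<Longrightarrow> t q \<in> Alt n" "\<And>q. q \<in> P \<Longrightarrow> t q \<circ> t q = id"
      "\<And>q r. q \<in> P \<Longrightarrow> r \<in> P \<Longrightarrow> t q \<circ> t r = t r \<circ> t q"
    and TP: "T \<subseteq> P" "Q \<subseteq> P"
    and u: "U u" "0 < ip n u u"
    and eig: "\<And>q x. q \<in> T \<Longrightarrow> x \<in> Alt n \<Longrightarrow> u (x \<circ> t q) = \<chi> q * u x"
  obtains u' \<chi>' where "U u'" "0 < ip n u' u'"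
    "\<And>q x. q \<in> T \<union> Q \<Longrightarrow> x \<in> Alt n \<Longrightarrow> u' (x \<circ> t q) = \<chi>' q * u' x"
    "\<And>q. q \<in> T \<Longrightarrow> \<chi>' q = \<chi> q" "\<And>q. q \<in> Q - T \<Longrightarrow> \<chi>' q \<in> {1, -1 :: real}"
proof -
  have "\<exists>u' \<chi>'. U u' \<and> 0 < ip n u' u' \<and> (\<forall>q\<in>T \<union> Q. \<forall>x\<in>Alt n. u' (x \<circ> t q) = \<chi>' q * u' x)
      \<and> (\<forall>q\<in>T. \<chi>' q = \<chi> q) \<and> (\<forall>q\<in>Q - T. \<chi>' q \<in> {1, -1})"
    using \<open>finite Q\<close> TP(2)
  proof (induction Q)
    case empty
    have "\<forall>q\<in>T \<union> {}. \<forall>x\<in>Alt n. u (x \<circ> t q) = \<chi> q * u x" using eig by simp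
    then show ?case using u by blast
  next
    case (insert r Q)
    then have "Q \<subseteq> P" by simp
    from insert.IH[OF this] obtain v \<chi>' where v: "U v" "0 < ip n v v"
      "\<forall>q\<in>T \<union> Q. \<forall>x\<in>Alt n. v (x \<circ> t q) = \<chi>' q * v x"
      "\<forall>q\<in>T. \<chi>' q = \<chi> q" "\<forall>q\<in>Q - T. \<chi>' q \<in> {1, -1}"
      by blast
    show ?case
    proof (cases "r \<in> T")
      case True
      then have *: "T \<union> insert r Q = T \<union> Q" "insert r Q - T = Q - T" by auto
      show ?thesis unfolding * using v by blast
    next
      case False
      have r: "r \<in> P" using insert.prems by auto
      define w where "w s = (\<lambda>x. 1 * v x + s * rtrans (t r) v x)" for s
      have U_w: "U (w s)" for s
        using U v(1) t(1)[OF r] unfolding invariant_subspace_def w_def by blast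
      have w_r: "w s (x \<circ> t r) = s * w s x" if "s = 1 \<or> s = -1" for s x
        using that t(2)[OF r] by (auto simp: w_def rtrans_def comp_assoc)
      have w_q: "w s (x \<circ> t q) = \<chi>' q * w s x" if "q \<in> T \<union> Q" "x \<in> Alt n" for s x q
      proof -
        have q: "q \<in> P" using that TP insert.prems by auto
        have "v (x \<circ> t q \<circ> t r) = v (x \<circ> t r \<circ> t q)"
          using t(3)[OF q r] by (simp add: comp_assoc)
        also have "\<dots> = \<chi>' q * v (x \<circ> t r)"
          using v(3) that t(1)[OF r] by simp
        finally show ?thesis
          using v(3) that by (simp add: w_def rtrans_def algebra_simps)
      qed
      have "\<exists>s. (s = 1 \<or> s = -1) \<and> ip n (w s) (w s) \<noteq> 0"
      proof (rule ccontr)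
        assume "\<not> ?thesis"
        then have "ip n (w 1) (w 1) = 0" "ip n (w (-1)) (w (-1)) = 0" by auto
        then have "v x = 0" if "x \<in> Alt n" for x
          using that by (fastforce simp: ip_eq_0_iff w_def)
        then show False using v(2) by (simp add: ip_def)
      qed
      then obtain s where s: "s = 1 \<or> s = -1" "ip n (w s) (w s) \<noteq> 0" by blast
      have "0 < ip n (w s) (w s)" using s(2) ip_nonneg[of n "w s"] by linarith
      moreover have "\<forall>q\<in>T \<union> insert r Q. \<forall>x\<in>Alt n. w s (x \<circ> t q) = (\<chi>'(r := s)) q * w s x"
        using w_r[OF s(1)] w_q False insert.hyps by auto
      moreover have "\<forall>q\<in>T. (\<chi>'(r := s)) q = \<chi> q" using v(4) False by auto
      moreover have "\<forall>q\<in>insert r Q - T. (\<chi>'(r := s)) q \<in> {1, -1}" using v(5) s(1) by auto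
      ultimately show ?thesis using U_w by blast
    qed
  qed
  then show ?thesis using that by blast
qed

section \<open>Characters of the Klein four-groups and the dimension bound\<close>

definition eigen :: "nat \<Rightarrow> nat \<Rightarrow> ((nat \<Rightarrow> nat) \<Rightarrow> real) \<Rightarrow> (nat \<Rightarrow> nat \<Rightarrow> real) \<Rightarrow> bool"
  where "eigen n k u \<chi> \<longleftrightarrow> 0 < ip n u u \<and>
    (\<forall>a<k. \<forall>i<2. \<chi> a i \<in> {1, -1} \<and> (\<forall>x\<in>Alt n. u (x \<circ> tt n a i) = \<chi> a i * u x))"

text \<open>The blocks whose Klein four-group acts by a non-trivial character.\<close>

definition supp :: "nat \<Rightarrow> (nat \<Rightarrow> nat \<Rightarrow> real) \<Rightarrow> nat set"
  where "supp k \<chi> = {a. a < k \<and> (\<chi> a 0 \<noteq> 1 \<or> \<chi> a 1 \<noteq> 1)}"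

lemma supp_subset: "supp k \<chi> \<subseteq> {..<k}" and finite_supp [simp]: "finite (supp k \<chi>)"
  by (auto simp: supp_def)

lemma eigen_orthogonal:
  assumes k: "4 * k \<le> n" and "eigen n k u \<chi>" "eigen n k v \<psi>" "a < k" "i < 2" "\<chi> a i \<noteq> \<psi> a i"
  shows "ip n u v = 0"
proof -
  have "ip n u v = ip n (rtrans (tt n a i) u) (rtrans (tt n a i) v)"
    using ip_rtrans[OF tt_Alt[OF k \<open>a < k\<close>]] by simp
  also have "\<dots> = ip n (\<lambda>x. \<chi> a i * u x) (\<lambda>x. \<psi> a i * v x)"
    using assms by (intro ip_cong) (auto simp: rtrans_def eigen_def)
  also have "\<dots> = (\<chi> a i * \<psi> a i) * ip n u v" by (simp add: ip_linear)
  also have "\<chi> a i * \<psi> a i = -1"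
  proof -
    have "\<chi> a i \<in> {1, -1}" "\<psi> a i \<in> {1, -1}" using assms(2-5) by (simp_all add: eigen_def)
    then show ?thesis using assms(6) by auto
  qed
  finally show ?thesis by simp
qed

lemma eigen_rtrans:
  assumes k: "4 * k \<le> n" and z: "z \<in> Alt n" and u: "0 < ip n u u"
    and conj: "\<And>a i x. a < k \<Longrightarrow> i < 2 \<Longrightarrow> x \<in> Alt n \<Longrightarrow> u (x \<circ> tt n a i \<circ> z) = \<psi> a i * u (x \<circ> z)"
    and "\<And>a i. a < k \<Longrightarrow> i < 2 \<Longrightarrow> \<psi> a i \<in> {1, -1}"
  shows "eigen n k (rtrans z u) \<psi>"
  unfolding eigen_def ip_rtrans[OF z]
  using u conj assms(5) by (simp add: rtrans_def)

lemma eigen_swap: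
  assumes k: "4 * k \<le> n" and e: "eigen n k u \<chi>" and ab: "a < k" "b < k" "a \<noteq> b"
  shows "eigen n k (rtrans (swapb n a b) u) (\<lambda>c. \<chi> (transpose a b c))"
proof (rule eigen_rtrans[OF k swapb_Alt[OF k ab]])
  fix c i x assume c: "c < k" "i < (2::nat)" "x \<in> Alt n"
  have "transpose a b c < k" using ab c by (auto simp: transpose_def)
  then have "u (x \<circ> swapb n a b \<circ> tt n (transpose a b c) i) = \<chi> (transpose a b c) i * u (x \<circ> swapb n a b)"
    using e c swapb_Alt[OF k ab] by (simp add: eigen_def)
  then show "u (x \<circ> tt n c i \<circ> swapb n a b) = \<chi> (transpose a b c) i * u (x \<circ> swapb n a b)"
    using swapb_conj[OF k ab c(1), of i] by (simp add: comp_assoc)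
qed (use ab e in \<open>auto simp: eigen_def transpose_def\<close>)

lemma eigen_rot:
  assumes k: "4 * k \<le> n" and e: "eigen n k u \<chi>" and a: "a < k"
  shows "eigen n k (rtrans (rot n a) u)
    (\<lambda>c i. if c = a then (if i = 0 then \<chi> a 0 * \<chi> a 1 else \<chi> a 0) else \<chi> c i)"
proof (rule eigen_rtrans[OF k rot_Alt[OF k a]])
  fix c i x assume c: "c < k" "i < (2::nat)" "x \<in> Alt n"
  have E: "u (y \<circ> tt n b j) = \<chi> b j * u y" if "b < k" "j < 2" "y \<in> Alt n" for b j y
    using e that by (simp add: eigen_def)
  have r: "x \<circ> rot n a \<in> Alt n" using c rot_Alt[OF k a] by simp
  show "u (x \<circ> tt n c i \<circ> rot n a)
      = (if c = a then (if i = 0 then \<chi> a 0 * \<chi> a 1 else \<chi> a 0) else \<chi> c i) * u (x \<circ> rot n a)"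
  proof (cases "c = a")
    case False
    then have "x \<circ> tt n c i \<circ> rot n a = x \<circ> rot n a \<circ> tt n c i"
      using rot_other[OF k a c(1), of i] by (simp add: comp_assoc)
    then show ?thesis using False E[OF c(1,2) r] by simp
  next
    case True
    show ?thesis
    proof (cases "i = 0")
      case i: True
      have "x \<circ> tt n c i \<circ> rot n a = x \<circ> rot n a \<circ> tt n a 0 \<circ> tt n a 1"
        using rot_same(2)[OF k a] i True by (simp add: comp_assoc)
      then show ?thesis
        using E[of a 1 "x \<circ> rot n a \<circ> tt n a 0"] E[of a 0 "x \<circ> rot n a"] r a tt_Alt[OF k a, of 0] i True
        by (simp add: mult_ac)
    next
      case i: False
      then have "x \<circ> tt n c i \<circ> rot n a = x \<circ> rot n a \<circ> tt n a 0"
        using rot_same(1)[OF k a] c(2) True by (simp add: comp_assoc less_2_cases_iff)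
      then show ?thesis
        using E[of a 0 "x \<circ> rot n a"] r a i True by simp
    qed
  qed
next
  have "\<chi> a 0 \<in> {1, -1}" "\<chi> a 1 \<in> {1, -1}" using e a by (simp_all add: eigen_def)
  then show "(if c = a then (if i = 0 then \<chi> a 0 * \<chi> a 1 else \<chi> a 0) else \<chi> c i) \<in> {1, -1}"
    if "c < k" "i < 2" for c i
    using that e by (auto simp: eigen_def)
qed (use e in \<open>simp add: eigen_def\<close>)

text \<open>Exchanging a block of the support outside \<open>T\<close> with a block of
  \<open>T\<close> outside the support brings the support one step closer to
  \<open>T\<close>.\<close>

lemma eigen_any_support:
  assumes k: "4 * k \<le> n" and U: "invariant_subspace n m U"
    and "U u" "eigen n k u \<chi>" "T \<subseteq> {..<k}" "card T = card (supp k \<chi>)"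
  shows "\<exists>u' \<chi>'. U u' \<and> eigen n k u' \<chi>' \<and> supp k \<chi>' = T"
  using assms(3-)
proof (induction "card (T - supp k \<chi>)" arbitrary: u \<chi>)
  case 0
  then have "T \<subseteq> supp k \<chi>" using finite_subset[OF 0(4)] by auto
  then have "T = supp k \<chi>" using 0 by (intro card_subset_eq) auto
  then show ?case using 0 by blast
next
  case (Suc d)
  have finT: "finite T" using Suc.prems(3) finite_subset by blast
  obtain a where a: "a \<in> T - supp k \<chi>" using Suc(2) by (metis card_gt_0_iff ex_in_conv zero_less_Suc)
  have "supp k \<chi> - T \<noteq> {}"
  proof
    assume "supp k \<chi> - T = {}"
    then have "supp k \<chi> = T" using Suc.prems(4) finT by (intro card_subset_eq) auto
    then show False using a by simp
  qed
  then obtain b where b: "b \<in> supp k \<chi> - T" by blast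
  have ab: "a < k" "b < k" "a \<noteq> b" using a b Suc.prems(3) supp_subset by auto
  let ?\<chi> = "\<lambda>c. \<chi> (transpose a b c)"
  have supp: "supp k ?\<chi> = insert a (supp k \<chi> - {b})"
    using a b ab by (auto simp: supp_def transpose_def split: if_splits)
  have "T - supp k ?\<chi> = (T - supp k \<chi>) - {a}" using supp b by auto
  then have "d = card (T - supp k ?\<chi>)" using Suc(2) a finT by simp
  moreover have "card T = card (supp k ?\<chi>)"
  proof -
    have "a \<notin> supp k \<chi> - {b}" using a by simp
    then have "card (supp k ?\<chi>) = Suc (card (supp k \<chi> - {b}))" unfolding supp by simp
    also have "\<dots> = card (supp k \<chi>)" using b by (intro card_Suc_Diff1) auto
    finally show ?thesis using Suc.prems(4) by simp
  qed
  moreover have "U (rtrans (swapb n a b) u)"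
    using U Suc.prems(1) swapb_Alt[OF k ab] by (simp add: invariant_subspace_def)
  ultimately show ?case
    using Suc(1) eigen_swap[OF k Suc.prems(2) ab] Suc.prems(3) by blast
qed

text \<open>Source of \<open>k choose s\<close> orthogonal vectors from a support of
  \<open>s\<close> blocks: different supports mean different characters. It is effective as long as
  the support is at most half of all blocks.\<close>

lemma eigen_family_blocks:
  assumes k: "4 * k \<le> n" and U: "invariant_subspace n m U" and u: "U u" "eigen n k u \<chi>"
  shows "\<exists>v. (\<forall>T\<in>{T. T \<subseteq> {..<k} \<and> card T = card (supp k \<chi>)}. U (v T) \<and> 0 < ip n (v T) (v T)) \<and>
    (\<forall>T\<in>{T. T \<subseteq> {..<k} \<and> card T = card (supp k \<chi>)}. \<forall>T'\<in>{T. T \<subseteq> {..<k} \<and> card T = card (supp k \<chi>)}.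
      T \<noteq> T' \<longrightarrow> ip n (v T) (v T') = 0)"
proof -
  let ?F = "{T. T \<subseteq> {..<k} \<and> card T = card (supp k \<chi>)}"
  have "\<forall>T\<in>?F. \<exists>u' \<chi>'. U u' \<and> eigen n k u' \<chi>' \<and> supp k \<chi>' = T"
    using eigen_any_support[OF k U u] by simp
  then obtain v \<psi> where v: "\<forall>T\<in>?F. U (v T) \<and> eigen n k (v T) (\<psi> T) \<and> supp k (\<psi> T) = T"
    by metis
  have "ip n (v T) (v T') = 0" if T: "T \<in> ?F" "T' \<in> ?F" "T \<noteq> T'" for T T'
  proof -
    have "supp k (\<psi> T) \<noteq> supp k (\<psi> T')" using v T by auto
    then have "\<exists>a<k. \<exists>i<2. \<psi> T a i \<noteq> \<psi> T' a i"
      unfolding supp_def by (metis (no_types, lifting) one_less_numeral_iff pos2 semiring_norm(76))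
    then show ?thesis using eigen_orthogonal[OF k] v T(1,2) by blast
  qed
  moreover have "\<forall>T\<in>?F. U (v T) \<and> 0 < ip n (v T) (v T)"
    using v by (simp add: eigen_def)
  ultimately show ?thesis by blast
qed

text \<open>Source of \<open>2 ^ s\<close> orthogonal vectors from a support of \<open>s\<close>
  blocks, by rotating any chosen subset of them. It serves for large supports, where the binomial
  coefficient may be small.\<close>

lemma eigen_family_rotations:
  assumes k: "4 * k \<le> n" and U: "invariant_subspace n m U" and u: "U u" "eigen n k u \<chi>"
  shows "\<exists>v. (\<forall>T\<in>Pow (supp k \<chi>). U (v T) \<and> 0 < ip n (v T) (v T)) \<and>
    (\<forall>T\<in>Pow (supp k \<chi>). \<forall>T'\<in>Pow (supp k \<chi>). T \<noteq> T' \<longrightarrow> ip n (v T) (v T') = 0)"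
proof -
  define \<psi> where "\<psi> T = (\<lambda>c i. if c \<in> T then (if i = 0 then \<chi> c 0 * \<chi> c 1 else \<chi> c 0) else \<chi> c i)" for T
  have "\<exists>v. U v \<and> eigen n k v (\<psi> T)" if "T \<subseteq> supp k \<chi>" for T
    using finite_subset[OF that finite_supp] that
  proof (induction T)
    case empty
    then show ?case using u by (auto simp: \<psi>_def)
  next
    case (insert a T)
    then obtain v where v: "U v" "eigen n k v (\<psi> T)" by auto
    have a: "a < k" using insert.prems supp_subset by auto
    have "(\<lambda>c i. if c = a then (if i = 0 then \<psi> T a 0 * \<psi> T a 1 else \<psi> T a 0) else \<psi> T c i) = \<psi> (insert a T)"
      using insert.hyps by (auto simp: \<psi>_def fun_eq_iff)
    then have "eigen n k (rtrans (rot n a) v) (\<psi> (insert a T))"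
      using eigen_rot[OF k v(2) a] by simp
    moreover have "U (rtrans (rot n a) v)"
      using U v(1) rot_Alt[OF k a] by (simp add: invariant_subspace_def)
    ultimately show ?case by blast
  qed
  then have "\<forall>T\<in>Pow (supp k \<chi>). \<exists>v. U v \<and> eigen n k v (\<psi> T)" by blast
  then obtain v where v: "\<forall>T\<in>Pow (supp k \<chi>). U (v T) \<and> eigen n k (v T) (\<psi> T)"
    by metis
  have *: "ip n (v T) (v T') = 0" if T: "T \<subseteq> supp k \<chi>" "T' \<subseteq> supp k \<chi>" "a \<in> T" "a \<notin> T'" for T T' a
  proof -
    have a: "a \<in> supp k \<chi>" using T by auto
    then have ak: "a < k" by (simp add: supp_def)
    have c: "\<chi> a 0 \<in> {1, -1}" "\<chi> a 1 \<in> {1, -1}" using u(2) ak by (auto simp: eigen_def)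
    \<comment> \<open>The rotation takes the signs \<open>(c0, c1)\<close> of a block to
      \<open>(c0 * c1, c0)\<close>, which fixes only the trivial character.\<close>
    have "\<psi> T a 0 \<noteq> \<psi> T' a 0 \<or> \<psi> T a 1 \<noteq> \<psi> T' a 1"
      using c a T by (auto simp: \<psi>_def supp_def)
    then obtain i where "i < 2" "\<psi> T a i \<noteq> \<psi> T' a i" by (metis one_less_numeral_iff pos2 semiring_norm(76))
    moreover have "eigen n k (v T) (\<psi> T)" "eigen n k (v T') (\<psi> T')" using v T(1,2) by blast+
    ultimately show ?thesis using eigen_orthogonal[OF k] ak by blast
  qed
  have "ip n (v T) (v T') = 0" if T: "T \<subseteq> supp k \<chi>" "T' \<subseteq> supp k \<chi>" "T \<noteq> T'" for T T'
  proof -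
    obtain a where "a \<in> T \<and> a \<notin> T' \<or> a \<in> T' \<and> a \<notin> T" using T by blast
    then show ?thesis using *[of T T' a] *[of T' T a] T ip_sym[of n "v T"] by auto
  qed
  moreover have "\<forall>T\<in>Pow (supp k \<chi>). U (v T) \<and> 0 < ip n (v T) (v T)"
    using v by (simp add: eigen_def)
  ultimately show ?thesis by (intro exI[of _ v]) auto
qed

text \<open>Two double transpositions that share one transposition and a point of the other multiply
  to a three-cycle, and conjugation gives all three-cycles. Six points allow four to be moved as
  desired by an even permutation.\<close>

lemma Alt_subset_of_double_transposition:
  assumes H: "id \<in> H" "\<And>a b. a \<in> H \<Longrightarrow> b \<in> H \<Longrightarrow> a \<circ> b \<in> H" "\<And>a. a \<in> H \<Longrightarrow> inv' a \<in> H"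
    and x: "distinct [x0, x1, x2, x3]" "set [x0, x1, x2, x3] \<subseteq> {1..n}" and n: "6 \<le> n"
    and conj: "\<And>g. g \<in> Alt n \<Longrightarrow> g \<circ> dtr x0 x1 x2 x3 \<circ> inv' g \<in> H"
  shows "Alt n \<subseteq> H"
proof -
  have "card ({1..n} - {x0, x1, x2, x3}) = n - 4"
    using x by (subst card_Diff_subset) auto
  then have "0 < card ({1..n} - {x0, x1, x2, x3})" using n by linarith
  then have "{1..n} - {x0, x1, x2, x3} \<noteq> {}" by (metis card.empty less_irrefl)
  then obtain x4 where x4: "x4 \<in> {1..n}" "x4 \<notin> {x0, x1, x2, x3}" by blast
  let ?t = "dtr x0 x1 x2 x3"
  \<comment> \<open>\<open>h\<close> replaces \<open>x3\<close> by \<open>x4\<close> and fixes the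
    other three points; the conjugate of \<open>?t\<close> is then \<open>dtr x0 x1 x2 x4\<close>,
    whose first transposition cancels that of \<open>?t\<close>.\<close>
  obtain h where h: "h \<in> Alt n" "\<And>y. y \<in> {x0, x1, x2, x3} \<Longrightarrow> h y = (if y = x3 then x4 else y)"
  proof (rule Alt_extend)
    show "bij_betw (\<lambda>y. if y = x3 then x4 else y) {x0, x1, x2, x3} {x0, x1, x2, x4}"
      using x x4 by (auto simp: bij_betw_def inj_on_def)
    show "card {x0, x1, x2, x3} + 2 \<le> n" using x(1) n by simp
  qed (use x x4 in auto)
  have three: "cycle_of_list [a, b, c] \<in> H"
    if abc: "distinct [a, b, c]" "set [a, b, c] \<subseteq> {1..n}" for a b c
  proof -
    define f where "f = (\<lambda>y. if y = x3 then a else if y = x2 then b else c)"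
    obtain g where g: "g \<in> Alt n" "\<And>y. y \<in> {x3, x2, x4} \<Longrightarrow> g y = f y"
    proof (rule Alt_extend)
      show "bij_betw f {x3, x2, x4} {a, b, c}"
        using x x4 abc by (auto simp: bij_betw_def inj_on_def f_def)
      show "card {x3, x2, x4} + 2 \<le> n" using x x4 n by (simp add: card_insert_if)
    qed (use x x4 abc in auto)
    have gh: "g \<circ> h \<in> Alt n" using g h by simp
    have inj: "inj g" "inj h" using g(1) h(1) Alt_bij bij_is_inj by blast+
    have ht: "h \<circ> ?t \<circ> inv' h = dtr x0 x1 x2 x4"
      unfolding dtr_conj[OF inj(2)] using h x(1) by (simp add: comp_assoc Alt_inv_o)
    have c0: "?t \<circ> dtr x0 x1 x2 x4 = transpose x2 x3 \<circ> transpose x2 x4"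
      using x x4 by (auto simp: fun_eq_iff dtr_def transpose_def)
    have "(g \<circ> ?t \<circ> inv' g) \<circ> ((g \<circ> h) \<circ> ?t \<circ> inv' (g \<circ> h))
        = g \<circ> ?t \<circ> (inv' g \<circ> g) \<circ> (h \<circ> ?t \<circ> inv' h) \<circ> inv' g"
      using Alt_inv_comp[OF g(1) h(1)] by (simp add: comp_assoc)
    also have "\<dots> = g \<circ> (?t \<circ> dtr x0 x1 x2 x4) \<circ> inv' g"
      using Alt_inv_o(1)[OF g(1)] ht by (simp add: comp_assoc)
    also have "\<dots> = transpose (g x2) (g x3) \<circ> transpose (g x2) (g x4) \<circ> (g \<circ> inv' g)"
      unfolding c0 using dtr_conj[OF inj(1), of x2 x3 x2 x4] by (simp add: dtr_def fun_eq_iff)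
    also have "\<dots> = cycle_of_list [a, b, c]"
      using g x x4 by (simp add: Alt_inv_o f_def transpose_commute)
    finally show ?thesis using H(2)[OF conj[OF g(1)] conj[OF gh]] by simp
  qed
  have cyc: "p \<in> H" if p: "p \<in> three_cycles n" for p
  proof -
    obtain cs where cs: "p = cycle_of_list cs" "distinct cs" "length cs = 3" "set cs \<subseteq> {1..n}"
      using p by blast
    then obtain a b c where "cs = [a, b, c]"
      by (auto simp: length_Suc_conv eval_nat_numeral)
    then show ?thesis using three cs by blast
  qed
  show ?thesis
  proof
    fix p assume "p \<in> Alt n"
    then have "p \<in> generate (alt_group n) (three_cycles n)"
      using alt_group_carrier_as_three_cycles by blast
    then show "p \<in> H"
    proof (induction rule: generate.induct)
      case one
      then show ?case using H(1) by (simp only: alt_group_one)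
    next
      case (inv h)
      then show ?case using cyc[OF inv] H(3) three_cycles_incl[of n] by (auto simp: alt_group_inv_equality)
    next
      case (eng h1 h2)
      then show ?case using H(2) by (simp only: alt_group_mult)
    qed (use cyc in blast)
  qed
qed

lemma joint_eigen:
  assumes k: "4 * k \<le> n" and U: "invariant_subspace n m U" and T: "T \<subseteq> {..<k} \<times> {..<2}"
    and u: "U u" "0 < ip n u u"
    and eig: "\<And>a i x. (a, i) \<in> T \<Longrightarrow> x \<in> Alt n \<Longrightarrow> u (x \<circ> tt n a i) = \<chi> a i * u x"
    and sgn: "\<And>a i. (a, i) \<in> T \<Longrightarrow> \<chi> a i \<in> {1, -1}"
  obtains u' \<chi>' where "U u'" "eigen n k u' \<chi>'" "\<And>a i. (a, i) \<in> T \<Longrightarrow> \<chi>' a i = \<chi> a i"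
proof -
  let ?P = "{..<k} \<times> {..<2::nat}"
  have fin: "finite ?P" by simp
  obtain u' \<chi>' where *: "U u'" "0 < ip n u' u'"
    "\<And>q x. q \<in> T \<union> ?P \<Longrightarrow> x \<in> Alt n \<Longrightarrow> u' (x \<circ> tt n (fst q) (snd q)) = \<chi>' q * u' x"
    "\<And>q. q \<in> T \<Longrightarrow> \<chi>' q = \<chi> (fst q) (snd q)" "\<And>q. q \<in> ?P - T \<Longrightarrow> \<chi>' q \<in> {1, -1 :: real}"
  proof (rule joint_eigenvector[OF U fin, of ?P "\<lambda>q. tt n (fst q) (snd q)" T u "\<lambda>q. \<chi> (fst q) (snd q)"])
    show "tt n (fst q) (snd q) \<circ> tt n (fst r) (snd r) = tt n (fst r) (snd r) \<circ> tt n (fst q) (snd q)"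
      if "q \<in> ?P" "r \<in> ?P" for q r
      using that tt_commute[OF k, of "fst q" "fst r" "snd q" "snd r"] by auto
    show "u (x \<circ> tt n (fst q) (snd q)) = \<chi> (fst q) (snd q) * u x" if "q \<in> T" "x \<in> Alt n" for q x
      using that eig[of "fst q" "snd q" x] by simp
  qed (use T u tt_Alt[OF k] tt_sq[OF k] in auto)
  have "\<chi>' (a, i) \<in> {1, -1} \<and> (\<forall>x\<in>Alt n. u' (x \<circ> tt n a i) = \<chi>' (a, i) * u' x)" if "a < k" "i < 2" for a i
  proof -
    have "\<chi>' (a, i) \<in> {1, -1}"
      using *(4)[of "(a, i)"] *(5)[of "(a, i)"] sgn[of a i] that by (cases "(a, i) \<in> T") auto
    then show ?thesis using *(3)[of "(a, i)"] that by simp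
  qed
  then have "eigen n k u' (\<lambda>a i. \<chi>' (a, i))"
    using *(2) by (auto simp: eigen_def)
  then show ?thesis using that *(1,4) by fastforce
qed

lemma Alt_mono:
  assumes "m \<le> n" shows "Alt m \<subseteq> Alt n"
proof
  fix p assume "p \<in> Alt m"
  then have p: "p permutes {1..m}" "evenperm p" by (simp_all only: Alt_iff)
  have "{1..m} \<subseteq> {1..n}" using assms by auto
  then show "p \<in> Alt n" using permutes_subset[OF p(1)] p(2) by (simp only: Alt_iff)
qed

text \<open>Invariance makes \<open>u\<close> constant on the permutations agreeing with
  \<open>x\<close> at the points \<open>n' + 1, ..., n\<close>. These are at most \<open>m\<close>
  points, so \<open>perp\<close> makes the sum over this non-empty set vanish.\<close>

lemma fixed_by_smaller_Alt_imp_zero: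
  assumes u: "perp n m u" and s: "n - n' \<le> m" "n' \<le> n"
    and fixed: "\<And>y z. y \<in> Alt n \<Longrightarrow> z \<in> Alt n' \<Longrightarrow> u (y \<circ> z) = u y" and x: "x \<in> Alt n"
  shows "u x = 0"
proof -
  define I where "I = [Suc n'..<Suc n]"
  have I: "length I \<le> m" "set I \<subseteq> {1..n}" using s by (auto simp: I_def)
  let ?S = "{y\<in>Alt n. map y I = map x I}"
  have "u y = u x" if y: "y \<in> ?S" for y
  proof -
    define z where "z = inv' x \<circ> y"
    have z: "z \<in> Alt n" using x y by (simp add: z_def)
    have "z a = a" if "a \<notin> {1..n'}" for a
    proof (cases "a \<in> {1..n}")
      case True
      then have "a \<in> set I" using that by (auto simp: I_def)
      then have "y a = x a" using y by auto
      then show ?thesis using x by (simp add: z_def)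
    next
      case False
      then show ?thesis using permutes_not_in[OF Alt_permutes[OF z]] by blast
    qed
    then have "z permutes {1..n'}"
      by (intro permutes_superset[OF Alt_permutes[OF z]]) blast
    then have "z \<in> Alt n'" using z by (simp add: Alt_iff)
    moreover have "x \<circ> z = y" using x by (simp add: z_def comp_assoc[symmetric] Alt_inv_o)
    ultimately show ?thesis using fixed[OF x] by metis
  qed
  then have "(\<Sum>y\<in>?S. u y) = (\<Sum>y\<in>?S. u x)" by (intro sum.cong) auto
  then have "real (card ?S) * u x = (\<Sum>y\<in>?S. u y)" by simp
  also have "\<dots> = 0" using u[unfolded perp_def] I by blast
  finally have "card ?S = 0 \<or> u x = 0" by simp
  moreover have "0 < card ?S" using x by (auto simp: card_gt_0_iff)
  ultimately show ?thesis by linarith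
qed

text \<open>
  A vector of maximal support is fixed by every double transposition outside its support; if the support is
  small, the vector therefore has low degree.
\<close>

lemma eigen_large_support:
  assumes k: "4 * k \<le> n" and j: "1 \<le> j" "j < k" and U: "invariant_subspace n (4 * (j - 1)) U"
    and u0: "U u0" "0 < ip n u0 u0"
  shows "\<exists>u \<chi>. U u \<and> eigen n k u \<chi> \<and> j \<le> card (supp k \<chi>)"
proof (rule ccontr)
  assume neg: "\<not> ?thesis"
  then have less: "card (supp k \<chi>) < j" if "U u" "eigen n k u \<chi>" for u \<chi>
    using that not_le by blast
  \<comment> \<open>The largest support size \<open>s\<close> occurring in \<open>U\<close> exists
    because all sizes are below \<open>j\<close> by the assumption to be refuted.\<close>
  define P where "P s \<longleftrightarrow> (\<exists>u \<chi>. U u \<and> eigen n k u \<chi> \<and> card (supp k \<chi>) = s)" for s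
  obtain u1 \<chi>1 where "U u1" "eigen n k u1 \<chi>1"
    by (rule joint_eigen[OF k U empty_subsetI u0]) auto
  then have "P (card (supp k \<chi>1))" by (auto simp: P_def)
  moreover have "\<forall>s. P s \<longrightarrow> s \<le> j" using less by (force simp: P_def)
  ultimately have "P (GREATEST s. P s)" "\<And>s'. P s' \<Longrightarrow> s' \<le> (GREATEST s. P s)"
    by (auto intro: GreatestI_nat[where b = j] Greatest_le_nat[where b = j])
  then obtain s where s: "P s" "\<And>s'. P s' \<Longrightarrow> s' \<le> s" by blast
  from s(1) obtain u2 \<chi>2 where u2: "U u2" "eigen n k u2 \<chi>2" "card (supp k \<chi>2) = s"
    by (auto simp: P_def)
  have sj: "s < j" using less u2 by blast
  obtain u \<chi> where u: "U u" "eigen n k u \<chi>" "supp k \<chi> = {..<s}"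
    using eigen_any_support[OF k U u2(1,2), of "{..<s}"] u2(3) sj j by auto
  have E: "u (y \<circ> tt n b i) = \<chi> b i * u y" if "b < k" "i < 2" "y \<in> Alt n" for b i y
    using u(2) that by (simp add: eigen_def)
  let ?n = "n - 4 * s"
  let ?t = "tt n s 0"
  have sk: "s < k" using sj j by simp
  have n': "?n \<le> n" "6 \<le> ?n" using k sj j by linarith+
  have Alt_mono: "Alt ?n \<subseteq> Alt n" by (rule Alt_mono) simp
  have t: "?t \<in> Alt n" using tt_Alt[OF k sk] .
  have inv_conj: "u (y \<circ> (inv' g \<circ> ?t \<circ> g)) = u y" if y: "y \<in> Alt n" and g: "g \<in> Alt ?n" for g y
  proof -
    have gn: "g \<in> Alt n" using g Alt_mono by blast
    \<comment> \<open>Up to a factor 2, the part of \<open>rtrans g u\<close> on which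
      \<open>?t\<close> acts by -1. If it were non-zero, it would keep the characters on the first
      \<open>s\<close> blocks and acquire a non-trivial one on block \<open>s\<close>, so some
      support would exceed the maximum.\<close>
    define v where "v = (\<lambda>x. 1 * rtrans g u x + (-1) * rtrans ?t (rtrans g u) x)"
    have v: "v x = u (x \<circ> g) - u (x \<circ> ?t \<circ> g)" for x by (simp add: v_def rtrans_def)
    have "U v" using U u(1) gn t unfolding invariant_subspace_def v_def by blast
    show ?thesis
    proof (cases "ip n v v = 0")
      case True
      then have "v (y \<circ> inv' g) = 0" using y gn by (simp add: ip_eq_0_iff)
      then show ?thesis using gn by (simp add: v comp_assoc Alt_inv_o)
    next
      case False
      then have pos: "0 < ip n v v" using ip_nonneg[of n v] by linarith
      \<comment> \<open>The first \<open>s\<close> blocks consist of the points above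
        \<open>n - 4 * s\<close>, which \<open>g\<close> fixes.\<close>
      have g_comm: "g \<circ> tt n b i = tt n b i \<circ> g" if b: "b < s" for b i
      proof (rule tt_conj_fix[OF k])
        show "inj g" using gn Alt_bij bij_is_inj by blast
        fix c :: nat assume "c < 4"
        then have "pt n b c \<notin> {1..?n}" using b k sk unfolding pt_def by auto
        then show "g (pt n b c) = pt n b c" using Alt_permutes[OF g] by (rule permutes_not_in[rotated])
      qed
      define \<psi> where "\<psi> b i = (if b = s then -1 else \<chi> b i)" for b i
      let ?T = "{..<s} \<times> {..<2::nat} \<union> {(s, 0)}"
      obtain u' \<chi>' where u': "U u'" "eigen n k u' \<chi>'" "\<And>a i. (a, i) \<in> ?T \<Longrightarrow> \<chi>' a i = \<psi> a i"
      proof (rule joint_eigen[OF k U _ \<open>U v\<close> pos, of ?T \<psi>])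
        fix b i x assume bi: "(b, i) \<in> ?T" and x: "x \<in> Alt n"
        show "v (x \<circ> tt n b i) = \<psi> b i * v x"
        proof (cases "b = s")
          case True
          then have "tt n b i \<circ> ?t = id" using bi tt_sq[OF k sk] by auto
          then show ?thesis using True bi by (auto simp: v \<psi>_def comp_assoc)
        next
          case False
          then have b: "b < s" "i < 2" "b < k" using bi sk by auto
          have "u (x \<circ> tt n b i \<circ> g) = u (x \<circ> g \<circ> tt n b i)"
            using g_comm[OF b(1), of i] by (simp add: comp_assoc)
          moreover have "u (x \<circ> tt n b i \<circ> ?t \<circ> g) = u (x \<circ> ?t \<circ> g \<circ> tt n b i)"
          proof -
            have "tt n b i \<circ> ?t \<circ> g = ?t \<circ> (tt n b i \<circ> g)"
              using tt_commute[OF k b(3) sk, of i 0] by (simp add: comp_assoc[symmetric])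
            also have "\<dots> = ?t \<circ> g \<circ> tt n b i" using g_comm[OF b(1), of i] by (simp add: comp_assoc)
            finally show ?thesis by (simp add: comp_assoc)
          qed
          ultimately show ?thesis
            using E[OF b(3,2), of "x \<circ> g"] E[OF b(3,2), of "x \<circ> ?t \<circ> g"] x gn t False
            by (simp add: v \<psi>_def algebra_simps)
        qed
      next
        fix b i assume "(b, i) \<in> ?T"
        then have "b = s \<or> b < k \<and> i < 2" using sk by auto
        then show "\<psi> b i \<in> {1, -1}" using u(2) by (auto simp: \<psi>_def eigen_def)
      qed (use sk in auto)
      have "{..<Suc s} \<subseteq> supp k \<chi>'"
      proof
        fix b assume "b \<in> {..<Suc s}"
        then consider "b < s" | "b = s" by fastforce
        then show "b \<in> supp k \<chi>'"
        proof cases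
          case 1
          then have "b \<in> supp k \<chi>" using u(3) by simp
          then show ?thesis using 1 u'(3)[of b 0] u'(3)[of b 1] by (simp add: supp_def \<psi>_def)
        next
          case 2
          then show ?thesis using u'(3)[of s 0] sk by (simp add: supp_def \<psi>_def)
        qed
      qed
      then have "Suc s \<le> card (supp k \<chi>')"
        using card_mono[OF finite_supp, of "{..<Suc s}"] by simp
      moreover have "card (supp k \<chi>') \<le> s"
        using s(2) u' by (auto simp: P_def)
      ultimately show ?thesis by simp
    qed
  qed
  \<comment> \<open>The stabiliser of \<open>u\<close> under right translation. It contains a double
    transposition of the remaining points together with its conjugates by
    \<open>Alt ?n\<close>.\<close>
  define H where "H = {z \<in> Alt n. \<forall>y\<in>Alt n. u (y \<circ> z) = u y}"
  have "Alt ?n \<subseteq> H"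
  proof (rule Alt_subset_of_double_transposition[OF _ _ _ _ _ n'(2), of H "pt n s 0" "pt n s 1" "pt n s 2" "pt n s 3"])
    show "id \<in> H" by (simp add: H_def)
    show "a \<circ> b \<in> H" if "a \<in> H" "b \<in> H" for a b
    proof -
      have "u (y \<circ> (a \<circ> b)) = u y" if "y \<in> Alt n" for y
        using that \<open>a \<in> H\<close> \<open>b \<in> H\<close> Alt_comp[of y n a] by (simp add: H_def comp_assoc[symmetric])
      then show ?thesis using that by (simp add: H_def)
    qed
    show "inv' a \<in> H" if "a \<in> H" for a
    proof -
      have "u (y \<circ> inv' a) = u y" if "y \<in> Alt n" for y
      proof -
        have "u (y \<circ> inv' a \<circ> a) = u (y \<circ> inv' a)" using that \<open>a \<in> H\<close> by (simp add: H_def)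
        moreover have "a \<in> Alt n" using \<open>a \<in> H\<close> by (simp add: H_def)
        ultimately show ?thesis using Alt_inv_o(1)[of a n] by (simp add: comp_assoc)
      qed
      then show ?thesis using that by (simp add: H_def)
    qed
    show "distinct [pt n s 0, pt n s 1, pt n s 2, pt n s 3]"
      by (simp add: pt_eq_iff[OF k] sk)
    have "s + 2 \<le> k" using sj j by simp
    then have "4 * s + 8 \<le> n" using k by linarith
    then show "set [pt n s 0, pt n s 1, pt n s 2, pt n s 3] \<subseteq> {1..?n}"
      by (auto simp: pt_def)
    show "g \<circ> dtr (pt n s 0) (pt n s 1) (pt n s 2) (pt n s 3) \<circ> inv' g \<in> H" if "g \<in> Alt ?n" for g
    proof -
      have "g \<in> Alt n" using that Alt_mono by blast
      moreover have "inv' (inv' g) = g" using that by simp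
      ultimately show ?thesis
        using inv_conj[OF _ Alt_inv[OF that]] t by (simp add: H_def tt_def)
    qed
  qed
  \<comment> \<open>From \<open>s < j\<close> the points outside \<open>{1..?n}\<close> number
    \<open>4 * s \<le> 4 * (j - 1)\<close>, few enough for \<open>perp\<close>.\<close>
  then have "u x = 0" if "x \<in> Alt n" for x
    using U u(1) that sj n'(1)
    by (intro fixed_by_smaller_Alt_imp_zero[of n "4 * (j - 1)" u ?n])
      (auto simp: H_def invariant_subspace_def)
  then show False using u(2) by (simp add: eigen_def ip_def)
qed

text \<open>A support of \<open>s\<close> blocks is moved around if \<open>2 * s \<le> k\<close>,
  where \<open>k choose s\<close> is at least \<open>k choose j\<close> by monotonicity up to the
  middle; a larger one is rotated in place.\<close>

lemma invariant_subspace_dim: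
  assumes k: "4 * k \<le> n" and j: "1 \<le> j" "j < k" and U: "invariant_subspace n (4 * (j - 1)) U"
    and u0: "U u0" "0 < ip n u0 u0"
    and N: "N \<le> k choose j" "\<And>s. k < 2 * s \<Longrightarrow> N \<le> 2 ^ s"
  shows "\<exists>(I::nat set set) v. finite I \<and> N \<le> card I \<and> (\<forall>i\<in>I. U (v i) \<and> 0 < ip n (v i) (v i)) \<and>
        (\<forall>i\<in>I. \<forall>j\<in>I. i \<noteq> j \<longrightarrow> ip n (v i) (v j) = 0)"
proof -
  obtain u \<chi> where u: "U u" "eigen n k u \<chi>" "j \<le> card (supp k \<chi>)"
    using eigen_large_support[OF k j U u0] by blast
  define s where "s = card (supp k \<chi>)"
  show ?thesis
  proof (cases "2 * s \<le> k")
    case True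
    let ?F = "{T. T \<subseteq> {..<k} \<and> card T = card (supp k \<chi>)}"
    have "card ?F = k choose s" using n_subsets[of "{..<k}" s] by (simp add: s_def)
    moreover have "k choose j \<le> k choose s" using True u(3) by (intro binomial_mono) (auto simp: s_def)
    ultimately have "N \<le> card ?F" using N(1) by linarith
    moreover have "finite ?F" by (rule finite_subset[of _ "Pow {..<k}"]) auto
    moreover obtain v where "\<forall>T\<in>?F. U (v T) \<and> 0 < ip n (v T) (v T)"
      "\<forall>T\<in>?F. \<forall>T'\<in>?F. T \<noteq> T' \<longrightarrow> ip n (v T) (v T') = 0"
      using eigen_family_blocks[OF k U u(1,2)] by (elim exE conjE)
    ultimately show ?thesis by (intro exI[of _ ?F] exI[of _ v] conjI)
  next
    case False
    then have "N \<le> card (Pow (supp k \<chi>))" using N(2)[of s] by (simp add: card_Pow s_def)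
    moreover obtain v where "\<forall>T\<in>Pow (supp k \<chi>). U (v T) \<and> 0 < ip n (v T) (v T)"
      "\<forall>T\<in>Pow (supp k \<chi>). \<forall>T'\<in>Pow (supp k \<chi>). T \<noteq> T' \<longrightarrow> ip n (v T) (v T') = 0"
      using eigen_family_rotations[OF k U u(1,2)] by (elim exE conjE)
    moreover have "finite (Pow (supp k \<chi>))" by simp
    ultimately show ?thesis by (intro exI[of _ "Pow (supp k \<chi>)"] exI[of _ v] conjI)
  qed
qed

text \<open>With \<open>k = n div 4\<close> blocks the dimension is at least the minimum of
  \<open>k choose j\<close> and \<open>2 ^ (k div 2)\<close>, and for large \<open>n\<close> both
  are at least \<open>(n / (8 * j)) ^ j\<close>. The case \<open>j = 1\<close> concerns all
  functions of mean zero.\<close>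

lemma conv_perp_bound:
  assumes j: "1 \<le> j"
  shows "\<exists>n0. \<forall>n\<ge>n0. \<forall>f g. perp n (4 * (j - 1)) g \<longrightarrow>
    (real n / (8 * real j)) ^ j * ip n (conv n f g) (conv n f g) \<le> card (Alt n) * ip n f f * ip n g g"
proof -
  have "eventually (\<lambda>n::nat. real n ^ j \<le> 2 powr (real n / 8 - 1)) at_top"
    by real_asymp
  then obtain n1 where n1: "\<And>n. n \<ge> n1 \<Longrightarrow> real n ^ j \<le> 2 powr (real n / 8 - 1)"
    by (auto simp: eventually_at_top_linorder)
  show ?thesis
  proof (intro exI[of _ "max n1 (8 * j + 8)"] allI impI)
    fix n f g assume n: "max n1 (8 * j + 8) \<le> n" and g: "perp n (4 * (j - 1)) g"
    define k where "k = n div 4"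
    have k: "4 * k \<le> n" "j < k" "real n / 8 \<le> real k" "real n / 8 - 1 \<le> real k / 2"
      using n unfolding k_def by linarith+
    define N where "N = min (k choose j) (2 ^ (k div 2))"
    have "(real n / (8 * real j)) ^ j \<le> real (k choose j)"
    proof -
      have "(real n / (8 * real j)) ^ j \<le> (real k / real j) ^ j"
        using k(3) j by (intro power_mono) (auto simp: field_simps)
      also have "\<dots> \<le> real (k choose j)"
        using binomial_ge_n_over_k_pow_k[of j k, where 'a = real] k(2) by simp
      finally show ?thesis .
    qed
    moreover have "(real n / (8 * real j)) ^ j \<le> 2 ^ (k div 2)"
    proof -
      have "real n / (8 * real j) \<le> real n"
        using frac_le[of "real n" "real n" 1 "8 * real j"] j by simp
      then have "(real n / (8 * real j)) ^ j \<le> real n ^ j"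
        by (intro power_mono) auto
      also have "\<dots> \<le> 2 powr (real n / 8 - 1)" using n1 n by simp
      also have "\<dots> \<le> 2 powr (real (k div 2))"
        using k n unfolding k_def by (intro powr_mono) (linarith, simp)
      also have "\<dots> = 2 ^ (k div 2)" by (simp add: powr_realpow)
      finally show ?thesis .
    qed
    ultimately have N: "(real n / (8 * real j)) ^ j \<le> real N"
      unfolding N_def of_nat_min by simp
    have "real N * ip n (conv n f g) (conv n f g) \<le> card (Alt n) * ip n f f * ip n g g"
    proof (rule conv_norm_bound[OF _ g, where 'i = "nat set"])
      fix U u assume U: "invariant_subspace n (4 * (j - 1)) U" "U u" "0 < ip n u u"
      have "N \<le> 2 ^ s" if "k < 2 * s" for s
      proof -
        have "(2::nat) ^ (k div 2) \<le> 2 ^ s" using that by (intro power_increasing) auto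
        then show ?thesis unfolding N_def by (rule min.coboundedI2)
      qed
      then show "\<exists>(I::nat set set) v. finite I \<and> real N \<le> real (card I) \<and> (\<forall>i\<in>I. U (v i) \<and> 0 < ip n (v i) (v i)) \<and>
        (\<forall>i\<in>I. \<forall>j\<in>I. i \<noteq> j \<longrightarrow> ip n (v i) (v j) = 0)"
        unfolding of_nat_le_iff
        using U k j by (intro invariant_subspace_dim[where k = k and j = j]) (auto simp: N_def)
    qed
    then show "(real n / (8 * real j)) ^ j * ip n (conv n f g) (conv n f g)
        \<le> card (Alt n) * ip n f f * ip n g g"
      using mult_right_mono[OF N ip_nonneg[of n "conv n f g"]] by linarith
  qed
qed

section \<open>Counting equivariant maps\<close>

text \<open>
  The number of equivariant maps from \<open>(V, \<tau>)\<close> to \<open>({1..n}, \<sigma>)\<close> is a product of numbers of fixed points of powers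
  of \<open>\<sigma>\<close>, one for each cycle of \<open>\<tau>\<close>.
\<close>

definition eqv :: "nat \<Rightarrow> nat set \<Rightarrow> (nat \<Rightarrow> nat) \<Rightarrow> (nat \<Rightarrow> nat) \<Rightarrow> (nat \<Rightarrow> nat) set"
  where "eqv n V \<tau> \<sigma> = {\<phi> \<in> V \<rightarrow>\<^sub>E {1..n}. \<forall>i\<in>V. \<sigma> (\<phi> i) = \<phi> (\<tau> i)}"

definition perm_patterns :: "nat \<Rightarrow> (nat set \<times> (nat \<Rightarrow> nat)) set"
  where "perm_patterns M = {(V, \<tau>). V \<subseteq> {..<M} \<and> \<tau> permutes V}"

text \<open>The coefficients \<open>c\<close> do not involve \<open>n\<close>, so the same
  combination can be evaluated in alternating groups of different degrees.\<close>

definition pattern_comb :: "nat \<Rightarrow> nat \<Rightarrow> (nat set \<times> (nat \<Rightarrow> nat) \<Rightarrow> real) \<Rightarrow> (nat \<Rightarrow> nat) \<Rightarrow> real"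
  where "pattern_comb n M c \<sigma> = (\<Sum>p\<in>perm_patterns M. c p * real (card (eqv n (fst p) (snd p) \<sigma>)))"

definition pattern_span :: "nat \<Rightarrow> nat \<Rightarrow> ((nat \<Rightarrow> nat) \<Rightarrow> real) \<Rightarrow> bool"
  where "pattern_span n M f \<longleftrightarrow> (\<exists>c. \<forall>\<sigma>. \<sigma> permutes {1..n} \<longrightarrow> f \<sigma> = pattern_comb n M c \<sigma>)"

lemma finite_perm_patterns [simp]: "finite (perm_patterns M)"
proof -
  have "perm_patterns M \<subseteq> Pow {..<M} \<times> {\<tau>. \<tau> permutes {..<M}}"
    by (auto simp: perm_patterns_def intro: permutes_subset)
  then show ?thesis by (rule finite_subset) (simp add: finite_permutations)
qed

lemma pattern_span_cong: "pattern_span n M f \<Longrightarrow> (\<And>\<sigma>. \<sigma> permutes {1..n} \<Longrightarrow> g \<sigma> = f \<sigma>) \<Longrightarrow> pattern_span n M g"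
  by (simp add: pattern_span_def)

lemma pattern_span_0: "pattern_span n M (\<lambda>\<sigma>. 0)"
  unfolding pattern_span_def by (rule exI[of _ "\<lambda>_. 0"]) (simp add: pattern_comb_def)

lemma pattern_span_add:
  assumes "pattern_span n M f" "pattern_span n M g" shows "pattern_span n M (\<lambda>\<sigma>. f \<sigma> + g \<sigma>)"
proof -
  obtain c d where "\<forall>\<sigma>. \<sigma> permutes {1..n} \<longrightarrow> f \<sigma> = pattern_comb n M c \<sigma>"
    "\<forall>\<sigma>. \<sigma> permutes {1..n} \<longrightarrow> g \<sigma> = pattern_comb n M d \<sigma>" using assms by (auto simp: pattern_span_def)
  then show ?thesis unfolding pattern_span_def
    by (intro exI[of _ "\<lambda>p. c p + d p"]) (simp add: pattern_comb_def distrib_right sum.distrib)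
qed

lemma pattern_span_scale:
  assumes "pattern_span n M f" shows "pattern_span n M (\<lambda>\<sigma>. a * f \<sigma>)"
proof -
  obtain c where "\<forall>\<sigma>. \<sigma> permutes {1..n} \<longrightarrow> f \<sigma> = pattern_comb n M c \<sigma>"
    using assms by (auto simp: pattern_span_def)
  then show ?thesis unfolding pattern_span_def
    by (intro exI[of _ "\<lambda>p. a * c p"]) (simp add: pattern_comb_def sum_distrib_left mult.assoc)
qed

lemma pattern_span_sum: "(\<And>i. i \<in> I \<Longrightarrow> pattern_span n M (f i)) \<Longrightarrow> pattern_span n M (\<lambda>\<sigma>. \<Sum>i\<in>I. f i \<sigma>)"
  by (induction I rule: infinite_finite_induct) (simp_all add: pattern_span_0 pattern_span_add)

lemma pattern_span_eqv:
  assumes "(V, \<tau>) \<in> perm_patterns M" shows "pattern_span n M (\<lambda>\<sigma>. real (card (eqv n V \<tau> \<sigma>)))"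
  unfolding pattern_span_def
proof (intro exI allI impI)
  fix \<sigma>
  have "pattern_comb n M (\<lambda>p. of_bool (p = (V, \<tau>))) \<sigma>
      = (\<Sum>p\<in>perm_patterns M. if p = (V, \<tau>) then real (card (eqv n V \<tau> \<sigma>)) else 0)"
    unfolding pattern_comb_def by (intro sum.cong) auto
  then show "real (card (eqv n V \<tau> \<sigma>)) = pattern_comb n M (\<lambda>p. of_bool (p = (V, \<tau>))) \<sigma>"
    using assms by simp
qed

text \<open>A wider class of patterns, with partial information \<open>E\<close> on the action and
  inequalities \<open>R\<close>, as it arises from conjugation averages. It will be reduced to
  \<open>eqv\<close>.\<close>

definition homs :: "nat \<Rightarrow> nat set \<Rightarrow> (nat \<times> nat) set \<Rightarrow> (nat \<times> nat) set \<Rightarrow> (nat \<Rightarrow> nat) \<Rightarrow> (nat \<Rightarrow> nat) set"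
  where "homs n V E R \<sigma> = {\<phi> \<in> V \<rightarrow>\<^sub>E {1..n}.
    (\<forall>(i, j)\<in>E. \<sigma> (\<phi> i) = \<phi> j) \<and> (\<forall>(i, j)\<in>R. \<phi> i \<noteq> \<phi> j)}"

lemma finite_homs: "finite V \<Longrightarrow> finite (homs n V E R \<sigma>)"
  unfolding homs_def by (rule finite_subset[OF _ finite_PiE[of V "\<lambda>_. {1..n}"]]) auto

lemma card_homs_identify:
  fixes a b :: nat
  assumes ab: "a \<in> V" "b \<in> V" "a \<noteq> b" and ER: "E \<subseteq> V \<times> V" "R \<subseteq> V \<times> V"
  defines "s \<equiv> \<lambda>i. if i = b then a else i"
  shows "card {\<phi> \<in> homs n V E R \<sigma>. \<phi> a = \<phi> b}
    = card (homs n (V - {b}) (map_prod s s ` E) (map_prod s s ` R) \<sigma>)"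
proof (rule bij_betw_same_card)
  let ?r = "\<lambda>\<phi>. restrict \<phi> (V - {b})" and ?e = "\<lambda>\<psi>. \<psi>(b := \<psi> a)"
  have s: "s i \<in> V - {b}" if "i \<in> V" for i using that ab by (auto simp: s_def)
  show "bij_betw ?r {\<phi> \<in> homs n V E R \<sigma>. \<phi> a = \<phi> b}
      (homs n (V - {b}) (map_prod s s ` E) (map_prod s s ` R) \<sigma>)"
  proof (rule bij_betwI[where g = ?e])
    show "?r \<in> {\<phi> \<in> homs n V E R \<sigma>. \<phi> a = \<phi> b} \<rightarrow>
      homs n (V - {b}) (map_prod s s ` E) (map_prod s s ` R) \<sigma>"
    proof
      fix \<phi> assume "\<phi> \<in> {\<phi> \<in> homs n V E R \<sigma>. \<phi> a = \<phi> b}"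
      then have \<phi>: "\<phi> \<in> V \<rightarrow>\<^sub>E {1..n}" "\<forall>(i, j)\<in>E. \<sigma> (\<phi> i) = \<phi> j" "\<forall>(i, j)\<in>R. \<phi> i \<noteq> \<phi> j" "\<phi> a = \<phi> b"
        by (auto simp: homs_def)
      define r where "r = ?r \<phi>"
      have r: "r (s i) = \<phi> i" if "i \<in> V" for i
        using s[OF that] \<phi>(4) by (auto simp: s_def r_def)
      have "\<sigma> (r (s i)) = r (s j)" if "(i, j) \<in> E" for i j
      proof -
        have "i \<in> V" "j \<in> V" using that ER(1) by auto
        then show ?thesis using \<phi>(2) that by (auto simp: r)
      qed
      moreover have "r (s i) \<noteq> r (s j)" if "(i, j) \<in> R" for i j
      proof -
        have "i \<in> V" "j \<in> V" using that ER(2) by auto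
        then show ?thesis using \<phi>(3) that by (auto simp: r)
      qed
      moreover have "r \<in> (V - {b}) \<rightarrow>\<^sub>E {1..n}" using \<phi>(1) by (auto simp: PiE_iff r_def)
      ultimately have "r \<in> homs n (V - {b}) (map_prod s s ` E) (map_prod s s ` R) \<sigma>"
        unfolding homs_def by auto
      then show "?r \<phi> \<in> homs n (V - {b}) (map_prod s s ` E) (map_prod s s ` R) \<sigma>"
        by (simp only: r_def)
    qed
    show "?e \<in> homs n (V - {b}) (map_prod s s ` E) (map_prod s s ` R) \<sigma>
      \<rightarrow> {\<phi> \<in> homs n V E R \<sigma>. \<phi> a = \<phi> b}"
    proof
      fix \<psi> assume "\<psi> \<in> homs n (V - {b}) (map_prod s s ` E) (map_prod s s ` R) \<sigma>"
      then have \<psi>: "\<psi> \<in> (V - {b}) \<rightarrow>\<^sub>E {1..n}" "\<forall>(i, j)\<in>E. \<sigma> (\<psi> (s i)) = \<psi> (s j)" "\<forall>(i, j)\<in>R. \<psi> (s i) \<noteq> \<psi> (s j)"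
        by (auto simp: homs_def)
      have e: "?e \<psi> i = \<psi> (s i)" for i by (simp add: s_def)
      have "?e \<psi> \<in> V \<rightarrow>\<^sub>E {1..n}" using \<psi>(1) ab by (auto simp: PiE_iff extensional_def)
      then show "?e \<psi> \<in> {\<phi> \<in> homs n V E R \<sigma>. \<phi> a = \<phi> b}"
        using \<psi>(2,3) ab unfolding homs_def mem_Collect_eq e by (auto simp: s_def)
    qed
    show "?e (?r \<phi>) = \<phi>" if "\<phi> \<in> {\<phi> \<in> homs n V E R \<sigma>. \<phi> a = \<phi> b}" for \<phi>
      using that ab by (auto simp: homs_def fun_eq_iff PiE_iff extensional_def)
    show "?r (?e \<psi>) = \<psi>" if "\<psi> \<in> homs n (V - {b}) (map_prod s s ` E) (map_prod s s ` R) \<sigma>" for \<psi>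
      using that ab by (auto simp: homs_def fun_eq_iff PiE_iff extensional_def)
  qed
qed

text \<open>The value at the end \<open>j\<close> of a path is forced by the value at
  \<open>i\<close>, so the end can be cut off.\<close>

lemma card_homs_leaf:
  assumes \<sigma>: "\<sigma> permutes {1..n}" and E: "E \<subseteq> V \<times> V" "(i, j) \<in> E" "i \<noteq> j"
    and out: "\<And>l. (j, l) \<notin> E" and ins: "\<And>l. (l, j) \<in> E \<Longrightarrow> l = i"
  shows "card (homs n V E {} \<sigma>) = card (homs n (V - {j}) (E - {(i, j)}) {} \<sigma>)"
proof (rule bij_betw_same_card)
  let ?r = "\<lambda>\<phi>. restrict \<phi> (V - {j})" and ?e = "\<lambda>\<psi>. \<psi>(j := \<sigma> (\<psi> i))"
  have ij: "i \<in> V" "j \<in> V" using E by auto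
  have E': "a \<in> V - {j} \<and> b \<in> V - {j}" if "(a, b) \<in> E - {(i, j)}" for a b
    using that E(1) out ins by blast
  show "bij_betw ?r (homs n V E {} \<sigma>) (homs n (V - {j}) (E - {(i, j)}) {} \<sigma>)"
  proof (rule bij_betwI[where g = ?e])
    show "?r \<in> homs n V E {} \<sigma> \<rightarrow> homs n (V - {j}) (E - {(i, j)}) {} \<sigma>"
    proof
      fix \<phi> assume "\<phi> \<in> homs n V E {} \<sigma>"
      then have \<phi>: "\<phi> \<in> V \<rightarrow>\<^sub>E {1..n}" "\<And>a b. (a, b) \<in> E \<Longrightarrow> \<sigma> (\<phi> a) = \<phi> b" by (auto simp: homs_def)
      have "\<sigma> (?r \<phi> a) = ?r \<phi> b" if "(a, b) \<in> E - {(i, j)}" for a b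
        using E'[OF that] \<phi>(2)[of a b] that by simp
      moreover have "?r \<phi> \<in> (V - {j}) \<rightarrow>\<^sub>E {1..n}" using \<phi>(1) by (auto simp: PiE_iff)
      ultimately show "?r \<phi> \<in> homs n (V - {j}) (E - {(i, j)}) {} \<sigma>"
        unfolding homs_def by blast
    qed
    show "?e \<in> homs n (V - {j}) (E - {(i, j)}) {} \<sigma> \<rightarrow> homs n V E {} \<sigma>"
    proof
      fix \<psi> assume "\<psi> \<in> homs n (V - {j}) (E - {(i, j)}) {} \<sigma>"
      then have \<psi>: "\<psi> \<in> (V - {j}) \<rightarrow>\<^sub>E {1..n}" "\<And>a b. (a, b) \<in> E - {(i, j)} \<Longrightarrow> \<sigma> (\<psi> a) = \<psi> b"
        by (auto simp: homs_def)
      have "\<sigma> (?e \<psi> a) = ?e \<psi> b" if "(a, b) \<in> E" for a b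
      proof (cases "(a, b) = (i, j)")
        case False
        then show ?thesis using E'[of a b] \<psi>(2)[of a b] that by simp
      qed (use E(3) in simp)
      moreover have "\<psi> i \<in> {1..n}" using \<psi>(1) ij E(3) by (auto simp: PiE_iff)
      then have "\<sigma> (\<psi> i) \<in> {1..n}" using permutes_in_image[OF \<sigma>] by blast
      then have "?e \<psi> \<in> V \<rightarrow>\<^sub>E {1..n}" using \<psi>(1) ij by (auto simp: PiE_iff extensional_def)
      ultimately show "?e \<psi> \<in> homs n V E {} \<sigma>" unfolding homs_def by blast
    qed
    show "?e (?r \<phi>) = \<phi>" if "\<phi> \<in> homs n V E {} \<sigma>" for \<phi>
    proof
      fix x
      have "\<sigma> (\<phi> i) = \<phi> j" using that E(2) by (auto simp: homs_def)
      then show "?e (?r \<phi>) x = \<phi> x"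
        using that ij E(3) by (auto simp: homs_def PiE_iff extensional_def)
    qed
    show "?r (?e \<psi>) = \<psi>" if "\<psi> \<in> homs n (V - {j}) (E - {(i, j)}) {} \<sigma>" for \<psi>
      using that ij by (auto simp: homs_def fun_eq_iff PiE_iff extensional_def)
  qed
qed

lemma card_homs_isolated:
  assumes E: "E \<subseteq> (V - {j}) \<times> (V - {j})" and j: "j \<in> V"
  shows "card (homs n V E {} \<sigma>) = n * card (homs n (V - {j}) E {} \<sigma>)"
proof -
  let ?r = "\<lambda>\<phi>. (\<phi> j, restrict \<phi> (V - {j}))" and ?e = "\<lambda>(y, \<psi>). \<psi>(j := y)"
  have "bij_betw ?r (homs n V E {} \<sigma>) ({1..n} \<times> homs n (V - {j}) E {} \<sigma>)"
  proof (rule bij_betwI[where g = ?e])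
    show "?r \<in> homs n V E {} \<sigma> \<rightarrow> {1..n} \<times> homs n (V - {j}) E {} \<sigma>"
    proof
      fix \<phi> assume "\<phi> \<in> homs n V E {} \<sigma>"
      then have \<phi>: "\<phi> \<in> V \<rightarrow>\<^sub>E {1..n}" "\<And>a b. (a, b) \<in> E \<Longrightarrow> \<sigma> (\<phi> a) = \<phi> b" by (auto simp: homs_def)
      have "\<sigma> (restrict \<phi> (V - {j}) a) = restrict \<phi> (V - {j}) b" if "(a, b) \<in> E" for a b
        using E \<phi>(2)[OF that] that by auto
      moreover have "restrict \<phi> (V - {j}) \<in> (V - {j}) \<rightarrow>\<^sub>E {1..n}" using \<phi>(1) by (auto simp: PiE_iff)
      moreover have "\<phi> j \<in> {1..n}" using \<phi>(1) j by blast
      ultimately show "?r \<phi> \<in> {1..n} \<times> homs n (V - {j}) E {} \<sigma>"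
        unfolding homs_def by blast
    qed
    show "?e \<in> {1..n} \<times> homs n (V - {j}) E {} \<sigma> \<rightarrow> homs n V E {} \<sigma>"
    proof
      fix y\<psi> assume "y\<psi> \<in> {1..n} \<times> homs n (V - {j}) E {} \<sigma>"
      then obtain y \<psi> where "y\<psi> = (y, \<psi>)" "y \<in> {1..n}" "\<psi> \<in> homs n (V - {j}) E {} \<sigma>"
        by blast
      then have \<psi>: "y\<psi> = (y, \<psi>)" "y \<in> {1..n}" "\<psi> \<in> (V - {j}) \<rightarrow>\<^sub>E {1..n}"
        "\<And>a b. (a, b) \<in> E \<Longrightarrow> \<sigma> (\<psi> a) = \<psi> b"
        by (auto simp: homs_def)
      have "\<sigma> ((\<psi>(j := y)) a) = (\<psi>(j := y)) b" if "(a, b) \<in> E" for a b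
        using E \<psi>(4)[OF that] that by auto
      moreover have "\<psi>(j := y) \<in> V \<rightarrow>\<^sub>E {1..n}" using \<psi>(2,3) j by (auto simp: PiE_iff extensional_def)
      ultimately show "?e y\<psi> \<in> homs n V E {} \<sigma>" unfolding homs_def \<psi>(1) by auto
    qed
  qed (use j in \<open>auto simp: homs_def fun_eq_iff PiE_iff extensional_def\<close>)
  then show ?thesis using bij_betw_same_card by (fastforce simp: card_cartesian_product)
qed

text \<open>Induction on the number of points. An inequality is removed by subtracting the maps that
  violate it, which live on fewer points. Two edges leaving or entering the same point force an
  identification, since \<open>\<sigma>\<close> is injective. Otherwise \<open>E\<close> consists of
  paths and cycles: paths are shortened from the end, an isolated point gives a factor
  \<open>n\<close>, and if only cycles are left, \<open>E\<close> is the graph of a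
  permutation.\<close>

lemma pattern_span_homs:
  assumes "finite V" "V \<subseteq> {..<M}" "E \<subseteq> V \<times> V" "R \<subseteq> V \<times> V"
  shows "pattern_span n M (\<lambda>\<sigma>. real (card (homs n V E R \<sigma>)))"
  using assms
proof (induction "card V" arbitrary: V E R rule: less_induct)
  case less
  note IH = less(1)
  have IH1: "pattern_span n M (\<lambda>\<sigma>. real (card (homs n (V - {b}) E' R' \<sigma>)))"
    if "b \<in> V" "E' \<subseteq> (V - {b}) \<times> (V - {b})" "R' \<subseteq> (V - {b}) \<times> (V - {b})" for b E' R'
    using that less(2,3) card_Diff1_less[OF less(2) that(1)] by (intro IH) auto
  have identify: "pattern_span n M (\<lambda>\<sigma>. real (card {\<phi> \<in> homs n V E R \<sigma>. \<phi> a = \<phi> b}))"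
    if "a \<in> V" "b \<in> V" "a \<noteq> b" "R \<subseteq> V \<times> V" for a b R
  proof -
    have sub: "map_prod s s ` F \<subseteq> (V - {b}) \<times> (V - {b})"
      if "F \<subseteq> V \<times> V" "s = (\<lambda>i. if i = b then a else i)" for F s
      using that \<open>a \<in> V\<close> \<open>a \<noteq> b\<close> by (auto split: if_splits)
    show ?thesis unfolding card_homs_identify[OF that(1-3) less(4) that(4)]
      by (intro IH1 sub refl that less(4))
  qed
  have "finite R" using less(2,5) finite_subset by blast
  then show ?case using less(5)
  proof (induction R)
    case (insert ab R)
    obtain a b where ab: "ab = (a, b)" by (cases ab)
    have fin: "finite (homs n V E R \<sigma>)" for \<sigma> using finite_homs less(2) by blast
    show ?case
    proof (cases "a = b")
      case True
      then have "homs n V E (insert ab R) \<sigma> = {}" for \<sigma> by (auto simp: homs_def ab)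
      then show ?thesis by (simp add: pattern_span_0)
    next
      case False
      have "homs n V E (insert ab R) \<sigma> = homs n V E R \<sigma> - {\<phi> \<in> homs n V E R \<sigma>. \<phi> a = \<phi> b}" for \<sigma>
        by (auto simp: homs_def ab)
      then have "real (card (homs n V E (insert ab R) \<sigma>)) = real (card (homs n V E R \<sigma>))
          + (-1) * real (card {\<phi> \<in> homs n V E R \<sigma>. \<phi> a = \<phi> b})" for \<sigma>
        using fin[of \<sigma>] by (simp add: card_Diff_subset card_mono of_nat_diff)
      moreover have "pattern_span n M (\<lambda>\<sigma>. real (card (homs n V E R \<sigma>))
          + (-1) * real (card {\<phi> \<in> homs n V E R \<sigma>. \<phi> a = \<phi> b}))"
        using insert False ab by (intro pattern_span_add pattern_span_scale identify) auto
      ultimately show ?thesis by simp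
    qed
  next
    case empty
    consider (out2) i j j' where "(i, j) \<in> E" "(i, j') \<in> E" "j \<noteq> j'"
      | (in2) i i' j where "(i, j) \<in> E" "(i', j) \<in> E" "i \<noteq> i'"
      | (inj) "\<And>i j j'. (i, j) \<in> E \<Longrightarrow> (i, j') \<in> E \<Longrightarrow> j = j'"
        "\<And>i i' j. (i, j) \<in> E \<Longrightarrow> (i', j) \<in> E \<Longrightarrow> i = i'" by blast
    then show ?case
    proof cases
      case out2
      have "\<phi> j = \<phi> j'" if "\<phi> \<in> homs n V E {} \<sigma>" for \<phi> \<sigma>
      proof -
        have "\<sigma> (\<phi> i) = \<phi> j" "\<sigma> (\<phi> i) = \<phi> j'" using that out2 by (auto simp: homs_def)
        then show ?thesis by simp
      qed
      then have "homs n V E {} \<sigma> = {\<phi> \<in> homs n V E {} \<sigma>. \<phi> j = \<phi> j'}" for \<sigma> by blast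
      then show ?thesis using identify[of j j' "{}"] out2 less(4) by auto
    next
      case in2
      have eq: "real (card (homs n V E {} \<sigma>)) = real (card {\<phi> \<in> homs n V E {} \<sigma>. \<phi> i = \<phi> i'})"
        if "\<sigma> permutes {1..n}" for \<sigma>
      proof -
        have "\<phi> i = \<phi> i'" if "\<phi> \<in> homs n V E {} \<sigma>" for \<phi>
        proof -
          have "\<sigma> (\<phi> i) = \<phi> j" "\<sigma> (\<phi> i') = \<phi> j" using that in2 by (auto simp: homs_def)
          then show ?thesis using injD[OF permutes_inj[OF \<open>\<sigma> permutes {1..n}\<close>], of "\<phi> i" "\<phi> i'"] by simp
        qed
        then have "homs n V E {} \<sigma> = {\<phi> \<in> homs n V E {} \<sigma>. \<phi> i = \<phi> i'}" by blast
        then show ?thesis by simp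
      qed
      show ?thesis by (rule pattern_span_cong[OF identify[of i i' "{}"] eq]) (use in2 less(4) in auto)
    next
      case inj
      show ?thesis
      proof (cases "\<exists>j\<in>V. \<forall>l. (j, l) \<notin> E")
        case True
        then obtain j where j: "j \<in> V" "\<And>l. (j, l) \<notin> E" by blast
        show ?thesis
        proof (cases "\<exists>i. (i, j) \<in> E")
          case True
          then obtain i where i: "(i, j) \<in> E" by blast
          have ne: "i \<noteq> j" using i j by blast
          have "pattern_span n M (\<lambda>\<sigma>. real (card (homs n (V - {j}) (E - {(i, j)}) {} \<sigma>)))"
          proof (rule IH1[OF j(1)])
            show "E - {(i, j)} \<subseteq> (V - {j}) \<times> (V - {j})" using less(4) j(2) inj(2)[OF _ i] by auto
          qed simp
          then show ?thesis
            by (rule pattern_span_cong) (use card_homs_leaf[OF _ less(4) i ne j(2)] inj(2)[OF _ i] in simp)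
        next
          case False
          have sub: "E \<subseteq> (V - {j}) \<times> (V - {j})" using False j(2) less(4) by auto
          show ?thesis unfolding card_homs_isolated[OF sub j(1)] of_nat_mult
            by (intro pattern_span_scale IH1 j(1) sub) simp
        qed
      next
        case False
        define \<tau> where "\<tau> i = (if i \<in> V then SOME j. (i, j) \<in> E else i)" for i
        have \<tau>E: "(i, \<tau> i) \<in> E" if "i \<in> V" for i
          using False that someI_ex[of "\<lambda>j. (i, j) \<in> E"] by (auto simp: \<tau>_def)
        have E_iff: "(i, j) \<in> E \<longleftrightarrow> i \<in> V \<and> j = \<tau> i" for i j
          using \<tau>E inj(1) less(4) by blast
        have "inj_on \<tau> V" using \<tau>E inj(2) by (metis inj_onI)
        moreover have "\<tau> ` V \<subseteq> V" using \<tau>E less(4) by blast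
        ultimately have "bij_betw \<tau> V V"
          using less(2) by (simp add: bij_betw_def endo_inj_surj)
        then have "\<tau> permutes V" by (rule bij_imp_permutes) (simp add: \<tau>_def)
        then have "(V, \<tau>) \<in> perm_patterns M" using less(3) by (simp add: perm_patterns_def)
        moreover have "homs n V E {} \<sigma> = eqv n V \<tau> \<sigma>" for \<sigma>
          by (auto simp: homs_def eqv_def E_iff)
        ultimately show ?thesis using pattern_span_eqv by simp
      qed
    qed
  qed
qed

section \<open>Means of pattern counts\<close>

lemma Alt_nonempty [simp]: "Alt n \<noteq> {}"
  using Alt_id by blast

text \<open>Given two spare points in \<open>{1..n}\<close>, this is the orbit of
  \<open>\<phi>\<close> under \<open>Alt n\<close>.\<close>

definition same_kernel :: "nat \<Rightarrow> 'a set \<Rightarrow> ('a \<Rightarrow> nat) \<Rightarrow> ('a \<Rightarrow> nat) set"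
  where "same_kernel n V \<phi> = {\<psi> \<in> V \<rightarrow>\<^sub>E {1..n}. \<forall>i\<in>V. \<forall>j\<in>V. \<psi> i = \<psi> j \<longleftrightarrow> \<phi> i = \<phi> j}"

text \<open>Orbit counting: \<open>Alt n\<close> is transitive on
  \<open>same_kernel n V \<phi>\<close> by \<open>Alt_extend\<close>, and left translation compares
  the fibres over any two of its elements.\<close>

lemma card_Alt_fibre:
  assumes V: "finite V" "card V + 2 \<le> n" and \<phi>: "\<phi> \<in> V \<rightarrow>\<^sub>E {1..n}" and \<psi>: "\<psi> \<in> same_kernel n V \<phi>"
  shows "card {g \<in> Alt n. \<forall>i\<in>V. g (\<phi> i) = \<psi> i} * card (same_kernel n V \<phi>) = card (Alt n)"
proof -
  let ?\<Omega> = "same_kernel n V \<phi>"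
  let ?fib = "\<lambda>\<psi>. {g \<in> Alt n. \<forall>i\<in>V. g (\<phi> i) = \<psi> i}"
  have trans: "\<exists>g\<in>Alt n. \<forall>i\<in>V. g (\<phi>1 i) = \<phi>2 i" if "\<phi>1 \<in> ?\<Omega>" "\<phi>2 \<in> ?\<Omega>" for \<phi>1 \<phi>2
  proof -
    define f where "f = (\<lambda>y. \<phi>2 (SOME i. i \<in> V \<and> \<phi>1 i = y))"
    have ker: "\<phi>1 i = \<phi>1 j \<longleftrightarrow> \<phi>2 i = \<phi>2 j" if "i \<in> V" "j \<in> V" for i j
      using that \<open>\<phi>1 \<in> ?\<Omega>\<close> \<open>\<phi>2 \<in> ?\<Omega>\<close> by (simp add: same_kernel_def)
    have f: "f (\<phi>1 i) = \<phi>2 i" if "i \<in> V" for i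
    proof -
      have "\<exists>k. k \<in> V \<and> \<phi>1 k = \<phi>1 i" using that by blast
      from someI_ex[OF this] show ?thesis using ker that unfolding f_def by blast
    qed
    have "inj_on f (\<phi>1 ` V)"
    proof (rule inj_onI)
      fix y z assume "y \<in> \<phi>1 ` V" "z \<in> \<phi>1 ` V" "f y = f z"
      then obtain i j where ij: "i \<in> V" "j \<in> V" "y = \<phi>1 i" "z = \<phi>1 j" by blast
      then show "y = z" using \<open>f y = f z\<close> f[of i] f[of j] ker[of i j] by simp
    qed
    moreover have "f ` \<phi>1 ` V = \<phi>2 ` V" using f by (simp add: image_image cong: image_cong)
    ultimately have bij: "bij_betw f (\<phi>1 ` V) (\<phi>2 ` V)" by (simp add: bij_betw_def)
    have sub: "\<phi>1 ` V \<subseteq> {1..n}" "\<phi>2 ` V \<subseteq> {1..n}"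
      using that by (auto simp: same_kernel_def PiE_iff)
    have "card (\<phi>1 ` V) + 2 \<le> n" using card_image_le[OF V(1), of \<phi>1] V(2) by linarith
    then obtain g where "g \<in> Alt n" "\<And>x. x \<in> \<phi>1 ` V \<Longrightarrow> g x = f x"
      using Alt_extend[OF bij sub] by blast
    then show ?thesis using f by (intro bexI[of _ g]) auto
  qed
  have fin: "finite ?\<Omega>"
    unfolding same_kernel_def using V(1) by (intro finite_subset[OF _ finite_PiE[of V "\<lambda>_. {1..n}"]]) auto
  have le: "card (?fib \<psi>1) \<le> card (?fib \<psi>2)" if \<psi>12: "\<psi>1 \<in> ?\<Omega>" "\<psi>2 \<in> ?\<Omega>" for \<psi>1 \<psi>2
  proof -
    obtain h where h: "h \<in> Alt n" "\<forall>i\<in>V. h (\<psi>1 i) = \<psi>2 i" using trans[OF \<psi>12] by blast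
    have "inj_on (\<lambda>g. h \<circ> g) (?fib \<psi>1)"
      using bij_betw_Alt_left[OF h(1)] by (auto simp: bij_betw_def intro: inj_on_subset)
    moreover have "(\<lambda>g. h \<circ> g) ` ?fib \<psi>1 \<subseteq> ?fib \<psi>2" using h by auto
    ultimately show ?thesis by (intro card_inj_on_le) auto
  qed
  have eq: "card (?fib \<psi>1) = card (?fib \<psi>)" if "\<psi>1 \<in> ?\<Omega>" for \<psi>1
    using le[OF that \<psi>] le[OF \<psi> that] by simp
  have "Alt n = (\<Union>\<psi>1\<in>?\<Omega>. ?fib \<psi>1)"
  proof -
    have "restrict (\<lambda>i. g (\<phi> i)) V \<in> ?\<Omega>" if "g \<in> Alt n" for g
    proof -
      have "g (\<phi> i) \<in> {1..n}" if "i \<in> V" for i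
        using \<phi> that Alt_image_eq[OF \<open>g \<in> Alt n\<close>] by blast
      then show ?thesis
        using bij_is_inj[OF Alt_bij[OF that]] by (auto simp: same_kernel_def inj_eq)
    qed
    then show ?thesis by fastforce
  qed
  then have "card (Alt n) = card (\<Union>\<psi>1\<in>?\<Omega>. ?fib \<psi>1)" by simp
  also have "\<dots> = (\<Sum>\<psi>1\<in>?\<Omega>. card (?fib \<psi>1))"
  proof (rule card_UN_disjoint[OF fin])
    show "\<forall>i\<in>?\<Omega>. \<forall>j\<in>?\<Omega>. i \<noteq> j \<longrightarrow> ?fib i \<inter> ?fib j = {}"
    proof (intro ballI impI)
      fix a b assume ab: "a \<in> ?\<Omega>" "b \<in> ?\<Omega>" "a \<noteq> b"
      have "a = b" if "g \<in> ?fib a" "g \<in> ?fib b" for g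
      proof (rule extensionalityI[of a V b])
        show "a i = b i" if "i \<in> V" for i
          using that \<open>g \<in> ?fib a\<close> \<open>g \<in> ?fib b\<close> by auto
      qed (use ab in \<open>auto simp: same_kernel_def PiE_iff\<close>)
      then show "?fib a \<inter> ?fib b = {}" using ab by blast
    qed
  qed simp
  also have "\<dots> = (\<Sum>\<psi>1\<in>?\<Omega>. card (?fib \<psi>))" using eq by (rule sum.cong[OF refl])
  finally show ?thesis by (simp add: mult.commute)
qed

definition kern :: "nat set \<Rightarrow> (nat \<Rightarrow> nat) \<Rightarrow> (nat \<times> nat) set"
  where "kern V \<phi> = {(i, j) \<in> V \<times> V. \<phi> i = \<phi> j}"

text \<open>For a permutation \<open>\<tau>\<close> of \<open>V\<close> these are the
  \<open>\<tau>\<close>-invariant equivalence relations on \<open>V\<close> with at most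
  \<open>n\<close> classes.\<close>

definition inv_kern :: "nat \<Rightarrow> nat set \<Rightarrow> (nat \<Rightarrow> nat) \<Rightarrow> (nat \<times> nat) set set"
  where "inv_kern n V \<tau> = kern V ` {\<phi> \<in> V \<rightarrow>\<^sub>E {1..n}. kern V (\<lambda>i. \<phi> (\<tau> i)) = kern V \<phi>}"

text \<open>A kernel on \<open>V\<close> has at most \<open>card V\<close> classes and can be
  realised with values in \<open>{1..n'}\<close>. From that size on the set no longer depends on
  \<open>n\<close>.\<close>

lemma inv_kern_mono:
  assumes V: "finite V" "card V \<le> n'" and \<tau>: "\<tau> permutes V"
  shows "inv_kern n V \<tau> \<subseteq> inv_kern n' V \<tau>"
proof
  fix \<kappa> assume "\<kappa> \<in> inv_kern n V \<tau>"
  then obtain \<phi> where \<phi>: "\<phi> \<in> V \<rightarrow>\<^sub>E {1..n}" "kern V (\<lambda>i. \<phi> (\<tau> i)) = kern V \<phi>" "\<kappa> = kern V \<phi>"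
    by (auto simp: inv_kern_def)
  have "card (\<phi> ` V) \<le> card {1..n'}" using card_image_le[OF V(1), of \<phi>] V(2) by simp
  then obtain f where f: "f ` \<phi> ` V \<subseteq> {1..n'}" "inj_on f (\<phi> ` V)"
    using card_le_inj[of "\<phi> ` V" "{1..n'}"] V(1) by auto
  have \<tau>V: "\<tau> i \<in> V \<longleftrightarrow> i \<in> V" for i using permutes_in_image[OF \<tau>] .
  define \<psi> where "\<psi> = restrict (\<lambda>i. f (\<phi> i)) V"
  have k: "\<psi> i = \<psi> j \<longleftrightarrow> \<phi> i = \<phi> j" if "i \<in> V" "j \<in> V" for i j
    using that f(2) by (auto simp: \<psi>_def inj_on_eq_iff)
  have "kern V \<psi> = kern V \<phi>" using k by (auto simp: kern_def)
  moreover have "kern V (\<lambda>i. \<psi> (\<tau> i)) = kern V (\<lambda>i. \<phi> (\<tau> i))" using k \<tau>V by (auto simp: kern_def)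
  moreover have "\<psi> \<in> V \<rightarrow>\<^sub>E {1..n'}" using f(1) by (auto simp: \<psi>_def)
  ultimately show "\<kappa> \<in> inv_kern n' V \<tau>" using \<phi> by (auto simp: inv_kern_def)
qed

text \<open>Sum over \<open>\<phi>\<close> first. The equations have a solution
  \<open>\<sigma>\<close> only if \<open>\<phi>\<close> and its composite with \<open>\<tau>\<close>
  have the same kernel, and then the number of solutions is \<open>card (Alt n)\<close> divided by
  the size of the orbit. The maps with a given kernel form one orbit, so each invariant kernel
  contributes \<open>card (Alt n)\<close> in total.\<close>

lemma sum_card_eqv:
  assumes V: "finite V" "card V + 2 \<le> n" and \<tau>: "\<tau> permutes V"
  shows "(\<Sum>\<sigma>\<in>Alt n. real (card (eqv n V \<tau> \<sigma>))) = real (card (Alt n)) * real (card (inv_kern n V \<tau>))"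
proof -
  let ?P = "V \<rightarrow>\<^sub>E {1..n}"
  let ?I = "{\<phi> \<in> ?P. kern V (\<lambda>i. \<phi> (\<tau> i)) = kern V \<phi>}"
  have finP: "finite ?P" using V(1) by (intro finite_PiE) auto
  have \<tau>V: "\<tau> i \<in> V \<longleftrightarrow> i \<in> V" for i using permutes_in_image[OF \<tau>] .
  have kern_iff: "kern V \<psi> = kern V \<phi> \<longleftrightarrow> (\<forall>i\<in>V. \<forall>j\<in>V. \<psi> i = \<psi> j \<longleftrightarrow> \<phi> i = \<phi> j)" for \<psi> \<phi>
    unfolding kern_def by blast
  have fib: "real (card {\<sigma> \<in> Alt n. \<forall>i\<in>V. \<sigma> (\<phi> i) = \<phi> (\<tau> i)})
      = (if \<phi> \<in> ?I then real (card (Alt n)) / real (card {\<psi> \<in> ?I. kern V \<psi> = kern V \<phi>}) else 0)"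
    if \<phi>: "\<phi> \<in> ?P" for \<phi>
  proof (cases "\<phi> \<in> ?I")
    case True
    define \<psi> where "\<psi> = restrict (\<lambda>i. \<phi> (\<tau> i)) V"
    have "\<psi> \<in> ?P" using \<phi> \<tau>V by (auto simp: \<psi>_def)
    then have \<psi>: "\<psi> \<in> same_kernel n V \<phi>"
      using True unfolding mem_Collect_eq kern_iff by (auto simp: same_kernel_def \<psi>_def)
    have inv: "kern V (\<lambda>i. \<psi> (\<tau> i)) = kern V \<psi>" if "kern V \<psi> = kern V \<phi>" for \<psi>
      using True that \<tau>V unfolding mem_Collect_eq kern_iff by simp
    have "same_kernel n V \<phi> = {\<psi> \<in> ?I. kern V \<psi> = kern V \<phi>}"
      using inv by (auto simp: same_kernel_def kern_iff)
    moreover have "{\<sigma> \<in> Alt n. \<forall>i\<in>V. \<sigma> (\<phi> i) = \<phi> (\<tau> i)} = {\<sigma> \<in> Alt n. \<forall>i\<in>V. \<sigma> (\<phi> i) = \<psi> i}"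
      by (auto simp: \<psi>_def)
    ultimately have "card {\<sigma> \<in> Alt n. \<forall>i\<in>V. \<sigma> (\<phi> i) = \<phi> (\<tau> i)} * card {\<psi> \<in> ?I. kern V \<psi> = kern V \<phi>} = card (Alt n)"
      using card_Alt_fibre[OF V \<phi> \<psi>] by simp
    moreover from this have "card {\<psi> \<in> ?I. kern V \<psi> = kern V \<phi>} \<noteq> 0"
      using card_Alt_pos[of n] by (metis less_irrefl mult_0_right)
    ultimately show ?thesis using True
      by (simp add: field_simps flip: of_nat_mult)
  next
    case False
    have empty: "{\<sigma> \<in> Alt n. \<forall>i\<in>V. \<sigma> (\<phi> i) = \<phi> (\<tau> i)} = {}"
    proof (rule ccontr)
      assume "\<not> ?thesis"
      then obtain \<sigma> where \<sigma>: "\<sigma> \<in> Alt n" "\<forall>i\<in>V. \<sigma> (\<phi> i) = \<phi> (\<tau> i)" by auto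
      have "\<phi> (\<tau> i) = \<phi> (\<tau> j) \<longleftrightarrow> \<phi> i = \<phi> j" if "i \<in> V" "j \<in> V" for i j
        using \<sigma>(2) that inj_eq[OF bij_is_inj[OF Alt_bij[OF \<sigma>(1)]], of "\<phi> i" "\<phi> j"] by simp
      then show False using False \<phi> by (simp add: kern_iff)
    qed
    show ?thesis by (simp only: if_not_P[OF False] empty card.empty of_nat_0)
  qed
  have "(\<Sum>\<sigma>\<in>Alt n. real (card (eqv n V \<tau> \<sigma>))) = (\<Sum>\<sigma>\<in>Alt n. \<Sum>\<phi>\<in>?P. of_bool (\<forall>i\<in>V. \<sigma> (\<phi> i) = \<phi> (\<tau> i)))"
  proof (rule sum.cong[OF refl])
    fix \<sigma>
    have "eqv n V \<tau> \<sigma> = ?P \<inter> {\<phi>. \<forall>i\<in>V. \<sigma> (\<phi> i) = \<phi> (\<tau> i)}" by (auto simp: eqv_def)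
    then show "real (card (eqv n V \<tau> \<sigma>)) = (\<Sum>\<phi>\<in>?P. of_bool (\<forall>i\<in>V. \<sigma> (\<phi> i) = \<phi> (\<tau> i)))"
      using finP by simp
  qed
  also have "\<dots> = (\<Sum>\<phi>\<in>?P. \<Sum>\<sigma>\<in>Alt n. of_bool (\<forall>i\<in>V. \<sigma> (\<phi> i) = \<phi> (\<tau> i)))" by (rule sum.swap)
  also have "\<dots> = (\<Sum>\<phi>\<in>?P. real (card {\<sigma> \<in> Alt n. \<forall>i\<in>V. \<sigma> (\<phi> i) = \<phi> (\<tau> i)}))"
  proof (rule sum.cong[OF refl])
    fix \<phi>
    have "Alt n \<inter> {\<sigma>. \<forall>i\<in>V. \<sigma> (\<phi> i) = \<phi> (\<tau> i)} = {\<sigma> \<in> Alt n. \<forall>i\<in>V. \<sigma> (\<phi> i) = \<phi> (\<tau> i)}" by auto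
    then show "(\<Sum>\<sigma>\<in>Alt n. of_bool (\<forall>i\<in>V. \<sigma> (\<phi> i) = \<phi> (\<tau> i)))
        = real (card {\<sigma> \<in> Alt n. \<forall>i\<in>V. \<sigma> (\<phi> i) = \<phi> (\<tau> i)})"
      by simp
  qed
  also have "\<dots> = (\<Sum>\<phi>\<in>?P. if \<phi> \<in> ?I then real (card (Alt n)) / real (card {\<psi> \<in> ?I. kern V \<psi> = kern V \<phi>}) else 0)"
    by (rule sum.cong[OF refl fib])
  also have "\<dots> = (\<Sum>\<phi>\<in>?I. real (card (Alt n)) / real (card {\<psi> \<in> ?I. kern V \<psi> = kern V \<phi>}))"
    using finP by (intro sum.mono_neutral_cong_right) auto
  also have "\<dots> = (\<Sum>\<kappa>\<in>kern V ` ?I. \<Sum>\<phi>\<in>{\<phi> \<in> ?I. kern V \<phi> = \<kappa>}.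
      real (card (Alt n)) / real (card {\<psi> \<in> ?I. kern V \<psi> = kern V \<phi>}))"
    by (rule sum.group[symmetric]) (use finP in auto)
  also have "\<dots> = (\<Sum>\<kappa>\<in>kern V ` ?I. real (card (Alt n)))"
  proof (rule sum.cong[OF refl])
    fix \<kappa> assume \<kappa>: "\<kappa> \<in> kern V ` ?I"
    have "(\<Sum>\<phi>\<in>{\<phi> \<in> ?I. kern V \<phi> = \<kappa>}. real (card (Alt n)) / real (card {\<psi> \<in> ?I. kern V \<psi> = kern V \<phi>}))
        = (\<Sum>\<phi>\<in>{\<phi> \<in> ?I. kern V \<phi> = \<kappa>}. real (card (Alt n)) / real (card {\<psi> \<in> ?I. kern V \<psi> = \<kappa>}))"
      by (rule sum.cong) auto
    moreover have "card {\<psi> \<in> ?I. kern V \<psi> = \<kappa>} \<noteq> 0"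
      using \<kappa> finP by (auto simp: card_eq_0_iff)
    ultimately show "(\<Sum>\<phi>\<in>{\<phi> \<in> ?I. kern V \<phi> = \<kappa>}.
      real (card (Alt n)) / real (card {\<psi> \<in> ?I. kern V \<psi> = kern V \<phi>})) = real (card (Alt n))"
      by (simp only: sum_constant) simp
  qed
  finally show ?thesis by (simp add: inv_kern_def)
qed

definition mean :: "nat \<Rightarrow> ((nat \<Rightarrow> nat) \<Rightarrow> real) \<Rightarrow> real"
  where "mean n f = (\<Sum>x\<in>Alt n. f x) / real (card (Alt n))"

lemma mean_nonneg: "(\<And>x. x \<in> Alt n \<Longrightarrow> 0 \<le> f x) \<Longrightarrow> 0 \<le> mean n f"
  by (simp add: mean_def sum_nonneg)

lemma mean_cong: "(\<And>x. x \<in> Alt n \<Longrightarrow> f x = g x) \<Longrightarrow> mean n f = mean n g"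
  by (simp add: mean_def)

lemma mean_pattern_comb_indep:
  assumes "M + 2 \<le> n" "M + 2 \<le> n'"
  shows "mean n (pattern_comb n M c) = mean n' (pattern_comb n' M c)"
proof -
  have 1: "mean m (pattern_comb m M c) = (\<Sum>p\<in>perm_patterns M. c p * real (card (inv_kern m (fst p) (snd p))))"
    if m: "M + 2 \<le> m" for m
  proof -
    have "(\<Sum>\<sigma>\<in>Alt m. pattern_comb m M c \<sigma>)
        = (\<Sum>p\<in>perm_patterns M. c p * (\<Sum>\<sigma>\<in>Alt m. real (card (eqv m (fst p) (snd p) \<sigma>))))"
      unfolding pattern_comb_def sum_distrib_left by (rule sum.swap)
    also have "\<dots> = (\<Sum>p\<in>perm_patterns M. c p * (real (card (Alt m)) * real (card (inv_kern m (fst p) (snd p)))))"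
    proof (rule sum.cong[OF refl])
      fix p assume "p \<in> perm_patterns M"
      then have p: "fst p \<subseteq> {..<M}" "snd p permutes fst p" by (auto simp: perm_patterns_def)
      have "finite (fst p)" "card (fst p) \<le> M"
        using p(1) finite_subset card_mono[OF _ p(1)] by auto
      then show "c p * (\<Sum>\<sigma>\<in>Alt m. real (card (eqv m (fst p) (snd p) \<sigma>)))
          = c p * (real (card (Alt m)) * real (card (inv_kern m (fst p) (snd p))))"
        using sum_card_eqv[of "fst p" m "snd p"] p(2) m by simp
    qed
    also have "\<dots> = real (card (Alt m)) * (\<Sum>p\<in>perm_patterns M. c p * real (card (inv_kern m (fst p) (snd p))))"
      by (simp add: sum_distrib_left algebra_simps)
    finally show ?thesis
      by (simp add: mean_def)
  qed
  have "inv_kern n (fst p) (snd p) = inv_kern n' (fst p) (snd p)" if "p \<in> perm_patterns M" for p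
  proof -
    have p: "fst p \<subseteq> {..<M}" "snd p permutes fst p" using that by (auto simp: perm_patterns_def)
    then have "finite (fst p)" "card (fst p) \<le> M"
      using finite_subset card_mono[OF _ p(1)] by auto
    then show ?thesis using assms p(2) by (intro equalityI inv_kern_mono) auto
  qed
  then show ?thesis using assms by (simp add: 1)
qed

text \<open>Pairs of maps are maps on the disjoint union, realised by shifting \<open>V'\<close> by
  \<open>M\<close>.\<close>

lemma card_eqv_mult:
  assumes V: "V \<subseteq> {..<M}" and \<tau>: "\<tau> permutes V" and V': "V' \<subseteq> {..<M}" and \<tau>': "\<tau>' permutes V'"
  shows "card (eqv n V \<tau> \<sigma>) * card (eqv n V' \<tau>' \<sigma>)
    = card (eqv n (V \<union> (\<lambda>i. i + M) ` V') (\<lambda>i. if i < M then \<tau> i else \<tau>' (i - M) + M) \<sigma>)"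
proof -
  let ?W = "V \<union> (\<lambda>i. i + M) ` V'" and ?t = "\<lambda>i. if i < M then \<tau> i else \<tau>' (i - M) + M"
  let ?f = "\<lambda>\<phi>. (restrict \<phi> V, restrict (\<lambda>i. \<phi> (i + M)) V')"
  let ?g = "\<lambda>(\<phi>, \<psi>). restrict (\<lambda>i. if i < M then \<phi> i else \<psi> (i - M)) ?W"
  have \<tau>V: "\<tau> i \<in> V \<longleftrightarrow> i \<in> V" "\<tau>' i \<in> V' \<longleftrightarrow> i \<in> V'" for i
    using permutes_in_image[OF \<tau>] permutes_in_image[OF \<tau>'] by auto
  have W: "i + M \<in> ?W \<longleftrightarrow> i \<in> V'" for i using V by auto
  have Vlt: "i < M" if "i \<in> V" for i using V that by auto
  have "bij_betw ?f (eqv n ?W ?t \<sigma>) (eqv n V \<tau> \<sigma> \<times> eqv n V' \<tau>' \<sigma>)"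
  proof (rule bij_betwI[where g = ?g])
    show "?f \<in> eqv n ?W ?t \<sigma> \<rightarrow> eqv n V \<tau> \<sigma> \<times> eqv n V' \<tau>' \<sigma>"
    proof
      fix \<phi> assume \<phi>: "\<phi> \<in> eqv n ?W ?t \<sigma>"
      have "restrict \<phi> V \<in> eqv n V \<tau> \<sigma>"
        using \<phi> Vlt \<tau>V(1) by (auto simp: eqv_def PiE_iff)
      moreover have "restrict (\<lambda>i. \<phi> (i + M)) V' \<in> eqv n V' \<tau>' \<sigma>"
        using \<phi> \<tau>V(2) by (auto simp: eqv_def PiE_iff)
      ultimately show "?f \<phi> \<in> eqv n V \<tau> \<sigma> \<times> eqv n V' \<tau>' \<sigma>" by simp
    qed
    show "?g \<in> eqv n V \<tau> \<sigma> \<times> eqv n V' \<tau>' \<sigma> \<rightarrow> eqv n ?W ?t \<sigma>"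
    proof
      fix p assume "p \<in> eqv n V \<tau> \<sigma> \<times> eqv n V' \<tau>' \<sigma>"
      then obtain \<phi> \<psi> where p: "p = (\<phi>, \<psi>)" "\<phi> \<in> eqv n V \<tau> \<sigma>" "\<psi> \<in> eqv n V' \<tau>' \<sigma>" by blast
      have 1: "?g p i = \<phi> i" if "i \<in> V" for i using that Vlt p(1) by auto
      have 2: "?g p (i + M) = \<psi> i" if "i \<in> V'" for i using that p(1) by auto
      have "?g p \<in> ?W \<rightarrow>\<^sub>E {1..n}"
      proof (rule PiE_I)
        fix x assume "x \<in> ?W"
        then consider "x \<in> V" | i where "x = i + M" "i \<in> V'" by blast
        then show "?g p x \<in> {1..n}"
        proof cases
          case 1
          then show ?thesis using p(2) \<open>\<And>i. i \<in> V \<Longrightarrow> ?g p i = \<phi> i\<close> by (auto simp: eqv_def)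
        next
          case 2
          then show ?thesis using p(3) \<open>\<And>i. i \<in> V' \<Longrightarrow> ?g p (i + M) = \<psi> i\<close> by (auto simp: eqv_def)
        qed
      qed (use p in auto)
      moreover have "\<sigma> (?g p x) = ?g p (?t x)" if "x \<in> ?W" for x
      proof -
        consider "x \<in> V" | i where "x = i + M" "i \<in> V'" using \<open>x \<in> ?W\<close> by blast
        then show ?thesis
        proof cases
          case a: 1
          have "?t x = \<tau> x" using Vlt[OF a] by simp
          then show ?thesis using p(2) a 1[of x] 1[of "\<tau> x"] \<tau>V(1)[of x] by (simp only: eqv_def) auto
        next
          case b: 2
          have "?t x = \<tau>' i + M" using b by simp
          then show ?thesis using p(3) b 2[of i] 2[of "\<tau>' i"] \<tau>V(2)[of i] by (simp only: eqv_def) auto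
        qed
      qed
      ultimately show "?g p \<in> eqv n ?W ?t \<sigma>" unfolding eqv_def by blast
    qed
    show "?g (?f \<phi>) = \<phi>" if "\<phi> \<in> eqv n ?W ?t \<sigma>" for \<phi>
    proof
      fix x
      have ext: "\<phi> x = undefined" if "x \<notin> ?W" using that \<open>\<phi> \<in> eqv n ?W ?t \<sigma>\<close> by (auto simp: eqv_def PiE_iff extensional_def)
      consider "x \<in> V" | i where "x = i + M" "i \<in> V'" | "x \<notin> ?W" by blast
      then show "?g (?f \<phi>) x = \<phi> x" by cases (use ext Vlt in auto)
    qed
    show "?f (?g p) = p" if p': "p \<in> eqv n V \<tau> \<sigma> \<times> eqv n V' \<tau>' \<sigma>" for p
    proof -
      obtain \<phi> \<psi> where p: "p = (\<phi>, \<psi>)" "\<phi> \<in> V \<rightarrow>\<^sub>E {1..n}" "\<psi> \<in> V' \<rightarrow>\<^sub>E {1..n}"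
        using p' by (auto simp: eqv_def)
      have "restrict (?g p) V = \<phi>"
        using p Vlt by (auto simp: fun_eq_iff PiE_iff extensional_def)
      moreover have "restrict (\<lambda>i. ?g p (i + M)) V' = \<psi>"
        using p by (auto simp: fun_eq_iff PiE_iff extensional_def)
      ultimately show ?thesis by (simp add: p(1))
    qed
  qed
  from bij_betw_same_card[OF this] show ?thesis by (simp only: card_cartesian_product)
qed

lemma perm_patterns_mult:
  assumes V: "V \<subseteq> {..<M}" and \<tau>: "\<tau> permutes V" and V': "V' \<subseteq> {..<M}" and \<tau>': "\<tau>' permutes V'"
  shows "(V \<union> (\<lambda>i. i + M) ` V', \<lambda>i. if i < M then \<tau> i else \<tau>' (i - M) + M) \<in> perm_patterns (2 * M)"
proof -
  let ?W = "V \<union> (\<lambda>i. i + M) ` V'" and ?t = "\<lambda>i. if i < M then \<tau> i else \<tau>' (i - M) + M"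
  have \<tau>V: "\<tau> i \<in> V \<longleftrightarrow> i \<in> V" "\<tau>' i \<in> V' \<longleftrightarrow> i \<in> V'" for i
    using permutes_in_image[OF \<tau>] permutes_in_image[OF \<tau>'] by auto
  have Vlt: "i < M" if "i \<in> V" for i using V that by auto
  have "?W \<subseteq> {..<2 * M}" using V V' by auto
  moreover have "?t permutes ?W"
  proof (rule bij_imp_permutes)
    have "?t ` V = V" using permutes_image[OF \<tau>] Vlt by (simp cong: image_cong)
    moreover have "?t ` (\<lambda>i. i + M) ` V' = (\<lambda>i. i + M) ` V'"
    proof -
      have "?t ` (\<lambda>i. i + M) ` V' = (\<lambda>i. \<tau>' i + M) ` V'"
        unfolding image_image by (rule image_cong) simp_all
      also have "\<dots> = (\<lambda>i. i + M) ` \<tau>' ` V'" by (simp only: image_image)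
      finally show ?thesis by (simp only: permutes_image[OF \<tau>'])
    qed
    ultimately have im: "?t ` ?W = ?W" by (simp only: image_Un)
    have "finite ?W" using V V' finite_subset[of _ "{..<M}"] by auto
    then show "bij_betw ?t ?W ?W"
      using im eq_card_imp_inj_on[of ?W ?t] by (simp add: bij_betw_def)
    fix x assume x: "x \<notin> ?W"
    show "?t x = x"
    proof (cases "x < M")
      case True
      then show ?thesis using x permutes_not_in[OF \<tau>] by simp
    next
      case False
      then have "x - M \<notin> V'" using x by force
      then show ?thesis using False permutes_not_in[OF \<tau>'] by simp
    qed
  qed
  ultimately show ?thesis by (simp add: perm_patterns_def)
qed

text \<open>The new coefficients are chosen before \<open>n\<close>, as a comparison of moments for
  different \<open>n\<close> requires.\<close>

lemma pattern_comb_square: "\<exists>c'. \<forall>n \<sigma>. (pattern_comb n M c \<sigma>)\<^sup>2 = pattern_comb n (2 * M) c' \<sigma>"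
proof -
  let ?P = "perm_patterns M"
  define m where "m = (\<lambda>(p, q). (fst p \<union> (\<lambda>i. i + M) ` fst q,
    \<lambda>i. if i < M then snd p i else snd q (i - M) + M))"
  define c' where "c' r = (\<Sum>pq\<in>{pq \<in> ?P \<times> ?P. m pq = r}. c (fst pq) * c (snd pq))" for r
  have m: "m pq \<in> perm_patterns (2 * M)"
    "real (card (eqv n (fst (fst pq)) (snd (fst pq)) \<sigma>)) * real (card (eqv n (fst (snd pq)) (snd (snd pq)) \<sigma>))
      = real (card (eqv n (fst (m pq)) (snd (m pq)) \<sigma>))"
    if pq: "pq \<in> ?P \<times> ?P" for pq n \<sigma>
  proof -
    have *: "fst (fst pq) \<subseteq> {..<M}" "snd (fst pq) permutes fst (fst pq)"
      "fst (snd pq) \<subseteq> {..<M}" "snd (snd pq) permutes fst (snd pq)"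
      using pq by (auto simp: perm_patterns_def)
    show "m pq \<in> perm_patterns (2 * M)"
      using perm_patterns_mult[OF *] by (simp add: m_def split_beta)
    show "real (card (eqv n (fst (fst pq)) (snd (fst pq)) \<sigma>)) * real (card (eqv n (fst (snd pq)) (snd (snd pq)) \<sigma>))
      = real (card (eqv n (fst (m pq)) (snd (m pq)) \<sigma>))"
      using card_eqv_mult[OF *, of n \<sigma>] by (simp add: m_def split_beta flip: of_nat_mult)
  qed
  have "(pattern_comb n M c \<sigma>)\<^sup>2 = pattern_comb n (2 * M) c' \<sigma>" for n \<sigma>
  proof -
    let ?h = "\<lambda>p. real (card (eqv n (fst p) (snd p) \<sigma>))"
    have "(pattern_comb n M c \<sigma>)\<^sup>2 = (\<Sum>pq\<in>?P \<times> ?P. (c (fst pq) * ?h (fst pq)) * (c (snd pq) * ?h (snd pq)))"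
      by (simp add: pattern_comb_def power2_eq_square sum_product sum.cartesian_product split_beta)
    also have "\<dots> = (\<Sum>pq\<in>?P \<times> ?P. c (fst pq) * c (snd pq) * ?h (m pq))"
    proof (rule sum.cong[OF refl])
      fix pq assume "pq \<in> ?P \<times> ?P"
      then show "(c (fst pq) * ?h (fst pq)) * (c (snd pq) * ?h (snd pq)) = c (fst pq) * c (snd pq) * ?h (m pq)"
        by (subst m(2)[symmetric]) (simp_all add: mult_ac)
    qed
    also have "\<dots> = (\<Sum>r\<in>perm_patterns (2 * M). \<Sum>pq\<in>{pq \<in> ?P \<times> ?P. m pq = r}. c (fst pq) * c (snd pq) * ?h (m pq))"
      by (rule sum.group[symmetric]) (use m(1) in auto)
    also have "\<dots> = pattern_comb n (2 * M) c' \<sigma>"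
      unfolding pattern_comb_def c'_def sum_distrib_right by (intro sum.cong refl) auto
    finally show ?thesis .
  qed
  then show ?thesis by blast
qed

lemma pattern_comb_power: "\<exists>c'. \<forall>n \<sigma>. (pattern_comb n M c \<sigma>) ^ (2 ^ t) = pattern_comb n (2 ^ t * M) c' \<sigma>"
proof (induction t)
  case 0
  then show ?case by (intro exI[of _ c]) simp
next
  case (Suc t)
  then obtain c1 where c1: "\<forall>n \<sigma>. (pattern_comb n M c \<sigma>) ^ (2 ^ t) = pattern_comb n (2 ^ t * M) c1 \<sigma>" by blast
  obtain c2 where "\<forall>n \<sigma>. (pattern_comb n (2 ^ t * M) c1 \<sigma>)\<^sup>2 = pattern_comb n (2 * (2 ^ t * M)) c2 \<sigma>"
    using pattern_comb_square by blast
  moreover have "pattern_comb n M c \<sigma> ^ 2 ^ Suc t = (pattern_comb n M c \<sigma> ^ 2 ^ t)\<^sup>2" for n \<sigma>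
    by (simp add: mult.commute flip: power_mult)
  ultimately show ?case
    using c1 by (intro exI[of _ c2]) (simp only: power_Suc[of "2::nat" t] mult.assoc, simp)
qed

section \<open>Moments of class functions of low degree\<close>

lemma mean_Cauchy: "(mean n (\<lambda>x. f x * g x))\<^sup>2 \<le> mean n (\<lambda>x. (f x)\<^sup>2) * mean n (\<lambda>x. (g x)\<^sup>2)"
  using divide_right_mono[OF ip_Cauchy[of n f g], of "(real (card (Alt n)))\<^sup>2"]
  by (simp add: mean_def ip_def power_divide power2_eq_square)

lemma mean_mono: "(\<And>x. x \<in> Alt n \<Longrightarrow> f x \<le> g x) \<Longrightarrow> mean n f \<le> mean n g"
  unfolding mean_def by (intro divide_right_mono sum_mono) auto

lemma mean_const [simp]: "mean n (\<lambda>_. c) = c"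
  by (simp add: mean_def)

text \<open>
  The moments of a combination of patterns do not depend on \<open>n\<close>, so it suffices to compare them for one
  fixed \<open>n\<close>, where any two norms are equivalent.
\<close>

lemma pattern_span_moment_bound:
  "\<exists>K>0. \<forall>n\<ge>2 ^ Suc t * M + 2. \<forall>f. pattern_span n M f \<longrightarrow>
    mean n (\<lambda>x. f x ^ 2 ^ Suc t) \<le> K * mean n (\<lambda>x. (f x)\<^sup>2) ^ 2 ^ t"
proof -
  define n0 where "n0 = 2 ^ Suc t * M + 2"
  have n0: "2 * M + 2 \<le> n0"
    unfolding n0_def by (intro add_right_mono mult_right_mono) auto
  show ?thesis
  proof (intro exI[of _ "real (card (Alt n0)) ^ 2 ^ t"] conjI allI impI)
    show "0 < real (card (Alt n0)) ^ 2 ^ t" by simp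
    fix n f assume n: "2 ^ Suc t * M + 2 \<le> n" and "pattern_span n M f"
    then obtain c where c: "\<And>\<sigma>. \<sigma> permutes {1..n} \<Longrightarrow> f \<sigma> = pattern_comb n M c \<sigma>" by (auto simp: pattern_span_def)
    obtain c1 where c1: "\<And>n \<sigma>. pattern_comb n M c \<sigma> ^ 2 ^ Suc t = pattern_comb n (2 ^ Suc t * M) c1 \<sigma>"
      using pattern_comb_power[of M c "Suc t"] by blast
    obtain c2 where c2: "\<And>n \<sigma>. (pattern_comb n M c \<sigma>)\<^sup>2 = pattern_comb n (2 * M) c2 \<sigma>"
      using pattern_comb_square[of M c] by blast
    let ?g = "pattern_comb n0 M c"
    have "mean n (\<lambda>x. f x ^ 2 ^ Suc t) = mean n (pattern_comb n (2 ^ Suc t * M) c1)"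
      by (rule mean_cong) (use c[OF Alt_permutes] c1 in metis)
    also have "\<dots> = mean n0 (pattern_comb n0 (2 ^ Suc t * M) c1)"
      by (rule mean_pattern_comb_indep) (use n n0_def in auto)
    also have "\<dots> = mean n0 (\<lambda>x. ?g x ^ 2 ^ Suc t)" by (simp only: c1)
    finally have 1: "mean n (\<lambda>x. f x ^ 2 ^ Suc t) = mean n0 (\<lambda>x. ?g x ^ 2 ^ Suc t)" .
    have "mean n (\<lambda>x. (f x)\<^sup>2) = mean n (pattern_comb n (2 * M) c2)"
      by (rule mean_cong) (use c[OF Alt_permutes] c2 in metis)
    also have "\<dots> = mean n0 (pattern_comb n0 (2 * M) c2)"
      by (rule mean_pattern_comb_indep) (use n n0 n0_def in linarith)+
    also have "\<dots> = mean n0 (\<lambda>x. (?g x)\<^sup>2)" by (simp only: c2)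
    finally have 2: "mean n (\<lambda>x. (f x)\<^sup>2) = mean n0 (\<lambda>x. (?g x)\<^sup>2)" .
    let ?m = "mean n0 (\<lambda>x. (?g x)\<^sup>2)"
    \<comment> \<open>On the fixed group the square is bounded pointwise by its sum. This crude
      bound suffices because \<open>n0\<close> depends on \<open>t\<close> and \<open>M\<close>
      only.\<close>
    have "mean n0 (\<lambda>x. ?g x ^ 2 ^ Suc t) \<le> mean n0 (\<lambda>x. (real (card (Alt n0)) * ?m) ^ 2 ^ t)"
    proof (rule mean_mono)
      fix x assume "x \<in> Alt n0"
      then have "(?g x)\<^sup>2 \<le> (\<Sum>x\<in>Alt n0. (?g x)\<^sup>2)"
        by (intro member_le_sum) auto
      also have "\<dots> = real (card (Alt n0)) * ?m" by (simp add: mean_def)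
      finally have "((?g x)\<^sup>2) ^ 2 ^ t \<le> (real (card (Alt n0)) * ?m) ^ 2 ^ t"
        by (rule power_mono) simp
      then show "?g x ^ 2 ^ Suc t \<le> (real (card (Alt n0)) * ?m) ^ 2 ^ t"
        by (simp add: power_mult)
    qed
    then show "mean n (\<lambda>x. f x ^ 2 ^ Suc t) \<le> real (card (Alt n0)) ^ 2 ^ t * mean n (\<lambda>x. (f x)\<^sup>2) ^ 2 ^ t"
      unfolding 1 2 by (simp only: mean_const power_mult_distrib)
  qed
qed

text \<open>Let \<open>a, b, c, d\<close> be the first four moments. Cauchy-Schwarz gives
  \<open>b^2 \<le> a * c\<close>, where \<open>f \<ge> 0\<close> is used, and
  \<open>c^2 \<le> b * d\<close>, while \<open>d \<le> K * b^2\<close> by the moment bound;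
  eliminating \<open>c\<close> and \<open>d\<close> leaves \<open>b \<le> K * a^2\<close>.\<close>

lemma pattern_span_nonneg_L2_L1:
  "\<exists>K>0. \<forall>n\<ge>4 * M + 2. \<forall>f. pattern_span n M f \<longrightarrow> (\<forall>x\<in>Alt n. 0 \<le> f x) \<longrightarrow>
    mean n (\<lambda>x. (f x)\<^sup>2) \<le> K * (mean n f)\<^sup>2"
proof -
  obtain K where K: "0 < K" "\<forall>n\<ge>2 ^ Suc 1 * M + 2. \<forall>f. pattern_span n M f \<longrightarrow>
    mean n (\<lambda>x. f x ^ 2 ^ Suc 1) \<le> K * mean n (\<lambda>x. (f x)\<^sup>2) ^ 2 ^ 1"
    using pattern_span_moment_bound[of 1 M] by (elim exE conjE)
  show ?thesis
  proof (intro exI[of _ K] conjI allI impI K(1))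
    fix n f assume n: "4 * M + 2 \<le> n" and f: "pattern_span n M f" "\<forall>x\<in>Alt n. 0 \<le> f x"
    define a b c d where "a = mean n f" and "b = mean n (\<lambda>x. (f x)\<^sup>2)"
      and "c = mean n (\<lambda>x. f x ^ 3)" and "d = mean n (\<lambda>x. f x ^ 4)"
    have "2 ^ Suc 1 * M + 2 \<le> n" using n by simp
    from K(2)[rule_format, OF this f(1)] have "d \<le> K * b ^ 2" by (simp add: b_def d_def)
    have nn: "0 \<le> b" "0 \<le> a" "0 \<le> c" using f(2) by (auto simp: a_def b_def c_def intro!: mean_nonneg)
    have "b\<^sup>2 = (mean n (\<lambda>x. sqrt (f x) * (sqrt (f x) * f x)))\<^sup>2"
      unfolding b_def using f(2) by (intro arg_cong[of _ _ "\<lambda>x. x\<^sup>2"] mean_cong) (simp add: power2_eq_square)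
    also have "\<dots> \<le> mean n (\<lambda>x. (sqrt (f x))\<^sup>2) * mean n (\<lambda>x. (sqrt (f x) * f x)\<^sup>2)"
      by (rule mean_Cauchy)
    also have "\<dots> = a * c"
      unfolding a_def c_def using f(2)
      by (intro arg_cong2[of _ _ _ _ "(*)"] mean_cong)
        (simp_all add: power_mult_distrib power2_eq_square power3_eq_cube)
    finally have bac: "b\<^sup>2 \<le> a * c" .
    have "c\<^sup>2 = (mean n (\<lambda>x. f x * (f x)\<^sup>2))\<^sup>2"
      by (simp add: c_def power2_eq_square power3_eq_cube mult.assoc)
    also have "\<dots> \<le> mean n (\<lambda>x. (f x)\<^sup>2) * mean n (\<lambda>x. ((f x)\<^sup>2)\<^sup>2)" by (rule mean_Cauchy)
    also have "\<dots> = b * d" by (simp add: b_def d_def)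
    also have "\<dots> \<le> b * (K * b\<^sup>2)" using \<open>d \<le> K * b ^ 2\<close> nn by (intro mult_left_mono)
    finally have cb: "c\<^sup>2 \<le> K * b ^ 3" by (simp add: power2_eq_square power3_eq_cube algebra_simps)
    have "b * b ^ 3 = (b\<^sup>2)\<^sup>2" by (simp add: power2_eq_square power3_eq_cube)
    also have "\<dots> \<le> (a * c)\<^sup>2" using bac by (rule power_mono) simp
    also have "\<dots> = a\<^sup>2 * c\<^sup>2" by (simp add: power_mult_distrib)
    also have "\<dots> \<le> a\<^sup>2 * (K * b ^ 3)" using cb by (rule mult_left_mono) simp
    finally have *: "b * b ^ 3 \<le> (K * a\<^sup>2) * b ^ 3" by (simp add: algebra_simps)
    have "b \<le> K * a\<^sup>2"
    proof (cases "b = 0")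
      case True
      then show ?thesis using K(1) by simp
    next
      case False
      then have "0 < b ^ 3" using nn(1) by simp
      then show ?thesis using * by (simp only: mult_le_cancel_right_pos)
    qed
    then show "mean n (\<lambda>x. (f x)\<^sup>2) \<le> K * (mean n f)\<^sup>2" by (simp add: a_def b_def)
  qed
qed

section \<open>Conjugation averages of functions of low degree\<close>

lemma map_eq_map_iff_zip:
  "length X = length Y \<Longrightarrow> map f X = map h Y \<longleftrightarrow> (\<forall>(x, y)\<in>set (zip X Y). f x = h y)"
  by (induction X Y rule: list_induct2) auto

text \<open>After replacing \<open>g\<close> by its inverse, the condition says that
  \<open>\<sigma>\<close> sends \<open>g x\<close> to \<open>g y\<close> for corresponding entries
  of \<open>X\<close> and \<open>Y\<close>. The restriction of \<open>g\<close> to the points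
  involved is equidistributed over all injections, so the sum is a multiple of the number of
  injective maps respecting the edges, a case of \<open>homs\<close>.\<close>

lemma pattern_span_conj_indicator:
  assumes X: "set X \<subseteq> {1..n}" "set Y \<subseteq> {1..n}" "length X = length Y" "length X \<le> m" and n: "2 * m + 2 \<le> n"
  shows "pattern_span n (2 * m) (\<lambda>\<sigma>. \<Sum>g\<in>Alt n. of_bool (map (g \<circ> \<sigma> \<circ> inv' g) X = Y))"
proof -
  \<comment> \<open>The points involved are renumbered by indices below \<open>2 * m\<close>, which
    turns them into an abstract pattern.\<close>
  define Z where "Z = remdups (X @ Y)"
  define V where "V = {..<length Z}"
  define \<phi>0 where "\<phi>0 = restrict ((!) Z) V"
  have setZ: "set Z = set X \<union> set Y" and dZ: "distinct Z" by (auto simp: Z_def)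
  have lenZ: "length Z \<le> 2 * m"
    using length_remdups_leq[of "X @ Y"] X by (simp add: Z_def)
  have V: "finite V" "V \<subseteq> {..<2 * m}" "card V + 2 \<le> n" using lenZ n by (auto simp: V_def)
  have \<phi>0: "\<phi>0 \<in> V \<rightarrow>\<^sub>E {1..n}"
  proof -
    have "Z ! i \<in> {1..n}" if "i \<in> V" for i
      using that nth_mem[of i Z] setZ X by (auto simp: V_def)
    then show ?thesis by (auto simp: \<phi>0_def)
  qed
  have inj0: "inj_on \<phi>0 V" using dZ by (auto simp: \<phi>0_def V_def inj_on_def nth_eq_iff_index_eq)
  have "\<forall>y\<in>set X \<union> set Y. \<exists>i\<in>V. \<phi>0 i = y"
    unfolding setZ[symmetric] by (auto simp: \<phi>0_def V_def in_set_conv_nth)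
  then obtain pos where pos: "\<And>y. y \<in> set X \<union> set Y \<Longrightarrow> pos y \<in> V \<and> \<phi>0 (pos y) = y"
    by metis
  define E where "E = (\<lambda>(x, y). (pos x, pos y)) ` set (zip X Y)"
  define R where "R = {(i, j) \<in> V \<times> V. i \<noteq> j}"
  let ?\<Omega> = "same_kernel n V \<phi>0"
  define P where "P \<sigma> \<psi> \<longleftrightarrow> (\<forall>(i, j)\<in>E. \<sigma> (\<psi> i) = \<psi> j)" for \<sigma> \<psi> :: "nat \<Rightarrow> nat"
  define lift where "lift g = restrict (\<lambda>i. g (\<phi>0 i)) V" for g :: "nat \<Rightarrow> nat"
  have fin: "finite ?\<Omega>"
    unfolding same_kernel_def using V(1) by (intro finite_subset[OF _ finite_PiE[of V "\<lambda>_. {1..n}"]]) auto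
  have zipV: "x \<in> set X \<and> y \<in> set Y" if "(x, y) \<in> set (zip X Y)" for x y
    using that by (auto dest: set_zip_leftD set_zip_rightD)
  have cond: "map (inv' g \<circ> \<sigma> \<circ> g) X = Y \<longleftrightarrow> P \<sigma> (lift g)" if g: "g \<in> Alt n" for g \<sigma>
  proof -
    have "map (inv' g \<circ> \<sigma> \<circ> g) X = Y \<longleftrightarrow> map (\<sigma> \<circ> g) X = map g Y"
    proof
      assume "map (inv' g \<circ> \<sigma> \<circ> g) X = Y"
      then have "map g (map (inv' g \<circ> \<sigma> \<circ> g) X) = map g Y" by simp
      then show "map (\<sigma> \<circ> g) X = map g Y" using g by (simp add: o_def)
    next
      assume "map (\<sigma> \<circ> g) X = map g Y"
      then have "map (inv' g) (map (\<sigma> \<circ> g) X) = map (inv' g) (map g Y)" by simp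
      then show "map (inv' g \<circ> \<sigma> \<circ> g) X = Y" using g by (simp add: o_def)
    qed
    also have "\<dots> \<longleftrightarrow> (\<forall>(x, y)\<in>set (zip X Y). \<sigma> (g x) = g y)"
      using map_eq_map_iff_zip[OF X(3), of "\<sigma> \<circ> g" g] by simp
    also have "\<dots> \<longleftrightarrow> P \<sigma> (lift g)"
    proof -
      have "lift g (pos y) = g y" if "y \<in> set X \<union> set Y" for y
        using pos[OF that] by (simp add: lift_def)
      then have "\<sigma> (lift g (pos x)) = lift g (pos y) \<longleftrightarrow> \<sigma> (g x) = g y" if "(x, y) \<in> set (zip X Y)" for x y
        using zipV[OF that] by simp
      then show ?thesis unfolding P_def E_def by fastforce
    qed
    finally show ?thesis .
  qed
  have lift: "lift g \<in> ?\<Omega>" if "g \<in> Alt n" for g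
  proof -
    have "g (\<phi>0 i) \<in> {1..n}" if "i \<in> V" for i
      using \<phi>0 that Alt_image_eq[OF \<open>g \<in> Alt n\<close>] by blast
    then show ?thesis
      using bij_is_inj[OF Alt_bij[OF that]] by (auto simp: same_kernel_def inj_eq lift_def)
  qed
  have fibre: "real (card {g \<in> Alt n. lift g = \<psi>}) = real (card (Alt n)) / real (card ?\<Omega>)" if \<psi>: "\<psi> \<in> ?\<Omega>" for \<psi>
  proof -
    have "lift g = \<psi> \<longleftrightarrow> (\<forall>i\<in>V. g (\<phi>0 i) = \<psi> i)" for g
      using \<psi> by (auto simp: lift_def same_kernel_def PiE_iff extensional_def fun_eq_iff)
    then have "card {g \<in> Alt n. lift g = \<psi>} * card ?\<Omega> = card (Alt n)"
      using card_Alt_fibre[OF V(1,3) \<phi>0 \<psi>] by simp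
    then have "real (card {g \<in> Alt n. lift g = \<psi>}) * real (card ?\<Omega>) = real (card (Alt n))"
      by (simp flip: of_nat_mult)
    moreover have "card ?\<Omega> \<noteq> 0" using \<psi> fin by auto
    ultimately show ?thesis by (simp add: field_simps)
  qed
  have "(\<Sum>g\<in>Alt n. of_bool (map (g \<circ> \<sigma> \<circ> inv' g) X = Y))
      = real (card (Alt n)) / real (card ?\<Omega>) * real (card (homs n V E R \<sigma>))" for \<sigma>
  proof -
    have "(\<Sum>g\<in>Alt n. of_bool (map (g \<circ> \<sigma> \<circ> inv' g) X = Y))
        = (\<Sum>g\<in>Alt n. of_bool (map (inv' g \<circ> \<sigma> \<circ> inv' (inv' g)) X = Y) :: real)"
      by (rule sum_Alt_inv[symmetric])
    also have "\<dots> = (\<Sum>g\<in>Alt n. of_bool (P \<sigma> (lift g)))"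
      by (rule sum.cong[OF refl]) (simp add: cond del: map_map)
    also have "\<dots> = (\<Sum>\<psi>\<in>?\<Omega>. \<Sum>g\<in>{g \<in> Alt n. lift g = \<psi>}. of_bool (P \<sigma> (lift g)))"
      by (rule sum.group[symmetric]) (use fin lift in auto)
    also have "\<dots> = (\<Sum>\<psi>\<in>?\<Omega>. real (card (Alt n)) / real (card ?\<Omega>) * of_bool (P \<sigma> \<psi>))"
    proof (rule sum.cong[OF refl])
      fix \<psi> assume \<psi>: "\<psi> \<in> ?\<Omega>"
      have "(\<Sum>g\<in>{g \<in> Alt n. lift g = \<psi>}. of_bool (P \<sigma> (lift g)) :: real)
          = (\<Sum>g\<in>{g \<in> Alt n. lift g = \<psi>}. of_bool (P \<sigma> \<psi>))" by (rule sum.cong) auto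
      also have "\<dots> = real (card {g \<in> Alt n. lift g = \<psi>}) * of_bool (P \<sigma> \<psi>)" by (rule sum_constant)
      finally show "(\<Sum>g\<in>{g \<in> Alt n. lift g = \<psi>}. of_bool (P \<sigma> (lift g)))
          = real (card (Alt n)) / real (card ?\<Omega>) * of_bool (P \<sigma> \<psi>)"
        by (simp only: fibre[OF \<psi>])
    qed
    also have "\<dots> = real (card (Alt n)) / real (card ?\<Omega>) * real (card {\<psi> \<in> ?\<Omega>. P \<sigma> \<psi>})"
    proof -
      have "?\<Omega> \<inter> {\<psi>. P \<sigma> \<psi>} = {\<psi> \<in> ?\<Omega>. P \<sigma> \<psi>}" by auto
      then have "(\<Sum>\<psi>\<in>?\<Omega>. of_bool (P \<sigma> \<psi>)) = real (card {\<psi> \<in> ?\<Omega>. P \<sigma> \<psi>})" using fin by simp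
      then show ?thesis by (simp only: sum_distrib_left[symmetric])
    qed
    also have "{\<psi> \<in> ?\<Omega>. P \<sigma> \<psi>} = homs n V E R \<sigma>"
    proof -
      have "?\<Omega> = {\<psi> \<in> V \<rightarrow>\<^sub>E {1..n}. \<forall>(i, j)\<in>R. \<psi> i \<noteq> \<psi> j}"
        using inj0 by (auto simp: same_kernel_def R_def inj_on_def)
      then show ?thesis by (auto simp: homs_def P_def)
    qed
    finally show ?thesis .
  qed
  moreover have "pattern_span n (2 * m) (\<lambda>\<sigma>. real (card (Alt n)) / real (card ?\<Omega>) * real (card (homs n V E R \<sigma>)))"
  proof (rule pattern_span_scale[OF pattern_span_homs[OF V(1,2)]])
    show "E \<subseteq> V \<times> V" using pos zipV by (auto simp: E_def)
    show "R \<subseteq> V \<times> V" by (auto simp: R_def)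
  qed
  ultimately show ?thesis by simp
qed

definition index_pairs :: "nat \<Rightarrow> nat \<Rightarrow> (nat list \<times> nat list) set"
  where "index_pairs n D = {(I, J). length I = length J \<and> length I \<le> D \<and> set I \<subseteq> {1..n} \<and> set J \<subseteq> {1..n}}"

definition low_degree :: "nat \<Rightarrow> nat \<Rightarrow> ((nat \<Rightarrow> nat) \<Rightarrow> real) \<Rightarrow> bool"
  where "low_degree n D F \<longleftrightarrow> (\<exists>a. \<forall>\<sigma>\<in>Alt n.
    F \<sigma> = (\<Sum>p\<in>index_pairs n D. a p * of_bool (map \<sigma> (fst p) = snd p)))"

lemma finite_index_pairs [simp]: "finite (index_pairs n D)"
proof -
  have "index_pairs n D \<subseteq> {I. set I \<subseteq> {1..n} \<and> length I \<le> D} \<times> {I. set I \<subseteq> {1..n} \<and> length I \<le> D}"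
    by (auto simp: index_pairs_def)
  moreover have "finite \<dots>" by (intro finite_cartesian_product finite_lists_length_le) auto
  ultimately show ?thesis by (rule finite_subset)
qed

text \<open>Iteration of the quadratic case, which is why all exponents are powers of two.\<close>

lemma power_mean:
  fixes a :: "'a \<Rightarrow> real"
  assumes W: "finite W" and a: "\<And>x. x \<in> W \<Longrightarrow> 0 \<le> a x"
  shows "((\<Sum>x\<in>W. a x) / card W) ^ 2 ^ s \<le> (\<Sum>x\<in>W. a x ^ 2 ^ s) / card W"
proof (cases "W = {}")
  case False
  then have N: "0 < real (card W)" using W by (simp add: card_gt_0_iff)
  have sq: "((\<Sum>x\<in>W. b x) / card W)\<^sup>2 \<le> (\<Sum>x\<in>W. (b x)\<^sup>2) / card W" for b :: "'a \<Rightarrow> real"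
  proof -
    define \<mu> where "\<mu> = (\<Sum>x\<in>W. b x) / card W"
    have *: "(\<Sum>x\<in>W. b x) = card W * \<mu>" using N by (simp add: \<mu>_def)
    have "0 \<le> (\<Sum>x\<in>W. (b x - \<mu>)\<^sup>2)" by (rule sum_nonneg) simp
    also have "\<dots> = (\<Sum>x\<in>W. (b x)\<^sup>2) - 2 * \<mu> * (\<Sum>x\<in>W. b x) + card W * \<mu>\<^sup>2"
      by (simp add: power2_diff sum.distrib sum_subtractf sum_distrib_left sum_distrib_right algebra_simps)
    also have "\<dots> = (\<Sum>x\<in>W. (b x)\<^sup>2) - card W * \<mu>\<^sup>2"
      unfolding * by (simp add: power2_eq_square)
    finally show ?thesis using N by (simp add: \<mu>_def[symmetric] field_simps)
  qed
  show ?thesis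
  proof (induction s)
    case (Suc s)
    have "((\<Sum>x\<in>W. a x) / card W) ^ 2 ^ Suc s = (((\<Sum>x\<in>W. a x) / card W) ^ 2 ^ s)\<^sup>2"
      by (simp add: mult.commute flip: power_mult)
    also have "\<dots> \<le> ((\<Sum>x\<in>W. a x ^ 2 ^ s) / card W)\<^sup>2"
      using Suc a by (intro power_mono) (auto intro!: zero_le_power divide_nonneg_nonneg sum_nonneg)
    also have "\<dots> \<le> (\<Sum>x\<in>W. (a x ^ 2 ^ s)\<^sup>2) / card W" by (rule sq)
    also have "\<dots> = (\<Sum>x\<in>W. a x ^ 2 ^ Suc s) / card W"
      by (simp add: mult.commute flip: power_mult)
    finally show ?case .
  qed simp
qed (simp add: power_0_left)

lemma sum_Alt_conj: "g \<in> Alt n \<Longrightarrow> (\<Sum>x\<in>Alt n. f (g \<circ> x \<circ> inv' g)) = (\<Sum>x\<in>Alt n. f x)"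
  using sum_Alt_left[of g n "\<lambda>x. f (x \<circ> inv' g)"] sum_Alt_right[of "inv' g" n f] by simp

lemma sum_conj_invariant:
  assumes W: "W \<subseteq> Alt n" "\<And>g x. g \<in> Alt n \<Longrightarrow> x \<in> W \<Longrightarrow> g \<circ> x \<circ> inv' g \<in> W" and g: "g \<in> Alt n"
  shows "(\<Sum>x\<in>W. f (g \<circ> x \<circ> inv' g)) = (\<Sum>x\<in>W. f x)"
proof (rule sum.reindex_bij_witness[where i = "\<lambda>x. inv' g \<circ> x \<circ> g" and j = "\<lambda>x. g \<circ> x \<circ> inv' g"])
  fix x assume x: "x \<in> W"
  show "inv' g \<circ> (g \<circ> x \<circ> inv' g) \<circ> g = x" "g \<circ> (inv' g \<circ> x \<circ> g) \<circ> inv' g = x"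
    using g by (auto simp: fun_eq_iff)
  show "g \<circ> x \<circ> inv' g \<in> W" using W(2) g x by blast
  show "inv' g \<circ> x \<circ> g \<in> W" using W(2)[OF Alt_inv[OF g] x] g by simp
qed simp

text \<open>Squaring \<open>F\<close> joins two conditions of length at most \<open>D\<close>, and a
  conjugated condition involves both its arguments and its values as points; hence
  \<open>4 * D\<close>.\<close>

lemma pattern_span_conj_average:
  assumes F: "low_degree n D F" and n: "4 * D + 2 \<le> n"
  obtains G where "pattern_span n (4 * D) G"
    "\<And>\<sigma>. \<sigma> \<in> Alt n \<Longrightarrow> G \<sigma> = (\<Sum>g\<in>Alt n. (F (g \<circ> \<sigma> \<circ> inv' g))\<^sup>2) / card (Alt n)"
proof -
  let ?P = "index_pairs n D"
  obtain a where a: "\<And>\<sigma>. \<sigma> \<in> Alt n \<Longrightarrow> F \<sigma> = (\<Sum>p\<in>?P. a p * of_bool (map \<sigma> (fst p) = snd p))"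
    using F by (auto simp: low_degree_def)
  define G where "G \<sigma> = (\<Sum>pq\<in>?P \<times> ?P. (a (fst pq) * a (snd pq) / card (Alt n)) *
    (\<Sum>g\<in>Alt n. of_bool (map (g \<circ> \<sigma> \<circ> inv' g) (fst (fst pq) @ fst (snd pq)) = snd (fst pq) @ snd (snd pq))))" for \<sigma>
  have "pattern_span n (2 * (2 * D)) G"
    unfolding G_def
    by (intro pattern_span_sum pattern_span_scale pattern_span_conj_indicator) (use n in \<open>auto simp: index_pairs_def\<close>)
  moreover have "G \<sigma> = (\<Sum>g\<in>Alt n. (F (g \<circ> \<sigma> \<circ> inv' g))\<^sup>2) / card (Alt n)" if \<sigma>: "\<sigma> \<in> Alt n" for \<sigma>
  proof -
    have sq: "(F (g \<circ> \<sigma> \<circ> inv' g))\<^sup>2 = (\<Sum>pq\<in>?P \<times> ?P. (a (fst pq) * a (snd pq)) *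
      of_bool (map (g \<circ> \<sigma> \<circ> inv' g) (fst (fst pq) @ fst (snd pq)) = snd (fst pq) @ snd (snd pq)))"
      if g: "g \<in> Alt n" for g
    proof -
      let ?x = "g \<circ> \<sigma> \<circ> inv' g"
      have "?x \<in> Alt n" using g \<sigma> by simp
      then have "(F ?x)\<^sup>2 = (\<Sum>p\<in>?P. a p * of_bool (map ?x (fst p) = snd p)) *
          (\<Sum>p\<in>?P. a p * of_bool (map ?x (fst p) = snd p))"
        by (simp only: a power2_eq_square)
      also have "\<dots> = (\<Sum>pq\<in>?P \<times> ?P. (a (fst pq) * of_bool (map ?x (fst (fst pq)) = snd (fst pq))) *
          (a (snd pq) * of_bool (map ?x (fst (snd pq)) = snd (snd pq))))"
        unfolding sum_product sum.cartesian_product by (simp only: case_prod_unfold)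
      also have "\<dots> = (\<Sum>pq\<in>?P \<times> ?P. (a (fst pq) * a (snd pq)) *
        of_bool (map ?x (fst (fst pq) @ fst (snd pq)) = snd (fst pq) @ snd (snd pq)))"
      proof (rule sum.cong[OF refl])
        fix pq assume "pq \<in> ?P \<times> ?P"
        then have "length (fst (fst pq)) = length (snd (fst pq))" by (auto simp: index_pairs_def)
        then have "map ?x (fst (fst pq) @ fst (snd pq)) = snd (fst pq) @ snd (snd pq)
            \<longleftrightarrow> map ?x (fst (fst pq)) = snd (fst pq) \<and> map ?x (fst (snd pq)) = snd (snd pq)"
          by simp
        then show "(a (fst pq) * of_bool (map ?x (fst (fst pq)) = snd (fst pq))) *
          (a (snd pq) * of_bool (map ?x (fst (snd pq)) = snd (snd pq))) = (a (fst pq) * a (snd pq)) *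
          of_bool (map ?x (fst (fst pq) @ fst (snd pq)) = snd (fst pq) @ snd (snd pq))"
          by (simp only: of_bool_conj) (simp only: mult_ac)
      qed
      finally show ?thesis .
    qed
    have "(\<Sum>g\<in>Alt n. (F (g \<circ> \<sigma> \<circ> inv' g))\<^sup>2) = (\<Sum>g\<in>Alt n. \<Sum>pq\<in>?P \<times> ?P. (a (fst pq) * a (snd pq)) *
      of_bool (map (g \<circ> \<sigma> \<circ> inv' g) (fst (fst pq) @ fst (snd pq)) = snd (fst pq) @ snd (snd pq)))"
      by (rule sum.cong[OF refl sq])
    also have "\<dots> = (\<Sum>pq\<in>?P \<times> ?P. (a (fst pq) * a (snd pq)) * (\<Sum>g\<in>Alt n.
      of_bool (map (g \<circ> \<sigma> \<circ> inv' g) (fst (fst pq) @ fst (snd pq)) = snd (fst pq) @ snd (snd pq))))"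
      unfolding sum_distrib_left by (rule sum.swap)
    finally show ?thesis
      unfolding G_def by (simp only: sum_divide_distrib times_divide_eq_left)
  qed
  ultimately show ?thesis using that[of G] by simp
qed

text \<open>Since \<open>W\<close> is normal, the square of \<open>F\<close> may be replaced by its
  conjugation average \<open>G\<close>. A high moment of \<open>G\<close> over \<open>W\<close> is
  at most \<open>card (Alt n) / card W\<close> times that over the whole group, and the higher the
  exponent, the less this factor costs once the root is taken.\<close>

lemma normal_second_moment:
  "\<exists>K>0. \<exists>n0. \<forall>n\<ge>n0. \<forall>F W. low_degree n D F \<longrightarrow> W \<subseteq> Alt n \<longrightarrow> W \<noteq> {} \<longrightarrow>
    (\<forall>g\<in>Alt n. \<forall>x\<in>W. g \<circ> x \<circ> inv' g \<in> W) \<longrightarrow>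
    ((\<Sum>x\<in>W. (F x)\<^sup>2) / card W) ^ 2 ^ Suc t
      \<le> K * (card (Alt n) / card W) * mean n (\<lambda>x. (F x)\<^sup>2) ^ 2 ^ Suc t"
proof -
  let ?M = "4 * D"
  obtain K1 where K1: "0 < K1" "\<forall>n\<ge>2 ^ Suc t * ?M + 2. \<forall>f. pattern_span n ?M f \<longrightarrow>
    mean n (\<lambda>x. f x ^ 2 ^ Suc t) \<le> K1 * mean n (\<lambda>x. (f x)\<^sup>2) ^ 2 ^ t"
    using pattern_span_moment_bound[of t ?M] by (elim exE conjE)
  obtain K2 where K2: "0 < K2" "\<forall>n\<ge>4 * ?M + 2. \<forall>f. pattern_span n ?M f \<longrightarrow> (\<forall>x\<in>Alt n. 0 \<le> f x) \<longrightarrow>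
    mean n (\<lambda>x. (f x)\<^sup>2) \<le> K2 * (mean n f)\<^sup>2"
    using pattern_span_nonneg_L2_L1[of ?M] by (elim exE conjE)
  show ?thesis
  proof (intro exI[of _ "K1 * K2 ^ 2 ^ t"] conjI exI[of _ "max (2 ^ Suc t * ?M + 2) (4 * ?M + 2)"] allI impI)
    show "0 < K1 * K2 ^ 2 ^ t" using K1 K2 by simp
    fix n F W assume n: "max (2 ^ Suc t * ?M + 2) (4 * ?M + 2) \<le> n" and F: "low_degree n D F"
      and W: "W \<subseteq> Alt n" "W \<noteq> {}" "\<forall>g\<in>Alt n. \<forall>x\<in>W. g \<circ> x \<circ> inv' g \<in> W"
    have n1: "2 ^ Suc t * ?M + 2 \<le> n" and n2: "4 * ?M + 2 \<le> n" and n3: "4 * D + 2 \<le> n"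
      using n by auto
    obtain G where G: "pattern_span n ?M G"
      "\<And>\<sigma>. \<sigma> \<in> Alt n \<Longrightarrow> G \<sigma> = (\<Sum>g\<in>Alt n. (F (g \<circ> \<sigma> \<circ> inv' g))\<^sup>2) / card (Alt n)"
      using pattern_span_conj_average[OF F n3] by blast
    have G0: "0 \<le> G x" if "x \<in> Alt n" for x using that by (simp add: G(2) sum_nonneg)
    have finW: "finite W" by (rule finite_subset[OF W(1) finite_Alt])
    have avg: "(\<Sum>x\<in>S. G x) = (\<Sum>x\<in>S. (F x)\<^sup>2)"
      if S: "S \<subseteq> Alt n" and inv: "\<And>g. g \<in> Alt n \<Longrightarrow> (\<Sum>x\<in>S. (F (g \<circ> x \<circ> inv' g))\<^sup>2) = (\<Sum>x\<in>S. (F x)\<^sup>2)" for S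
    proof -
      have "(\<Sum>x\<in>S. G x) = (\<Sum>x\<in>S. \<Sum>g\<in>Alt n. (F (g \<circ> x \<circ> inv' g))\<^sup>2) / card (Alt n)"
        unfolding sum_divide_distrib using S G(2) by (intro sum.cong) (auto simp: sum_divide_distrib)
      also have "(\<Sum>x\<in>S. \<Sum>g\<in>Alt n. (F (g \<circ> x \<circ> inv' g))\<^sup>2) = (\<Sum>g\<in>Alt n. \<Sum>x\<in>S. (F (g \<circ> x \<circ> inv' g))\<^sup>2)"
        by (rule sum.swap)
      also have "\<dots> = (\<Sum>g\<in>Alt n. \<Sum>x\<in>S. (F x)\<^sup>2)" by (rule sum.cong[OF refl inv])
      finally show ?thesis by simp
    qed
    have W_avg: "(\<Sum>x\<in>W. G x) = (\<Sum>x\<in>W. (F x)\<^sup>2)"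
      using W(1,3) by (intro avg sum_conj_invariant) auto
    have mean_G: "mean n G = mean n (\<lambda>x. (F x)\<^sup>2)"
      using avg[of "Alt n"] sum_Alt_conj[where f = "\<lambda>x. (F x)\<^sup>2"] by (simp add: mean_def)
    have N: "0 < real (card W)" using finW W(2) by (simp add: card_gt_0_iff)
    have "((\<Sum>x\<in>W. (F x)\<^sup>2) / card W) ^ 2 ^ Suc t \<le> (\<Sum>x\<in>W. G x ^ 2 ^ Suc t) / card W"
      unfolding W_avg[symmetric] using finW G0 W(1) by (intro power_mean) auto
    also have "\<dots> \<le> (\<Sum>x\<in>Alt n. G x ^ 2 ^ Suc t) / card W"
      using W(1) G0 by (intro divide_right_mono sum_mono2) auto
    also have "\<dots> = (card (Alt n) / card W) * mean n (\<lambda>x. G x ^ 2 ^ Suc t)"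
      by (simp add: mean_def)
    also have "\<dots> \<le> (card (Alt n) / card W) * (K1 * mean n (\<lambda>x. (G x)\<^sup>2) ^ 2 ^ t)"
      using K1(2)[rule_format, OF n1 G(1)] by (intro mult_left_mono) auto
    also have "\<dots> \<le> (card (Alt n) / card W) * (K1 * (K2 * (mean n G)\<^sup>2) ^ 2 ^ t)"
      using K2(2)[rule_format, OF n2 G(1)] G0 K1(1)
      by (intro mult_left_mono power_mono mean_nonneg) auto
    also have "\<dots> = K1 * K2 ^ 2 ^ t * (card (Alt n) / card W) * mean n (\<lambda>x. (F x)\<^sup>2) ^ 2 ^ Suc t"
      by (simp add: mean_G power_mult_distrib power_mult)
    finally show "((\<Sum>x\<in>W. (F x)\<^sup>2) / card W) ^ 2 ^ Suc t
      \<le> K1 * K2 ^ 2 ^ t * (card (Alt n) / card W) * mean n (\<lambda>x. (F x)\<^sup>2) ^ 2 ^ Suc t" .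
  qed
qed

section \<open>Counting products of three elements\<close>

text \<open>Gram-Schmidt: the earlier \<open>b t\<close> are removed from both \<open>f\<close> and
  \<open>b s\<close>, and the first remainder \<open>p\<close> is then projected on the second
  remainder \<open>q\<close>.\<close>

lemma orthogonal_projection:
  assumes "finite T"
  shows "\<exists>c. \<forall>t\<in>T. ip n (\<lambda>x. f x - (\<Sum>t\<in>T. c t * b t x)) (b t) = 0"
  using assms
proof (induction T arbitrary: f)
  case (insert s T)
  obtain c where c: "\<And>t. t \<in> T \<Longrightarrow> ip n (\<lambda>x. f x - (\<Sum>t\<in>T. c t * b t x)) (b t) = 0"
    using insert.IH[of f] by blast
  obtain d where d: "\<And>t. t \<in> T \<Longrightarrow> ip n (\<lambda>x. b s x - (\<Sum>t\<in>T. d t * b t x)) (b t) = 0"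
    using insert.IH[of "b s"] by blast
  define p where "p = (\<lambda>x. f x - (\<Sum>t\<in>T. c t * b t x))"
  define q where "q = (\<lambda>x. b s x - (\<Sum>t\<in>T. d t * b t x))"
  \<comment> \<open>If \<open>q\<close> vanishes on \<open>Alt n\<close>, this is a division by zero
    with value 0, and \<open>p\<close> is orthogonal to \<open>q\<close> anyway.\<close>
  define e where "e = ip n p q / ip n q q"
  define c' where "c' t = (if t = s then e else c t - e * d t)" for t
  have res: "f x - (\<Sum>t\<in>insert s T. c' t * b t x) = p x - e * q x" for x
  proof -
    have "(\<Sum>t\<in>T. c' t * b t x) = (\<Sum>t\<in>T. (c t - e * d t) * b t x)"
      using insert.hyps(2) by (intro sum.cong) (auto simp: c'_def)
    also have "\<dots> = (\<Sum>t\<in>T. c t * b t x) - e * (\<Sum>t\<in>T. d t * b t x)"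
      by (simp add: sum_subtractf sum_distrib_left algebra_simps)
    finally show ?thesis using insert.hyps by (simp add: c'_def p_def q_def algebra_simps)
  qed
  have T: "ip n (\<lambda>x. p x - e * q x) (b t) = 0" if "t \<in> T" for t
    using c[OF that] d[OF that] by (simp add: ip_linear p_def[symmetric] q_def[symmetric])
  have pq: "ip n p q - e * ip n q q = 0"
  proof (cases "ip n q q = 0")
    case True
    then have "ip n p q = 0" by (simp add: ip_def[of n p q] ip_eq_0_iff)
    then show ?thesis using True by simp
  qed (simp add: e_def)
  have "ip n (\<lambda>x. p x - e * q x) (b s) = 0"
  proof -
    have bs: "b s = (\<lambda>x. q x + (\<Sum>t\<in>T. d t * b t x))" by (simp add: q_def)
    have "ip n (\<lambda>x. p x - e * q x) (\<lambda>x. \<Sum>t\<in>T. d t * b t x) = 0"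
      unfolding ip_sum_right ip_scale_right using T by simp
    moreover have "ip n (\<lambda>x. p x - e * q x) q = 0" using pq by (simp add: ip_linear)
    ultimately show ?thesis by (subst bs) (simp only: ip_add_right)
  qed
  then have "\<forall>t\<in>insert s T. ip n (\<lambda>x. f x - (\<Sum>t\<in>insert s T. c' t * b t x)) (b t) = 0"
    unfolding res using T by simp
  then show ?case by blast
qed simp

lemma low_degree_projection:
  obtains F where "low_degree n D F" "perp n D (\<lambda>x. f x - F x)"
proof -
  define b where "b p = (\<lambda>x. of_bool (map x (fst p) = snd p) :: real)" for p :: "nat list \<times> nat list"
  obtain c where c: "\<And>p. p \<in> index_pairs n D \<Longrightarrow>
      ip n (\<lambda>x. f x - (\<Sum>p\<in>index_pairs n D. c p * b p x)) (b p) = 0"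
    using orthogonal_projection[OF finite_index_pairs, of n D n f b] by blast
  define F where "F = (\<lambda>x. \<Sum>p\<in>index_pairs n D. c p * b p x)"
  have "low_degree n D F" unfolding low_degree_def F_def b_def by blast
  moreover have "perp n D (\<lambda>x. f x - F x)"
    unfolding perp_def
  proof (intro allI impI)
    fix I J :: "nat list" assume I: "length I \<le> D" "set I \<subseteq> {1..n}"
    show "(\<Sum>x\<in>{x \<in> Alt n. map x I = J}. f x - F x) = 0"
    proof (cases "(I, J) \<in> index_pairs n D")
      case True
      have "(\<Sum>x\<in>{x \<in> Alt n. map x I = J}. f x - F x) = ip n (\<lambda>x. f x - F x) (b (I, J))"
        unfolding ip_def b_def by (intro sum.mono_neutral_cong_left) auto
      then show ?thesis using c[OF True] by (simp add: F_def)
    next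
      case False
      have "{x \<in> Alt n. map x I = J} = {}"
      proof (rule ccontr)
        assume "\<not> ?thesis"
        then obtain x where x: "x \<in> Alt n" "J = map x I" by blast
        have "x i \<in> {1..n}" if "i \<in> set I" for i using Alt_image_eq[OF x(1), of i] I(2) that by blast
        then have "(I, J) \<in> index_pairs n D" using I x(2) by (auto simp: index_pairs_def)
        then show False using False by blast
      qed
      then show ?thesis by (simp only: sum.empty)
    qed
  qed
  ultimately show ?thesis by (rule that)
qed

text \<open>The condition \<open>map (p \<circ> inv' z \<circ> q) I = J\<close> prescribes
  \<open>z\<close> at the images of \<open>J\<close> under \<open>inv' p\<close>, again at most
  \<open>D\<close> points. So low degree survives inversion and two-sided translation.\<close>

lemma perp_low_degree:
  assumes F: "low_degree n D F" and f: "perp n D f" and pq: "p \<in> Alt n" "q \<in> Alt n"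
  shows "(\<Sum>z\<in>Alt n. f z * F (p \<circ> inv' z \<circ> q)) = 0"
proof -
  obtain a where a: "\<And>\<sigma>. \<sigma> \<in> Alt n \<Longrightarrow>
    F \<sigma> = (\<Sum>r\<in>index_pairs n D. a r * of_bool (map \<sigma> (fst r) = snd r))"
    using F by (auto simp: low_degree_def)
  have iff: "map (p \<circ> inv' z \<circ> q) I = J \<longleftrightarrow> map z (map (inv' p) J) = map q I" if z: "z \<in> Alt n" for z I J
  proof
    assume "map (p \<circ> inv' z \<circ> q) I = J"
    then have "map z (map (inv' p) J) = map (\<lambda>i. z (inv' p (p (inv' z (q i))))) I" by auto
    then show "map z (map (inv' p) J) = map q I"
      by (simp add: Alt_inv_simps[OF z] Alt_inv_simps[OF pq(1)])
  next
    assume "map z (map (inv' p) J) = map q I"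
    then have "map (p \<circ> inv' z) (map q I) = map (p \<circ> inv' z) (map z (map (inv' p) J))" by simp
    then show "map (p \<circ> inv' z \<circ> q) I = J"
      by (simp add: o_def Alt_inv_simps[OF z] Alt_inv_simps[OF pq(1)])
  qed
  have "(\<Sum>z\<in>Alt n. f z * F (p \<circ> inv' z \<circ> q))
      = (\<Sum>z\<in>Alt n. \<Sum>r\<in>index_pairs n D. a r * (f z * of_bool (map z (map (inv' p) (snd r)) = map q (fst r))))"
  proof (rule sum.cong[OF refl])
    fix z assume z: "z \<in> Alt n"
    then have "p \<circ> inv' z \<circ> q \<in> Alt n" using pq by simp
    then show "f z * F (p \<circ> inv' z \<circ> q)
      = (\<Sum>r\<in>index_pairs n D. a r * (f z * of_bool (map z (map (inv' p) (snd r)) = map q (fst r))))"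
      unfolding a[OF \<open>p \<circ> inv' z \<circ> q \<in> Alt n\<close>] iff[OF z] sum_distrib_left by (simp only: mult_ac)
  qed
  also have "\<dots> = (\<Sum>r\<in>index_pairs n D. a r * (\<Sum>z\<in>Alt n. f z * of_bool (map z (map (inv' p) (snd r)) = map q (fst r))))"
    unfolding sum_distrib_left by (rule sum.swap)
  also have "\<dots> = 0"
  proof (intro sum.neutral ballI)
    fix r assume "r \<in> index_pairs n D"
    then have r: "length (snd r) \<le> D" "set (snd r) \<subseteq> {1..n}" by (auto simp: index_pairs_def)
    let ?I = "map (inv' p) (snd r)"
    have I: "length ?I \<le> D" "set ?I \<subseteq> {1..n}"
      using r Alt_image_eq[OF Alt_inv[OF pq(1)]] by auto
    have "(\<Sum>z\<in>Alt n. f z * of_bool (map z ?I = map q (fst r))) = (\<Sum>z\<in>{z \<in> Alt n. map z ?I = map q (fst r)}. f z)"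
      by (intro sum.mono_neutral_cong_right) auto
    also have "\<dots> = 0" using f I unfolding perp_def by blast
    finally show "a r * (\<Sum>z\<in>Alt n. f z * of_bool (map z ?I = map q (fst r))) = 0" by simp
  qed
  finally show ?thesis .
qed

lemma perp_sum: "perp n m f \<Longrightarrow> (\<Sum>x\<in>Alt n. f x) = 0"
  unfolding perp_def by (drule spec[of _ "[]"], drule spec[of _ "[]"]) simp

lemma sum_Alt_conv: "(\<Sum>x\<in>Alt n. conv n f g x) = (\<Sum>x\<in>Alt n. f x) * (\<Sum>x\<in>Alt n. g x)"
proof -
  have "(\<Sum>x\<in>Alt n. conv n f g x) = (\<Sum>y\<in>Alt n. \<Sum>x\<in>Alt n. f (x \<circ> inv' y) * g y)"
    unfolding conv_def by (rule sum.swap)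
  also have "\<dots> = (\<Sum>y\<in>Alt n. (\<Sum>x\<in>Alt n. f x) * g y)"
    using sum_Alt_right[OF Alt_inv, of _ n f] by (intro sum.cong) (simp_all flip: sum_distrib_right)
  finally show ?thesis by (simp add: sum_distrib_left)
qed

lemma sum_reflect: "h \<in> Alt n \<Longrightarrow> (\<Sum>x\<in>Alt n. f (inv' x \<circ> h)) = (\<Sum>x\<in>Alt n. f x)"
  using sum_Alt_inv[of "\<lambda>x. f (x \<circ> h)" n] sum_Alt_right[of h n f] by simp

lemma conv_sum_left: "x \<in> Alt n \<Longrightarrow> (\<Sum>y\<in>Alt n. f (x \<circ> inv' y)) = (\<Sum>y\<in>Alt n. f y)"
  using sum_Alt_inv[of "\<lambda>y. f (x \<circ> y)" n] sum_Alt_left[of x n f] by simp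

text \<open>In terms of \<open>z = x \<circ> inv' y\<close> the convolution pairs \<open>f\<close>
  with a translate of the inverted \<open>F\<close>, to which \<open>perp_low_degree\<close>
  applies.\<close>

lemma conv_perp_low_degree:
  assumes F: "low_degree n D F" and f: "perp n D f" and x: "x \<in> Alt n"
  shows "conv n f F x = 0"
proof -
  have "conv n f F x = (\<Sum>y\<in>Alt n. f (x \<circ> inv' y) * F (inv' (x \<circ> inv' y) \<circ> x))"
    unfolding conv_def
  proof (rule sum.cong[OF refl])
    fix y assume y: "y \<in> Alt n"
    have "inv' (x \<circ> inv' y) \<circ> x = y"
      using Alt_inv_comp[OF x Alt_inv[OF y]] x y by (simp add: comp_assoc Alt_inv_o)
    then show "f (x \<circ> inv' y) * F y = f (x \<circ> inv' y) * F (inv' (x \<circ> inv' y) \<circ> x)" by simp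
  qed
  also have "\<dots> = (\<Sum>z\<in>Alt n. f z * F (inv' z \<circ> x))"
    by (rule conv_sum_left[OF x, of "\<lambda>z. f z * F (inv' z \<circ> x)"])
  also have "\<dots> = 0" using perp_low_degree[OF F f Alt_id x] by simp
  finally show ?thesis .
qed

text \<open>Removes the mixed term in which the third factor is the high-degree part and the first
  one has low degree.\<close>

lemma conv_reflect_perp_low_degree:
  assumes F: "low_degree n D F" and f: "perp n D f" and h: "h \<in> Alt n"
  shows "ip n (conv n F g) (\<lambda>x. f (inv' x \<circ> h)) = 0"
proof -
  have 0: "(\<Sum>x\<in>Alt n. F (x \<circ> inv' y) * f (inv' x \<circ> h)) = 0" if y: "y \<in> Alt n" for y
  proof -
    have "(\<Sum>x\<in>Alt n. F (x \<circ> inv' y) * f (inv' x \<circ> h))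
        = (\<Sum>x\<in>Alt n. f (inv' x \<circ> h) * F (h \<circ> inv' (inv' x \<circ> h) \<circ> inv' y))"
    proof (rule sum.cong[OF refl])
      fix x assume x: "x \<in> Alt n"
      have "h \<circ> inv' (inv' x \<circ> h) = x"
        using Alt_inv_comp[OF Alt_inv[OF x] h] x h by (simp add: comp_assoc[symmetric] Alt_inv_o)
      then show "F (x \<circ> inv' y) * f (inv' x \<circ> h) = f (inv' x \<circ> h) * F (h \<circ> inv' (inv' x \<circ> h) \<circ> inv' y)"
        by simp
    qed
    also have "\<dots> = (\<Sum>z\<in>Alt n. f z * F (h \<circ> inv' z \<circ> inv' y))"
      by (rule sum_reflect[OF h, of "\<lambda>z. f z * F (h \<circ> inv' z \<circ> inv' y)"])
    also have "\<dots> = 0" by (rule perp_low_degree[OF F f h Alt_inv[OF y]])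
    finally show ?thesis .
  qed
  have "ip n (conv n F g) (\<lambda>x. f (inv' x \<circ> h))
      = (\<Sum>x\<in>Alt n. \<Sum>y\<in>Alt n. g y * (F (x \<circ> inv' y) * f (inv' x \<circ> h)))"
    unfolding ip_def conv_def sum_distrib_right by (simp only: mult_ac)
  also have "\<dots> = (\<Sum>y\<in>Alt n. g y * (\<Sum>x\<in>Alt n. F (x \<circ> inv' y) * f (inv' x \<circ> h)))"
    unfolding sum_distrib_left by (rule sum.swap)
  also have "\<dots> = 0" using 0 by simp
  finally show ?thesis .
qed

lemma conv_lincomb_right: "conv n f (\<lambda>x. g x + h x) x = conv n f g x + conv n f h x"
  by (simp add: conv_def distrib_left sum.distrib)

lemma conv_lincomb_left: "conv n (\<lambda>x. g x + h x) f x = conv n g f x + conv n h f x"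
  by (simp add: conv_def distrib_right sum.distrib)

lemma low_degree_add_const:
  assumes "low_degree n D F" shows "low_degree n D (\<lambda>x. F x + c)"
proof -
  obtain a where a: "\<And>\<sigma>. \<sigma> \<in> Alt n \<Longrightarrow>
    F \<sigma> = (\<Sum>r\<in>index_pairs n D. a r * of_bool (map \<sigma> (fst r) = snd r))"
    using assms by (auto simp: low_degree_def)
  have nil: "([], []) \<in> index_pairs n D" by (simp add: index_pairs_def)
  have "F \<sigma> + c = (\<Sum>r\<in>index_pairs n D. (a r + c * of_bool (r = ([], []))) * of_bool (map \<sigma> (fst r) = snd r))"
    if "\<sigma> \<in> Alt n" for \<sigma>
  proof -
    have "(\<Sum>r\<in>index_pairs n D. c * of_bool (r = ([], [])) * of_bool (map \<sigma> (fst r) = snd r))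
        = (\<Sum>r\<in>index_pairs n D. if r = ([], []) then c else 0)"
      by (rule sum.cong) auto
    also have "\<dots> = c" using nil by simp
    finally show ?thesis by (simp add: a[OF that] distrib_right sum.distrib)
  qed
  then show ?thesis
    unfolding low_degree_def by (intro exI[of _ "\<lambda>r. a r + c * of_bool (r = ([], []))"] ballI)
qed

text \<open>
  Only the low-degree parts of the three factors interact, except for a remainder that is controlled
  by the high-degree part of a single factor.
\<close>

lemma triple_convolution:
  fixes m :: real
  assumes F: "low_degree n D F" and perp: "perp n D (\<lambda>x. f x - F x)" and h: "h \<in> Alt n"
  defines "m \<equiv> mean n f" and "r \<equiv> \<lambda>g x. g (inv' x \<circ> h)"
  defines "l \<equiv> \<lambda>x. F x - m" and "u \<equiv> \<lambda>x. f x - F x"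
  shows "ip n (conv n f f) (r f)
      = card (Alt n) ^ 2 * m ^ 3 + ip n (conv n f u) (r f) + ip n (conv n l l) (r l)"
    and "perp n 0 l" and "ip n l l \<le> ip n F F" and "ip n F F = ip n f F" and "ip n u u \<le> ip n f f"
    and "ip n (r f) (r f) = ip n f f" and "ip n (r l) (r l) = ip n l l"
proof -
  have u: "perp n D u" using perp by (simp add: u_def)
  have l: "low_degree n D l" using low_degree_add_const[OF F, of "- m"] by (simp add: l_def)
  have sum_u: "(\<Sum>x\<in>Alt n. u x) = 0" by (rule perp_sum[OF u])
  then have "(\<Sum>x\<in>Alt n. F x) = (\<Sum>x\<in>Alt n. f x)" by (simp add: u_def sum_subtractf)
  then have sum_l: "(\<Sum>x\<in>Alt n. l x) = 0"
    by (simp add: l_def sum_subtractf m_def mean_def)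
  have sum_f: "(\<Sum>x\<in>Alt n. f x) = card (Alt n) * m" by (simp add: m_def mean_def)
  show "perp n 0 l"
    unfolding perp_def using sum_l by (auto simp: Collect_conj_eq)
  have f_split: "f = (\<lambda>x. (m + l x) + u x)" by (simp add: l_def u_def)
  have conv_const: "conv n f (\<lambda>_. m) x = m * (card (Alt n) * m)" if "x \<in> Alt n" for x
    using conv_sum_left[OF that, of f] by (simp add: conv_def sum_f flip: sum_distrib_right)
  \<comment> \<open>Against \<open>l\<close> the constant part of the left factor sums to zero, and
    its high-degree part vanishes by orthogonality.\<close>
  have conv_l: "conv n f l x = conv n l l x" if x: "x \<in> Alt n" for x
  proof -
    have "conv n f l x = conv n (\<lambda>_. m) l x + conv n l l x + conv n u l x"
      by (subst f_split) (simp only: conv_lincomb_left)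
    moreover have "conv n u l x = 0" by (rule conv_perp_low_degree[OF l u x])
    moreover have "conv n (\<lambda>_. m) l x = 0" using sum_l by (simp add: conv_def flip: sum_distrib_left)
    ultimately show ?thesis by simp
  qed
  \<comment> \<open>The term with \<open>u\<close> as middle factor is not split any further; it
    will be bounded as a whole.\<close>
  have conv_f: "conv n f f x = m * (card (Alt n) * m) + conv n l l x + conv n f u x" if "x \<in> Alt n" for x
  proof -
    have "conv n f f x = conv n f (\<lambda>x. (m + l x) + u x) x" using f_split by metis
    also have "\<dots> = conv n f (\<lambda>_. m) x + conv n f l x + conv n f u x" by (simp only: conv_lincomb_right)
    finally show ?thesis using conv_const[OF that] conv_l[OF that] by simp
  qed
  have sum_r: "(\<Sum>x\<in>Alt n. r g x) = (\<Sum>x\<in>Alt n. g x)" for g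
    unfolding r_def by (rule sum_reflect[OF h])
  have "ip n (conv n f f) (r f)
      = ip n (\<lambda>x. m * (card (Alt n) * m) + conv n l l x + conv n f u x) (r f)"
    by (rule ip_cong) (use conv_f in auto)
  also have "\<dots> = ip n (\<lambda>x. m * (card (Alt n) * m)) (r f) + ip n (conv n l l) (r f) + ip n (conv n f u) (r f)"
    by (simp only: ip_add_left)
  also have "ip n (\<lambda>x. m * (card (Alt n) * m)) (r f) = card (Alt n) ^ 2 * m ^ 3"
    using sum_r[of f] by (simp add: ip_def sum_f power2_eq_square power3_eq_cube flip: sum_distrib_left)
  also have "ip n (conv n l l) (r f) = ip n (conv n l l) (r l)"
  proof -
    have "r f = (\<lambda>x. m + r l x + r u x)" by (simp add: r_def l_def u_def)
    then have "ip n (conv n l l) (r f) = ip n (conv n l l) (\<lambda>_. m) + ip n (conv n l l) (r l) + ip n (conv n l l) (r u)"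
      by (simp only: ip_add_right)
    moreover have "ip n (conv n l l) (\<lambda>_. m) = 0"
      using sum_Alt_conv[of n l l] sum_l by (simp add: ip_def flip: sum_distrib_right)
    moreover have "ip n (conv n l l) (r u) = 0"
      unfolding r_def by (rule conv_reflect_perp_low_degree[OF l u h])
    ultimately show ?thesis by simp
  qed
  finally show "ip n (conv n f f) (r f)
      = card (Alt n) ^ 2 * m ^ 3 + ip n (conv n f u) (r f) + ip n (conv n l l) (r l)" by simp
  have uF: "ip n u F = 0"
  proof -
    obtain a where a: "\<And>\<sigma>. \<sigma> \<in> Alt n \<Longrightarrow>
      F \<sigma> = (\<Sum>r\<in>index_pairs n D. a r * of_bool (map \<sigma> (fst r) = snd r))"
      using F by (auto simp: low_degree_def)
    have "ip n u F = ip n u (\<lambda>\<sigma>. \<Sum>r\<in>index_pairs n D. a r * of_bool (map \<sigma> (fst r) = snd r))"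
      by (rule ip_cong) (simp_all add: a)
    also have "\<dots> = (\<Sum>r\<in>index_pairs n D. a r * ip n u (\<lambda>\<sigma>. of_bool (map \<sigma> (fst r) = snd r)))"
      by (simp only: ip_sum_right ip_scale_right)
    also have "\<dots> = 0"
    proof (intro sum.neutral ballI)
      fix r assume "r \<in> index_pairs n D"
      then have r: "length (fst r) \<le> D" "set (fst r) \<subseteq> {1..n}" by (auto simp: index_pairs_def)
      have "ip n u (\<lambda>\<sigma>. of_bool (map \<sigma> (fst r) = snd r)) = (\<Sum>x\<in>{x \<in> Alt n. map x (fst r) = snd r}. u x)"
        unfolding ip_def by (intro sum.mono_neutral_cong_right) auto
      also have "\<dots> = 0" using u r unfolding perp_def by blast
      finally show "a r * ip n u (\<lambda>\<sigma>. of_bool (map \<sigma> (fst r) = snd r)) = 0" by simp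
    qed
    finally show ?thesis .
  qed
  then show "ip n F F = ip n f F" by (simp add: u_def ip_diff_left)
  have "ip n f f = ip n (\<lambda>x. u x + F x) (\<lambda>x. u x + F x)" by (simp add: u_def)
  also have "\<dots> = ip n u u + ip n F F" using uF by (simp add: ip_linear ip_sym[of n F u])
  finally show "ip n u u \<le> ip n f f" using ip_nonneg[of n F] by linarith
  have "ip n F F = ip n (\<lambda>x. l x + m) (\<lambda>x. l x + m)" by (simp add: l_def)
  also have "\<dots> = ip n l l + 2 * ip n l (\<lambda>_. m) + ip n (\<lambda>_. m) (\<lambda>_. m)"
    by (simp add: ip_linear ip_sym[of n "\<lambda>_. m" l])
  also have "ip n l (\<lambda>_. m) = 0" using sum_l by (simp add: ip_def flip: sum_distrib_right)
  finally show "ip n l l \<le> ip n F F" using ip_nonneg[of n "\<lambda>_. m"] by linarith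
  show "ip n (r f) (r f) = ip n f f" "ip n (r l) (r l) = ip n l l"
    using sum_reflect[OF h, of "\<lambda>x. f x * f x"] sum_reflect[OF h, of "\<lambda>x. l x * l x"]
    by (simp_all add: ip_def r_def)
qed

section \<open>The final estimates\<close>

lemma abs_less_half:
  fixes N x y B :: real
  assumes "0 < N" "N * x\<^sup>2 \<le> B" "4 * B < N * y\<^sup>2" "0 < y"
  shows "\<bar>x\<bar> < y / 2"
proof -
  have "N * (4 * x\<^sup>2) < N * y\<^sup>2" using assms(2,3) by linarith
  then have "4 * x\<^sup>2 < y\<^sup>2" using assms(1) by simp
  then have "\<bar>x\<bar>\<^sup>2 < (y / 2)\<^sup>2" by (simp add: power_divide)
  then show ?thesis using assms(4) power2_less_imp_less by fastforce
qed

text \<open>By orthogonality the squared norm of \<open>F\<close> is its pairing with the indicator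
  of \<open>A\<close>, so only the values on \<open>A\<close> matter, hence on \<open>W\<close>.
  Cauchy-Schwarz bounds its square by \<open>card A\<close> times the sum of squares over
  \<open>W\<close>, which the moment hypothesis returns to the norm of \<open>F\<close> itself; one
  factor then cancels.\<close>

lemma low_part_bound:
  fixes n C t :: nat and K :: real
  assumes W: "W \<subseteq> Alt n" "W \<noteq> {}" and A: "A \<subseteq> W"
    and moment: "((\<Sum>x\<in>W. (F x)\<^sup>2) / card W) ^ 2 ^ Suc t
      \<le> K * (card (Alt n) / card W) * mean n (\<lambda>x. (F x)\<^sup>2) ^ 2 ^ Suc t"
    and K: "0 < K" "K \<le> n" "1 \<le> n" and dens: "card (Alt n) \<le> card W * n ^ C"
    and t: "32 * (C + 1) \<le> (2::nat) ^ Suc t"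
    and F: "ip n F F = ip n (indicator A) F"
  shows "ip n F F \<le> card A * card W * n powr (1/32) / card (Alt n)"
proof -
  let ?g = "real (card (Alt n))" and ?f = "indicator A :: _ \<Rightarrow> real" and ?q = "2 ^ Suc t :: nat"
  define M where "M = mean n (\<lambda>x. (F x)\<^sup>2)"
  have M: "M = ip n F F / ?g" "0 \<le> M"
    by (simp_all add: M_def mean_def ip_def power2_eq_square sum_nonneg)
  have finW: "finite W" by (rule finite_subset[OF W(1) finite_Alt])
  then have \<omega>: "0 < real (card W)" using W(2) by (simp add: card_gt_0_iff)
  have "?g / card W \<le> real n ^ C"
    using dens \<omega> by (simp add: divide_le_eq mult.commute flip: of_nat_power of_nat_mult)
  then have "K * (?g / card W) \<le> n * real n ^ C"
    using K by (intro mult_mono) auto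
  also have "\<dots> = n powr real (C + 1)"
    using powr_realpow[of "real n" "C + 1"] K(3) by (simp del: of_nat_add)
  \<comment> \<open>The exponent \<open>?q\<close> is so large that \<open>n ^ (C + 1)\<close>, with
    one power of \<open>n\<close> spent on \<open>K\<close>, has a \<open>?q\<close>-th root of at
    most \<open>n powr (1/32)\<close>.\<close>
  also have "\<dots> \<le> n powr (real ?q / 32)"
  proof (rule powr_mono)
    have "32 * (real C + 1) \<le> real ?q" using t by (simp flip: of_nat_le_iff[where 'a = real])
    then show "real (C + 1) \<le> real ?q / 32" by simp
  qed (use K in simp)
  also have "\<dots> = (n powr (1/32)) ^ ?q" using K(3) by (simp add: powr_powr flip: powr_realpow)
  finally have "K * (?g / card W) * M ^ ?q \<le> (n powr (1/32)) ^ ?q * M ^ ?q"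
    by (rule mult_right_mono) (simp add: M)
  then have "((\<Sum>x\<in>W. (F x)\<^sup>2) / card W) ^ ?q \<le> (n powr (1/32) * M) ^ ?q"
    using moment by (simp add: M_def power_mult_distrib)
  then have "(\<Sum>x\<in>W. (F x)\<^sup>2) / card W \<le> n powr (1/32) * M"
    by (rule power_mono_iff[THEN iffD1, rotated 3]) (use M(2) in \<open>auto intro!: divide_nonneg_nonneg sum_nonneg\<close>)
  then have S: "(\<Sum>x\<in>W. (F x)\<^sup>2) \<le> card W * (n powr (1/32) * M)"
    using \<omega> by (simp add: divide_le_eq mult.commute)
  have finA: "finite A" "A \<subseteq> Alt n" using A W(1) finW finite_subset by auto
  have ff: "ip n ?f ?f = card A"
    using finA by (simp add: ip_def indicator_def Int_absorb1 flip: of_bool_conj)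
  have "(ip n ?f F)\<^sup>2 = (ip n ?f (\<lambda>x. ?f x * F x))\<^sup>2"
    by (intro arg_cong[of _ _ "\<lambda>x. x\<^sup>2"]) (simp add: ip_def indicator_def)
  also have "\<dots> \<le> card A * ip n (\<lambda>x. ?f x * F x) (\<lambda>x. ?f x * F x)"
    using ip_Cauchy[of n ?f "\<lambda>x. ?f x * F x"] by (simp only: ff)
  also have "ip n (\<lambda>x. ?f x * F x) (\<lambda>x. ?f x * F x) = (\<Sum>x\<in>A. (F x)\<^sup>2)"
    unfolding ip_def using finA
    by (intro sum.mono_neutral_cong_right) (auto simp: indicator_def power2_eq_square)
  also have "card A * (\<Sum>x\<in>A. (F x)\<^sup>2) \<le> card A * (\<Sum>x\<in>W. (F x)\<^sup>2)"
    using A finW by (intro mult_left_mono sum_mono2) auto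
  also have "\<dots> \<le> card A * (card W * (n powr (1/32) * M))"
    using S by (intro mult_left_mono) auto
  finally have *: "ip n F F * ip n F F \<le> (card A * card W * n powr (1/32) / ?g) * ip n F F"
    by (simp add: F[symmetric] M(1) power2_eq_square mult_ac)
  show ?thesis
  proof (cases "ip n F F = 0")
    case False
    then have "0 < ip n F F" using ip_nonneg[of n F] by linarith
    then show ?thesis using * by (simp only: mult_le_cancel_right_pos)
  qed simp
qed

theorem theorem1p4:
  fixes k :: nat and r :: "nat \<Rightarrow> nat" and w :: "nat \<Rightarrow> letter list"
  assumes "k \<ge> 1"
    and "\<And>i. i \<in> {1..k} \<Longrightarrow> w i \<in> carrier (free_group (r i))"
    and "\<And>i. i \<in> {1..k} \<Longrightarrow> w i \<noteq> \<one>\<^bsub>free_group (r i)\<^esub>"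
  shows "\<exists>N::nat. \<forall>n\<ge>N. \<forall>A.
    A \<subseteq> (\<Inter>i\<in>{1..k}. word_image (alt_group n) (r i) (w i)) \<and>
    real (card A) \<ge>
      real n powr (-1/4) * real (card (\<Inter>i\<in>{1..k}. word_image (alt_group n) (r i) (w i)))
    \<longrightarrow> A <#>\<^bsub>alt_group n\<^esub> A <#>\<^bsub>alt_group n\<^esub> A = carrier (alt_group n)"
proof -
  define W where "W n = (\<Inter>i\<in>{1..k}. word_image (alt_group n) (r i) (w i))" for n
  note density = word_intersection_density[where k = k and r = r and w = w, OF assms(2,3,1), folded W_def]
  obtain C N1 where N1: "\<And>n. N1 \<le> n \<Longrightarrow> W n \<noteq> {} \<and> card (Alt n) \<le> card (W n) * n ^ C"
    using density(3) by blast
  \<comment> \<open>For the high-degree error a gain of order \<open>n ^ j\<close> has to outweigh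
    \<open>(g / a) ^ 3\<close>, which is at most \<open>n ^ (3 * C + 3)\<close>; one further power
    of \<open>n\<close> absorbs the constants.\<close>
  define j where "j = 3 * C + 4"
  define D where "D = 4 * (j - 1)"
  \<comment> \<open>Since \<open>t < 2 ^ t\<close>, this makes \<open>2 ^ Suc t\<close> exceed
    \<open>32 * (C + 1)\<close>, as \<open>low_part_bound\<close> requires.\<close>
  define t where "t = 32 * (C + 1)"
  have j: "1 \<le> j" by (simp add: j_def)
  obtain K N2 where K: "0 < K" and N2: "\<forall>n\<ge>N2. \<forall>F W. low_degree n D F \<longrightarrow> W \<subseteq> Alt n \<longrightarrow> W \<noteq> {} \<longrightarrow>
    (\<forall>g\<in>Alt n. \<forall>x\<in>W. g \<circ> x \<circ> inv' g \<in> W) \<longrightarrow>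
    ((\<Sum>x\<in>W. (F x)\<^sup>2) / card W) ^ 2 ^ Suc t
      \<le> K * (card (Alt n) / card W) * mean n (\<lambda>x. (F x)\<^sup>2) ^ 2 ^ Suc t"
    using normal_second_moment[of D t] by (elim exE conjE)
  obtain N3 where N3: "\<forall>n\<ge>N3. \<forall>f g. perp n (4 * (1 - 1)) g \<longrightarrow>
    (real n / (8 * real 1)) ^ 1 * ip n (conv n f g) (conv n f g) \<le> card (Alt n) * ip n f f * ip n g g"
    using conv_perp_bound[OF order_refl] by (elim exE)
  obtain N4 where N4: "\<forall>n\<ge>N4. \<forall>f g. perp n (4 * (j - 1)) g \<longrightarrow>
    (real n / (8 * real j)) ^ j * ip n (conv n f g) (conv n f g) \<le> card (Alt n) * ip n f f * ip n g g"
    using conv_perp_bound[OF j] by (elim exE)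
  \<comment> \<open>Three factors, each with \<open>1/4\<close> from the density of \<open>A\<close>
    in \<open>W\<close> and \<open>1/32\<close> from the moment bound, against the gain
    \<open>n / 8\<close>.\<close>
  have "eventually (\<lambda>n::nat. 4 * (real n powr (3/4) * real n powr (3/32)) < real n / 8) at_top"
    by real_asymp
  then obtain N5 where N5: "\<And>n. N5 \<le> n \<Longrightarrow> 4 * (real n powr (3/4) * real n powr (3/32)) < real n / 8"
    by (auto simp: eventually_at_top_linorder)
  obtain N6 where N6: "K \<le> real N6" using real_arch_simple by blast
  obtain N7 where N7: "4 * (8 * real j) ^ j < real N7" using reals_Archimedean2 by blast
  define N where "N = N1 + N2 + N3 + N4 + N5 + N6 + N7 + 1"
  have "A <#>\<^bsub>alt_group n\<^esub> A <#>\<^bsub>alt_group n\<^esub> A = Alt n"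
    if n: "N \<le> n" and A: "A \<subseteq> W n" and cA: "real n powr (-1/4) * real (card (W n)) \<le> real (card A)" for n A
  proof -
    have nN: "N1 \<le> n" "N2 \<le> n" "N3 \<le> n" "N4 \<le> n" "N5 \<le> n" "N6 \<le> n" "N7 \<le> n" and n1: "1 \<le> n"
      using n by (simp_all add: N_def)
    have Kn: "K \<le> real n" using N6 nN(6) by linarith
    have jn: "4 * (8 * real j) ^ j < real n" using N7 nN(7) by linarith
    have W: "W n \<noteq> {}" "card (Alt n) \<le> card (W n) * n ^ C" "W n \<subseteq> Alt n"
      using N1[OF nN(1)] density(1) by auto
    have finW: "finite (W n)" by (rule finite_subset[OF W(3) finite_Alt])
    have A_Alt: "A \<subseteq> Alt n" and finA: "finite A" using A W(3) finW finite_subset by auto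
    define g a \<omega> where "g = real (card (Alt n))" and "a = real (card A)" and "\<omega> = real (card (W n))"
    have \<omega>: "0 < \<omega>" using finW W(1) by (simp add: \<omega>_def card_gt_0_iff)
    have g: "0 < g" by (simp add: g_def)
    have "0 < n powr (-1/4) * \<omega>" using \<omega> n1 by simp
    then have a: "0 < a" using cA unfolding a_def \<omega>_def by linarith
    have \<omega>a: "\<omega> \<le> n powr (1/4) * a"
    proof -
      have "n powr (1/4) * (n powr (-1/4) * \<omega>) \<le> n powr (1/4) * a"
        using cA unfolding a_def \<omega>_def by (intro mult_left_mono) auto
      then show ?thesis using n1 by (simp add: mult.assoc[symmetric] flip: powr_add)
    qed
    let ?f = "indicator A :: (nat \<Rightarrow> nat) \<Rightarrow> real"
    obtain F where F: "low_degree n D F" "perp n D (\<lambda>x. ?f x - F x)"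
      using low_degree_projection[of n D ?f] by blast
    have ff: "ip n ?f ?f = a"
      using finA A_Alt by (simp add: a_def ip_def indicator_def Int_absorb1 flip: of_bool_conj)
    have mf: "mean n ?f = a / g"
      using A_Alt by (simp add: mean_def a_def g_def indicator_def Int_absorb1)
    show ?thesis
    proof
      show "A <#>\<^bsub>alt_group n\<^esub> A <#>\<^bsub>alt_group n\<^esub> A \<subseteq> Alt n"
        using subsetD[OF A_Alt] by (auto simp: set_mult_def alt_group_mult intro!: Alt_comp)
      show "Alt n \<subseteq> A <#>\<^bsub>alt_group n\<^esub> A <#>\<^bsub>alt_group n\<^esub> A"
      proof
        fix h assume h: "h \<in> Alt n"
        define l u where "l = (\<lambda>x. F x - mean n ?f)" and "u = (\<lambda>x. ?f x - F x)"
        define rf rl where "rf = (\<lambda>x. ?f (inv' x \<circ> h))" and "rl = (\<lambda>x. l (inv' x \<circ> h))"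
        note T = triple_convolution[OF F h, folded l_def u_def, folded rf_def rl_def]
        have rl: "rl = (\<lambda>x. F (inv' x \<circ> h) - mean n ?f)" by (simp add: rl_def l_def)
        have T7: "ip n rl rl = ip n l l" using T(7) by (simp only: rl)
        define X2 X3 where "X2 = ip n (conv n ?f u) rf" and "X3 = ip n (conv n l l) rl"
        define y where "y = a ^ 3 / g"
        have y: "0 < y" using a g by (simp add: y_def)
        \<comment> \<open>The left side counts the ways to write \<open>h\<close> as a product of
          three elements of \<open>A\<close>; \<open>y\<close> is the expected number, and it
          remains to bound the two errors by \<open>y / 2\<close>.\<close>
        have count: "ip n (conv n ?f ?f) rf = y + X2 + X3"
          using T(1) g unfolding X2_def X3_def rl mf
          by (simp add: y_def power_divide power2_eq_square power3_eq_cube flip: g_def)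
        have "\<bar>X2\<bar> < y / 2"
        proof (rule abs_less_half[OF _ _ _ y])
          let ?N = "(real n / (8 * real j)) ^ j"
          show "0 < ?N" using n1 j by simp
          have "X2\<^sup>2 \<le> ip n (conv n ?f u) (conv n ?f u) * ip n rf rf"
            unfolding X2_def by (rule ip_Cauchy)
          then have "X2\<^sup>2 \<le> ip n (conv n ?f u) (conv n ?f u) * a" by (simp only: T(6) ff)
          then have "?N * X2\<^sup>2 \<le> ?N * (ip n (conv n ?f u) (conv n ?f u) * a)"
            by (rule mult_left_mono) simp
          also have "\<dots> = (?N * ip n (conv n ?f u) (conv n ?f u)) * a" by simp
          also have "\<dots> \<le> (g * a * ip n u u) * a"
            using N4[rule_format, OF nN(4), of u ?f] F(2) a
            by (intro mult_right_mono) (simp_all add: g_def u_def D_def ff)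
          also have "\<dots> \<le> (g * a * a) * a"
            using T(5) a g by (intro mult_right_mono mult_left_mono) (simp_all add: ff)
          finally show "?N * X2\<^sup>2 \<le> g * a ^ 3" by (simp add: power3_eq_cube)
          have "g \<le> \<omega> * real n ^ C" using W(2) by (simp add: g_def \<omega>_def flip: of_nat_power of_nat_mult)
          also have "\<dots> \<le> (n powr (1/4) * a) * real n ^ C" using \<omega>a by (rule mult_right_mono) simp
          \<comment> \<open>The quarter power is rounded up to a full one, which keeps the exponents
            integral.\<close>
          also have "\<dots> \<le> (n powr 1 * a) * real n ^ C"
            using n1 a by (intro mult_right_mono powr_mono) auto
          finally have "g \<le> real n ^ (C + 1) * a" using n1 by (simp add: mult_ac)
          then have "g ^ 3 \<le> (real n ^ (C + 1) * a) ^ 3" using g by (intro power_mono) auto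
          also have "\<dots> = real n ^ (3 * C + 3) * a ^ 3"
            by (simp add: power_mult_distrib mult.commute flip: power_mult) (simp add: power_add algebra_simps)
          finally have g3: "g ^ 3 \<le> real n ^ (3 * C + 3) * a ^ 3" .
          have "4 * (g * a ^ 3) * g\<^sup>2 = 4 * g ^ 3 * a ^ 3" by (simp add: power2_eq_square power3_eq_cube)
          also have "\<dots> \<le> 4 * (real n ^ (3 * C + 3) * a ^ 3) * a ^ 3"
            using g3 a by (intro mult_right_mono) auto
          also have "\<dots> = (4 * real n ^ (3 * C + 3)) * (a ^ 3)\<^sup>2" by (simp add: power2_eq_square)
          also have "\<dots> < ?N * (a ^ 3)\<^sup>2"
          proof (rule mult_strict_right_mono)
            have "4 * real n ^ (3 * C + 3) * (8 * real j) ^ j = (4 * (8 * real j) ^ j) * real n ^ (3 * C + 3)" by simp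
            also have "\<dots> < real n * real n ^ (3 * C + 3)"
              using jn n1 by (intro mult_strict_right_mono) auto
            also have "\<dots> = real n ^ j" by (simp add: j_def numeral_eq_Suc)
            finally show "4 * real n ^ (3 * C + 3) < ?N"
              using j by (simp add: power_divide less_divide_eq)
          qed (use a in simp)
          also have "\<dots> = ?N * y\<^sup>2 * g\<^sup>2" using g by (simp add: y_def power_divide)
          finally show "4 * (g * a ^ 3) < ?N * y\<^sup>2" using g by simp
        qed
        moreover have "\<bar>X3\<bar> < y / 2"
        proof (rule abs_less_half[OF _ _ _ y])
          let ?N = "real n / 8" and ?L = "ip n l l" and ?\<kappa> = "n powr (1/32)"
          show "0 < ?N" using n1 by simp
          have t32: "32 * (C + 1) \<le> (2::nat) ^ Suc t"
          proof -
            have "t < 2 ^ t" by (rule less_exp)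
            moreover have "32 * (C + 1) = t" by (simp only: t_def)
            ultimately show ?thesis unfolding power_Suc by linarith
          qed
          have "ip n F F \<le> card A * card (W n) * ?\<kappa> / card (Alt n)"
          proof (rule low_part_bound[OF W(3,1) A _ K Kn n1 W(2) t32 T(4)])
            show "((\<Sum>x\<in>W n. (F x)\<^sup>2) / card (W n)) ^ 2 ^ Suc t
              \<le> K * (card (Alt n) / card (W n)) * mean n (\<lambda>x. (F x)\<^sup>2) ^ 2 ^ Suc t"
              using N2[rule_format, OF nN(2) F(1) W(3,1)] density(2) by blast
          qed
          then have "?L \<le> a * \<omega> * ?\<kappa> / g" using T(3) by (simp add: a_def \<omega>_def g_def)
          also have "\<dots> \<le> a * (n powr (1/4) * a) * ?\<kappa> / g"
            using \<omega>a a g by (intro divide_right_mono mult_right_mono mult_left_mono) auto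
          finally have L: "?L \<le> a * (n powr (1/4) * a) * ?\<kappa> / g" .
          have "X3\<^sup>2 \<le> ip n (conv n l l) (conv n l l) * ip n rl rl"
            unfolding X3_def by (rule ip_Cauchy)
          then have "X3\<^sup>2 \<le> ip n (conv n l l) (conv n l l) * ?L" by (simp only: T7)
          then have "?N * X3\<^sup>2 \<le> ?N * (ip n (conv n l l) (conv n l l) * ?L)"
            by (rule mult_left_mono) simp
          also have "\<dots> = (?N * ip n (conv n l l) (conv n l l)) * ?L" by simp
          \<comment> \<open>Only the vanishing mean of \<open>l\<close> is used, through
            \<open>conv_perp_bound\<close> for \<open>j = 1\<close>.\<close>
          also have "\<dots> \<le> (g * ?L * ?L) * ?L"
            using N3[rule_format, OF nN(3), of l l] T(2)
            by (intro mult_right_mono) (simp_all add: g_def)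
          also have "\<dots> = g * ?L ^ 3" by (simp add: power3_eq_cube)
          also have "\<dots> \<le> g * (a * (n powr (1/4) * a) * ?\<kappa> / g) ^ 3"
            using L g by (intro mult_left_mono power_mono) auto
          also have "\<dots> = (n powr (1/4)) ^ 3 * ?\<kappa> ^ 3 * y\<^sup>2"
            using g by (simp add: y_def power_divide power_mult_distrib power2_eq_square power3_eq_cube)
          also have "\<dots> = (n powr (3/4) * n powr (3/32)) * y\<^sup>2"
            using n1 by (simp add: powr_powr flip: powr_realpow)
          finally show "?N * X3\<^sup>2 \<le> (n powr (3/4) * n powr (3/32)) * y\<^sup>2" .
          show "4 * ((n powr (3/4) * n powr (3/32)) * y\<^sup>2) < ?N * y\<^sup>2"
            using mult_strict_right_mono[OF N5[OF nN(5)], of "y\<^sup>2"] y by (simp add: mult.assoc)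
        qed
        ultimately have "ip n (conv n ?f ?f) rf \<noteq> 0" unfolding count by linarith
        then obtain x where x: "x \<in> Alt n" "conv n ?f ?f x * rf x \<noteq> 0"
          unfolding ip_def by (meson sum.neutral)
        then have "conv n ?f ?f x \<noteq> 0" "inv' x \<circ> h \<in> A" by (auto simp: rf_def indicator_def split: if_splits)
        then obtain z where z: "z \<in> Alt n" "?f (x \<circ> inv' z) * ?f z \<noteq> 0"
          unfolding conv_def by (meson sum.neutral)
        then have zA: "x \<circ> inv' z \<in> A" "z \<in> A" by (auto simp: indicator_def split: if_splits)
        have "(x \<circ> inv' z) \<circ> z \<circ> (inv' x \<circ> h) = x \<circ> (inv' z \<circ> z) \<circ> inv' x \<circ> h" by (simp add: comp_assoc)
        also have "\<dots> = h" using Alt_inv_o[OF z(1)] Alt_inv_o[OF x(1)] by simp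
        finally have "h = (x \<circ> inv' z) \<circ> z \<circ> (inv' x \<circ> h)" by simp
        then show "h \<in> A <#>\<^bsub>alt_group n\<^esub> A <#>\<^bsub>alt_group n\<^esub> A"
          unfolding set_mult_def alt_group_mult using zA \<open>inv' x \<circ> h \<in> A\<close> by blast
      qed
    qed
  qed
  then show ?thesis by (intro exI[of _ N]) (auto simp: W_def)
qed

end
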